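(* Let $\Omega^1$ be an $A$-bimodule that is finitely generated projective both as a right and as a left $A$-module. There is an isomorphism of categories $${}_{IB(\Omega^1)}\mathcal{M}\;\cong\;{}_A\mathcal{IM}_A^{\Omega^1}$$ between the category of left modules over the algebra $IB(\Omega^1)$ and the category ${}_A\mathcal{IM}_A^{\Omega^1}$ of $A$-bimodules with invertible $\Omega^1$-intertwinings.
   Context: Conventions. $\mathbb{K}$ is a field, $A$ a unital associative $\mathbb{K}$-algebra, $\otimes$ means $\otimes_A$. $A^{op}=\{\overline{a}: a\in A\}$ with $\overline{a}\,\overline{b}=\overline{ba}$; $A^e=A\otimes_{\mathbb{K}}A^{op}$ with elements written $a\overline{b}$. $A$-bimodules are identified with left $A^e$-modules via $(a\overline{b})m=amb$. Summation over repeated dual-basis indices is implicit. $T_{A^e}(V)$ is the tensor algebra of an $A^e$-bimodule $V$. Duals. $\mathfrak{X}^1=\mathrm{Hom}_A(\Omega^1,A)$ (right module maps) is the left dual bimodule of $\Omega^1$, with $\mathrm{ev}:\mathfrak{X}^1\otimes\Omega^1\to A$, $\mathrm{ev}(x\otimes\omega)=x(\omega)$, and $\mathrm{coev}:A\to\Omega^1\otimes\mathfrak{X}^1$, $\mathrm{coev}(1)=\omega_i\otimes x_i$. $\mathfrak{Y}^1={}_A\mathrm{Hom}(\Omega^1,A)$ (left module maps) is the right dual bimodule, with $\underline{\mathrm{ev}}:\Omega^1\otimes\mathfrak{Y}^1\to A$, $\underline{\mathrm{ev}}(\omega\otimes y)=y(\omega)$, and $\underline{\mathrm{coev}}:A\to\mathfrak{Y}^1\otimes\Omega^1$,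 $\underline{\mathrm{coev}}(1)=y_j\otimes\rho_j$. The algebra $IB(\Omega^1)$. Let $\mathfrak{Z}=(\mathfrak{X}^1\otimes_{\mathbb{K}}\Omega^1)\oplus(\Omega^1\otimes_{\mathbb{K}}\mathfrak{Y}^1)$; write $(x,\omega)$ for $x\otimes_{\mathbb{K}}\omega$ and $(\rho,y)$ for $\rho\otimes_{\mathbb{K}}y$. $\mathfrak{Z}$ is an $A^e$-bimodule via $a\overline{a'}(x,\omega)b\overline{b'}=(axb,b'\omega a')$ and $a\overline{a'}(\rho,y)b\overline{b'}=(a\rho b,b'ya')$. $IB(\Omega^1)$ is the quotient of $R=T_{A^e}(\mathfrak{Z})$ (product $\bullet$) by the ideal generated by $$(\omega_i,y)\bullet(x_i,\omega)=\overline{\underline{\mathrm{ev}}(\omega\otimes y)},\qquad (x,\rho_j)\bullet(\omega,y_j)=\mathrm{ev}(x\otimes\omega)$$ for all $x\in\mathfrak{X}^1$, $\omega\in\Omega^1$, $y\in\mathfrak{Y}^1$. The category ${}_A\mathcal{IM}_A^{\Omega^1}$. Objects are pairs $(M,\sigma_M)$ with $M$ an $A$-bimodule and $\sigma_M:M\otimes\Omega^1\to\Omega^1\otimes M$ an invertible bimodule map. Morphisms $(M,\sigma_M)\to(N,\sigma_N)$ are bimodule maps $f:M\to N$ with $\sigma_N(f\otimes\mathrm{id}_{\Omega^1})=(\mathrm{id}_{\Omega^1}\otimes f)\sigma_M$. *)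

theory Defs
  imports
    "HOL-Algebra.Module"
    "HOL-Algebra.QuotRing"
    "HOL-Algebra.Product_Groups"
    "HOL-Algebra.Free_Abelian_Groups"
begin

section \<open>Categories and isomorphisms of categories\<close>

text \<open>Composition is indexed by the objects involved: \<open>Comp C X Y Z g f\<close> is \<open>g \<circ> f\<close> for
  \<open>f : X \<rightarrow> Y\<close> and \<open>g : Y \<rightarrow> Z\<close>.\<close>

record ('o, 'f) cat =
  Ob :: "'o set"
  Hom :: "'o \<Rightarrow> 'o \<Rightarrow> 'f set"
  Id :: "'o \<Rightarrow> 'f"
  Comp :: "'o \<Rightarrow> 'o \<Rightarrow> 'o \<Rightarrow> 'f \<Rightarrow> 'f \<Rightarrow> 'f"

locale category =
  fixes C :: "('o, 'f) cat"
  assumes Id_closed: "X \<in> Ob C \<Longrightarrow> Id C X \<in> Hom C X X"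
    and Comp_closed:
      "\<lbrakk>X \<in> Ob C; Y \<in> Ob C; Z \<in> Ob C; f \<in> Hom C X Y; g \<in> Hom C Y Z\<rbrakk>
        \<Longrightarrow> Comp C X Y Z g f \<in> Hom C X Z"
    and Id_left: "\<lbrakk>X \<in> Ob C; Y \<in> Ob C; f \<in> Hom C X Y\<rbrakk> \<Longrightarrow> Comp C X Y Y (Id C Y) f = f"
    and Id_right: "\<lbrakk>X \<in> Ob C; Y \<in> Ob C; f \<in> Hom C X Y\<rbrakk> \<Longrightarrow> Comp C X X Y f (Id C X) = f"
    and Comp_assoc:
      "\<lbrakk>X \<in> Ob C; Y \<in> Ob C; Z \<in> Ob C; U \<in> Ob C;
        f \<in> Hom C X Y; g \<in> Hom C Y Z; h \<in> Hom C Z U\<rbrakk>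
        \<Longrightarrow> Comp C X Z U h (Comp C X Y Z g f) = Comp C X Y U (Comp C Y Z U h g) f"

locale cat_functor = C: category C + D: category D
  for C :: "('o, 'f) cat" and D :: "('p, 'g) cat" +
  fixes Fo :: "'o \<Rightarrow> 'p" and Fm :: "'o \<Rightarrow> 'o \<Rightarrow> 'f \<Rightarrow> 'g"
  assumes Fo_closed: "X \<in> Ob C \<Longrightarrow> Fo X \<in> Ob D"
    and Fm_closed:
      "\<lbrakk>X \<in> Ob C; Y \<in> Ob C; f \<in> Hom C X Y\<rbrakk> \<Longrightarrow> Fm X Y f \<in> Hom D (Fo X) (Fo Y)"
    and Fm_Id: "X \<in> Ob C \<Longrightarrow> Fm X X (Id C X) = Id D (Fo X)"
    and Fm_Comp:
      "\<lbrakk>X \<in> Ob C; Y \<in> Ob C; Z \<in> Ob C; f \<in> Hom C X Y; g \<in> Hom C Y Z\<rbrakk>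
        \<Longrightarrow> Fm X Z (Comp C X Y Z g f) = Comp D (Fo X) (Fo Y) (Fo Z) (Fm Y Z g) (Fm X Y f)"

definition isomorphic_categories :: "('o, 'f) cat \<Rightarrow> ('p, 'g) cat \<Rightarrow> bool" where
  "isomorphic_categories C D \<longleftrightarrow>
    (\<exists>Fo Fm Go Gm. cat_functor C D Fo Fm \<and> cat_functor D C Go Gm
      \<and> (\<forall>X\<in>Ob C. Go (Fo X) = X)
      \<and> (\<forall>Y\<in>Ob D. Fo (Go Y) = Y)
      \<and> (\<forall>X\<in>Ob C. \<forall>Y\<in>Ob C. \<forall>f\<in>Hom C X Y. Gm (Fo X) (Fo Y) (Fm X Y f) = f)
      \<and> (\<forall>X\<in>Ob D. \<forall>Y\<in>Ob D. \<forall>g\<in>Hom D X Y. Fm (Go X) (Go Y) (Gm X Y g) = g))"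


section \<open>Algebras, modules, bimodules\<close>

locale k_algebra = K: field K + A: ring A + KA: module K A
  for K :: "('k, 'x) ring_scheme" and A :: "('k, 'a, 'y) module_scheme" +
  assumes smult_mult_left:
    "\<lbrakk>k \<in> carrier K; a \<in> carrier A; b \<in> carrier A\<rbrakk>
      \<Longrightarrow> (k \<odot>\<^bsub>A\<^esub> a) \<otimes>\<^bsub>A\<^esub> b = k \<odot>\<^bsub>A\<^esub> (a \<otimes>\<^bsub>A\<^esub> b)"
    and smult_mult_right:
    "\<lbrakk>k \<in> carrier K; a \<in> carrier A; b \<in> carrier A\<rbrakk>
      \<Longrightarrow> a \<otimes>\<^bsub>A\<^esub> (k \<odot>\<^bsub>A\<^esub> b) = k \<odot>\<^bsub>A\<^esub> (a \<otimes>\<^bsub>A\<^esub> b)"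

text \<open>The underlying abelian group of a module is a \<open>monoid\<close> record, so the module addition is
  written \<open>\<otimes>\<^bsub>M\<^esub>\<close> and its zero \<open>\<one>\<^bsub>M\<^esub>\<close>.\<close>

record ('r, 'm) lmod = "'m monoid" +
  lact :: "'r \<Rightarrow> 'm \<Rightarrow> 'm" (infixr "\<rightharpoonup>\<index>" 75)

record ('r, 's, 'm) bimod = "('r, 'm) lmod" +
  ract :: "'m \<Rightarrow> 's \<Rightarrow> 'm" (infixl "\<leftharpoonup>\<index>" 75)

definition bimod_on ::
  "('m, 'x) monoid_scheme \<Rightarrow> ('r \<Rightarrow> 'm \<Rightarrow> 'm) \<Rightarrow> ('m \<Rightarrow> 's \<Rightarrow> 'm) \<Rightarrow> ('r, 's, 'm) bimod" where
  "bimod_on G l r =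
    \<lparr>carrier = carrier G, monoid.mult = monoid.mult G, one = one G, lact = l, ract = r\<rparr>"

locale left_mod = R: ring R + M: comm_group M
  for R :: "('r, 'x) ring_scheme" and M :: "('r, 'm, 'y) lmod_scheme" +
  assumes lact_closed: "\<lbrakk>r \<in> carrier R; m \<in> carrier M\<rbrakk> \<Longrightarrow> r \<rightharpoonup>\<^bsub>M\<^esub> m \<in> carrier M"
    and lact_add: "\<lbrakk>r \<in> carrier R; m \<in> carrier M; n \<in> carrier M\<rbrakk>
      \<Longrightarrow> r \<rightharpoonup>\<^bsub>M\<^esub> (m \<otimes>\<^bsub>M\<^esub> n) = (r \<rightharpoonup>\<^bsub>M\<^esub> m) \<otimes>\<^bsub>M\<^esub> (r \<rightharpoonup>\<^bsub>M\<^esub> n)"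
    and add_lact: "\<lbrakk>r \<in> carrier R; s \<in> carrier R; m \<in> carrier M\<rbrakk>
      \<Longrightarrow> (r \<oplus>\<^bsub>R\<^esub> s) \<rightharpoonup>\<^bsub>M\<^esub> m = (r \<rightharpoonup>\<^bsub>M\<^esub> m) \<otimes>\<^bsub>M\<^esub> (s \<rightharpoonup>\<^bsub>M\<^esub> m)"
    and mult_lact: "\<lbrakk>r \<in> carrier R; s \<in> carrier R; m \<in> carrier M\<rbrakk>
      \<Longrightarrow> (r \<otimes>\<^bsub>R\<^esub> s) \<rightharpoonup>\<^bsub>M\<^esub> m = r \<rightharpoonup>\<^bsub>M\<^esub> s \<rightharpoonup>\<^bsub>M\<^esub> m"
    and one_lact: "m \<in> carrier M \<Longrightarrow> \<one>\<^bsub>R\<^esub> \<rightharpoonup>\<^bsub>M\<^esub> m = m"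

text \<open>Since \<open>A\<close>-bimodules are to be the same as left modules over \<open>A \<otimes>\<^sub>K A\<^sup>o\<^sup>p\<close>, the two actions
  of \<open>K\<close> on a bimodule have to agree (\<open>K_central\<close>).\<close>

locale bimodule = k_algebra K A + left_mod A M
  for K :: "('k, 'x) ring_scheme" and A :: "('k, 'a, 'y) module_scheme"
    and M :: "('a, 'a, 'm, 'z) bimod_scheme" +
  assumes ract_closed: "\<lbrakk>m \<in> carrier M; a \<in> carrier A\<rbrakk> \<Longrightarrow> m \<leftharpoonup>\<^bsub>M\<^esub> a \<in> carrier M"
    and add_ract: "\<lbrakk>m \<in> carrier M; n \<in> carrier M; a \<in> carrier A\<rbrakk>
      \<Longrightarrow> (m \<otimes>\<^bsub>M\<^esub> n) \<leftharpoonup>\<^bsub>M\<^esub> a = (m \<leftharpoonup>\<^bsub>M\<^esub> a) \<otimes>\<^bsub>M\<^esub> (n \<leftharpoonup>\<^bsub>M\<^esub> a)"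
    and ract_add: "\<lbrakk>m \<in> carrier M; a \<in> carrier A; b \<in> carrier A\<rbrakk>
      \<Longrightarrow> m \<leftharpoonup>\<^bsub>M\<^esub> (a \<oplus>\<^bsub>A\<^esub> b) = (m \<leftharpoonup>\<^bsub>M\<^esub> a) \<otimes>\<^bsub>M\<^esub> (m \<leftharpoonup>\<^bsub>M\<^esub> b)"
    and ract_mult: "\<lbrakk>m \<in> carrier M; a \<in> carrier A; b \<in> carrier A\<rbrakk>
      \<Longrightarrow> m \<leftharpoonup>\<^bsub>M\<^esub> (a \<otimes>\<^bsub>A\<^esub> b) = m \<leftharpoonup>\<^bsub>M\<^esub> a \<leftharpoonup>\<^bsub>M\<^esub> b"
    and ract_one: "m \<in> carrier M \<Longrightarrow> m \<leftharpoonup>\<^bsub>M\<^esub> \<one>\<^bsub>A\<^esub> = m"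
    and lact_ract: "\<lbrakk>m \<in> carrier M; a \<in> carrier A; b \<in> carrier A\<rbrakk>
      \<Longrightarrow> (a \<rightharpoonup>\<^bsub>M\<^esub> m) \<leftharpoonup>\<^bsub>M\<^esub> b = a \<rightharpoonup>\<^bsub>M\<^esub> (m \<leftharpoonup>\<^bsub>M\<^esub> b)"
    and K_central: "\<lbrakk>k \<in> carrier K; m \<in> carrier M\<rbrakk>
      \<Longrightarrow> (k \<odot>\<^bsub>A\<^esub> \<one>\<^bsub>A\<^esub>) \<rightharpoonup>\<^bsub>M\<^esub> m = m \<leftharpoonup>\<^bsub>M\<^esub> (k \<odot>\<^bsub>A\<^esub> \<one>\<^bsub>A\<^esub>)"

text \<open>Module maps are extensional functions, so that they are determined by their values on the
  carrier.\<close>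

definition lmod_hom ::
  "('r, 'x) ring_scheme \<Rightarrow> ('r, 'm, 'y) lmod_scheme \<Rightarrow> ('r, 'n, 'z) lmod_scheme \<Rightarrow> ('m \<Rightarrow> 'n) set"
  where
  "lmod_hom R M N = {f \<in> hom M N \<inter> extensional (carrier M).
     \<forall>r\<in>carrier R. \<forall>m\<in>carrier M. f (r \<rightharpoonup>\<^bsub>M\<^esub> m) = r \<rightharpoonup>\<^bsub>N\<^esub> f m}"

definition rmod_hom ::
  "('s, 'x) ring_scheme \<Rightarrow> ('r, 's, 'm, 'y) bimod_scheme \<Rightarrow> ('q, 's, 'n, 'z) bimod_scheme
    \<Rightarrow> ('m \<Rightarrow> 'n) set" where
  "rmod_hom S M N = {f \<in> hom M N \<inter> extensional (carrier M).
     \<forall>s\<in>carrier S. \<forall>m\<in>carrier M. f (m \<leftharpoonup>\<^bsub>M\<^esub> s) = f m \<leftharpoonup>\<^bsub>N\<^esub> s}"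

definition bimod_hom ::
  "('a, 'x) ring_scheme \<Rightarrow> ('a, 'a, 'm, 'y) bimod_scheme \<Rightarrow> ('a, 'a, 'n, 'z) bimod_scheme
    \<Rightarrow> ('m \<Rightarrow> 'n) set" where
  "bimod_hom A M N = lmod_hom A M N \<inter> rmod_hom A M N"

definition reg_bimod :: "('a, 'x) ring_scheme \<Rightarrow> ('a, 'a, 'a) bimod" where
  "reg_bimod A = bimod_on (add_monoid A) (\<lambda>a b. a \<otimes>\<^bsub>A\<^esub> b) (\<lambda>a b. a \<otimes>\<^bsub>A\<^esub> b)"

definition free_bimod :: "('a, 'x) ring_scheme \<Rightarrow> nat \<Rightarrow> ('a, 'a, nat \<Rightarrow> 'a) bimod" where
  "free_bimod A n = bimod_on (product_group {..<n} (\<lambda>_. add_monoid A))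
     (\<lambda>a v. \<lambda>i\<in>{..<n}. a \<otimes>\<^bsub>A\<^esub> v i) (\<lambda>v a. \<lambda>i\<in>{..<n}. v i \<otimes>\<^bsub>A\<^esub> a)"

text \<open>Finitely generated projective: (isomorphic to) a direct summand of some \<open>A\<^sup>n\<close>, with inclusion
  \<open>j\<close> and projection \<open>p\<close>.\<close>

definition fgp_right :: "('a, 'x) ring_scheme \<Rightarrow> ('a, 'a, 'm, 'y) bimod_scheme \<Rightarrow> bool" where
  "fgp_right A M \<longleftrightarrow> (\<exists>n. \<exists>j\<in>rmod_hom A M (free_bimod A n). \<exists>p\<in>rmod_hom A (free_bimod A n) M.
     \<forall>m\<in>carrier M. p (j m) = m)"

definition fgp_left :: "('a, 'x) ring_scheme \<Rightarrow> ('a, 'a, 'm, 'y) bimod_scheme \<Rightarrow> bool" where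
  "fgp_left A M \<longleftrightarrow> (\<exists>n. \<exists>j\<in>lmod_hom A M (free_bimod A n). \<exists>p\<in>lmod_hom A (free_bimod A n) M.
     \<forall>m\<in>carrier M. p (j m) = m)"


section \<open>Tensor products\<close>

text \<open>\<open>agp S E\<close> is the abelian group generated by \<open>S\<close> subject to the relations \<open>e = 0\<close> for
  \<open>e \<in> E\<close>, and \<open>agp_gen S E s\<close> is the class of the generator \<open>s\<close>.  If \<open>\<phi> : S \<rightarrow> G\<close> respects the
  relations, then \<open>agp_ext G \<phi>\<close> is the induced homomorphism \<open>agp S E \<rightarrow> G\<close>; it is meaningful only
  in that case, because \<open>free_ext G \<phi>\<close> must be constant on cosets.\<close>

definition agp :: "'s set \<Rightarrow> ('s \<Rightarrow>\<^sub>0 int) set \<Rightarrow> ('s \<Rightarrow>\<^sub>0 int) set monoid" where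
  "agp S E = free_Abelian_group S Mod generate (free_Abelian_group S) E"

definition agp_gen :: "'s set \<Rightarrow> ('s \<Rightarrow>\<^sub>0 int) set \<Rightarrow> 's \<Rightarrow> ('s \<Rightarrow>\<^sub>0 int) set" where
  "agp_gen S E s =
     generate (free_Abelian_group S) E #>\<^bsub>free_Abelian_group S\<^esub> frag_of s"

definition free_ext :: "('g, 'x) monoid_scheme \<Rightarrow> ('s \<Rightarrow> 'g) \<Rightarrow> ('s \<Rightarrow>\<^sub>0 int) \<Rightarrow> 'g" where
  "free_ext G \<phi> c =
     (\<Otimes>\<^bsub>G\<^esub>s\<in>Poly_Mapping.keys c. \<phi> s [^]\<^bsub>G\<^esub> Poly_Mapping.lookup c s)"

definition agp_ext :: "('g, 'x) monoid_scheme \<Rightarrow> ('s \<Rightarrow> 'g) \<Rightarrow> ('s \<Rightarrow>\<^sub>0 int) set \<Rightarrow> 'g" where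
  "agp_ext G \<phi> t = the_elem (free_ext G \<phi> ` t)"

text \<open>The tensor product of \<open>M\<close> and \<open>N\<close> over \<open>R\<close>, where \<open>r\<close> and \<open>l\<close> are the right action of \<open>R\<close>
  on \<open>M\<close> and the left action of \<open>R\<close> on \<open>N\<close>.\<close>

definition tens_rels ::
  "'r set \<Rightarrow> ('m, 'x) monoid_scheme \<Rightarrow> ('m \<Rightarrow> 'r \<Rightarrow> 'm) \<Rightarrow> ('n, 'y) monoid_scheme
    \<Rightarrow> ('r \<Rightarrow> 'n \<Rightarrow> 'n) \<Rightarrow> (('m \<times> 'n) \<Rightarrow>\<^sub>0 int) set" where
  "tens_rels R M r N l =
     {frag_of (m \<otimes>\<^bsub>M\<^esub> m', n) - frag_of (m, n) - frag_of (m', n) | m m' n.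
        m \<in> carrier M \<and> m' \<in> carrier M \<and> n \<in> carrier N}
   \<union> {frag_of (m, n \<otimes>\<^bsub>N\<^esub> n') - frag_of (m, n) - frag_of (m, n') | m n n'.
        m \<in> carrier M \<and> n \<in> carrier N \<and> n' \<in> carrier N}
   \<union> {frag_of (r m a, n) - frag_of (m, l a n) | m a n.
        m \<in> carrier M \<and> a \<in> R \<and> n \<in> carrier N}"

definition tens ::
  "'r set \<Rightarrow> ('m, 'x) monoid_scheme \<Rightarrow> ('m \<Rightarrow> 'r \<Rightarrow> 'm) \<Rightarrow> ('n, 'y) monoid_scheme
    \<Rightarrow> ('r \<Rightarrow> 'n \<Rightarrow> 'n) \<Rightarrow> (('m \<times> 'n) \<Rightarrow>\<^sub>0 int) set monoid" where
  "tens R M r N l = agp (carrier M \<times> carrier N) (tens_rels R M r N l)"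

definition pure_tens ::
  "'r set \<Rightarrow> ('m, 'x) monoid_scheme \<Rightarrow> ('m \<Rightarrow> 'r \<Rightarrow> 'm) \<Rightarrow> ('n, 'y) monoid_scheme
    \<Rightarrow> ('r \<Rightarrow> 'n \<Rightarrow> 'n) \<Rightarrow> 'm \<Rightarrow> 'n \<Rightarrow> (('m \<times> 'n) \<Rightarrow>\<^sub>0 int) set" where
  "pure_tens R M r N l m n = agp_gen (carrier M \<times> carrier N) (tens_rels R M r N l) (m, n)"

text \<open>\<open>M \<otimes>\<^sub>A N\<close> as an \<open>A\<close>-bimodule, and \<open>f \<otimes> g\<close> as a map into \<open>M' \<otimes>\<^sub>A N'\<close>.\<close>

definition tensA_pure ::
  "('a, 'x) ring_scheme \<Rightarrow> ('a, 'a, 'm, 'y) bimod_scheme \<Rightarrow> ('a, 'a, 'n, 'z) bimod_scheme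
    \<Rightarrow> 'm \<Rightarrow> 'n \<Rightarrow> (('m \<times> 'n) \<Rightarrow>\<^sub>0 int) set" where
  "tensA_pure A M N = pure_tens (carrier A) M (ract M) N (lact N)"

definition tensA ::
  "('a, 'x) ring_scheme \<Rightarrow> ('a, 'a, 'm, 'y) bimod_scheme \<Rightarrow> ('a, 'a, 'n, 'z) bimod_scheme
    \<Rightarrow> ('a, 'a, (('m \<times> 'n) \<Rightarrow>\<^sub>0 int) set) bimod" where
  "tensA A M N =
    (let T = tens (carrier A) M (ract M) N (lact N)
     in bimod_on T
          (\<lambda>a. agp_ext T (\<lambda>(m, n). tensA_pure A M N (a \<rightharpoonup>\<^bsub>M\<^esub> m) n))
          (\<lambda>t a. agp_ext T (\<lambda>(m, n). tensA_pure A M N m (n \<leftharpoonup>\<^bsub>N\<^esub> a)) t))"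

definition tensA_map ::
  "('a, 'x) ring_scheme \<Rightarrow> ('a, 'a, 'm, 'y) bimod_scheme \<Rightarrow> ('a, 'a, 'n, 'z) bimod_scheme
    \<Rightarrow> ('p \<Rightarrow> 'm) \<Rightarrow> ('q \<Rightarrow> 'n) \<Rightarrow> (('p \<times> 'q) \<Rightarrow>\<^sub>0 int) set \<Rightarrow> (('m \<times> 'n) \<Rightarrow>\<^sub>0 int) set" where
  "tensA_map A M' N' f g = agp_ext (tensA A M' N') (\<lambda>(m, n). tensA_pure A M' N' (f m) (g n))"


section \<open>The enveloping algebra\<close>

text \<open>\<open>env_pure K A a b\<close> is the element \<open>a b\<close>-bar of \<open>A\<^sup>e\<close>; the second tensor factor has the
  opposite multiplication.\<close>

definition env_pure ::
  "('k, 'x) ring_scheme \<Rightarrow> ('k, 'a, 'y) module_scheme \<Rightarrow> 'a \<Rightarrow> 'a \<Rightarrow> (('a \<times> 'a) \<Rightarrow>\<^sub>0 int) set"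
  where
  "env_pure K A = pure_tens (carrier K)
     (add_monoid A) (\<lambda>a k. k \<odot>\<^bsub>A\<^esub> a) (add_monoid A) (\<lambda>k a. k \<odot>\<^bsub>A\<^esub> a)"

definition env_alg ::
  "('k, 'x) ring_scheme \<Rightarrow> ('k, 'a, 'y) module_scheme \<Rightarrow> (('a \<times> 'a) \<Rightarrow>\<^sub>0 int) set ring" where
  "env_alg K A =
    (let T = tens (carrier K) (add_monoid A) (\<lambda>a k. k \<odot>\<^bsub>A\<^esub> a) (add_monoid A) (\<lambda>k a. k \<odot>\<^bsub>A\<^esub> a)
     in \<lparr>carrier = carrier T,
         monoid.mult = (\<lambda>s t. agp_ext T (\<lambda>(a, a').
            agp_ext T (\<lambda>(b, b'). env_pure K A (a \<otimes>\<^bsub>A\<^esub> b) (b' \<otimes>\<^bsub>A\<^esub> a')) t) s),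
         one = env_pure K A \<one>\<^bsub>A\<^esub> \<one>\<^bsub>A\<^esub>,
         ring.zero = one T,
         ring.add = monoid.mult T\<rparr>)"

text \<open>\<open>M \<otimes>\<^sub>K N\<close> for \<open>A\<close>-bimodules \<open>M\<close> and \<open>N\<close>, as an \<open>A\<^sup>e\<close>-bimodule: writing \<open>a a'\<close>-bar for the
  elements of \<open>A\<^sup>e\<close>, the actions are \<open>(a a'-bar) (m, n) (b b'-bar) = (a m b, b' n a')\<close>.\<close>

definition tensK_pure ::
  "('k, 'x) ring_scheme \<Rightarrow> ('k, 'a, 'y) module_scheme \<Rightarrow> ('a, 'a, 'm, 'u) bimod_scheme
    \<Rightarrow> ('a, 'a, 'n, 'v) bimod_scheme \<Rightarrow> 'm \<Rightarrow> 'n \<Rightarrow> (('m \<times> 'n) \<Rightarrow>\<^sub>0 int) set" where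
  "tensK_pure K A M N = pure_tens (carrier K)
     M (\<lambda>m k. m \<leftharpoonup>\<^bsub>M\<^esub> (k \<odot>\<^bsub>A\<^esub> \<one>\<^bsub>A\<^esub>)) N (\<lambda>k n. (k \<odot>\<^bsub>A\<^esub> \<one>\<^bsub>A\<^esub>) \<rightharpoonup>\<^bsub>N\<^esub> n)"

definition tensK ::
  "('k, 'x) ring_scheme \<Rightarrow> ('k, 'a, 'y) module_scheme \<Rightarrow> ('a, 'a, 'm, 'u) bimod_scheme
    \<Rightarrow> ('a, 'a, 'n, 'v) bimod_scheme
    \<Rightarrow> ((('a \<times> 'a) \<Rightarrow>\<^sub>0 int) set, (('a \<times> 'a) \<Rightarrow>\<^sub>0 int) set, (('m \<times> 'n) \<Rightarrow>\<^sub>0 int) set) bimod" where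
  "tensK K A M N =
    (let T = tens (carrier K)
               M (\<lambda>m k. m \<leftharpoonup>\<^bsub>M\<^esub> (k \<odot>\<^bsub>A\<^esub> \<one>\<^bsub>A\<^esub>)) N (\<lambda>k n. (k \<odot>\<^bsub>A\<^esub> \<one>\<^bsub>A\<^esub>) \<rightharpoonup>\<^bsub>N\<^esub> n)
     in bimod_on T
          (\<lambda>s t. agp_ext T (\<lambda>(a, a').
             agp_ext T (\<lambda>(m, n). tensK_pure K A M N (a \<rightharpoonup>\<^bsub>M\<^esub> m) (n \<leftharpoonup>\<^bsub>N\<^esub> a')) t) s)
          (\<lambda>t s. agp_ext T (\<lambda>(b, b').
             agp_ext T (\<lambda>(m, n). tensK_pure K A M N (m \<leftharpoonup>\<^bsub>M\<^esub> b) (b' \<rightharpoonup>\<^bsub>N\<^esub> n)) t) s))"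

definition bimod_sum ::
  "('r, 's, 'm, 'x) bimod_scheme \<Rightarrow> ('r, 's, 'n, 'y) bimod_scheme \<Rightarrow> ('r, 's, 'm \<times> 'n) bimod"
  where
  "bimod_sum M N = bimod_on (M \<times>\<times> N)
     (\<lambda>r (m, n). (r \<rightharpoonup>\<^bsub>M\<^esub> m, r \<rightharpoonup>\<^bsub>N\<^esub> n)) (\<lambda>(m, n) s. (m \<leftharpoonup>\<^bsub>M\<^esub> s, n \<leftharpoonup>\<^bsub>N\<^esub> s))"


section \<open>The tensor algebra of a bimodule\<close>

text \<open>The tensor algebra \<open>B \<oplus> V \<oplus> (V \<otimes>\<^sub>B V) \<oplus> \<dots>\<close> of a \<open>B\<close>-bimodule \<open>V\<close>.  All degrees are
  presented at once: \<open>Inl b\<close> stands for \<open>b\<close> in degree \<open>0\<close>, and \<open>Inr [v\<^sub>1, \<dots>, v\<^sub>n]\<close> with \<open>n \<ge> 1\<close> for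
  \<open>v\<^sub>1 \<otimes> \<dots> \<otimes> v\<^sub>n\<close> in degree \<open>n\<close>.  The relations are additivity in degree \<open>0\<close>, and multiadditivity
  and \<open>B\<close>-balancedness in degree \<open>n\<close>.  Each relation involves a single degree, so the quotient group
  is the direct sum of \<open>B\<close> and of the \<open>n\<close>-fold tensor powers of \<open>V\<close>.\<close>

definition tword :: "('b, 'x) ring_scheme \<Rightarrow> ('b, 'b, 'v, 'y) bimod_scheme \<Rightarrow> ('b + 'v list) set"
  where
  "tword B V = Inl ` carrier B \<union> Inr ` {vs. vs \<noteq> [] \<and> set vs \<subseteq> carrier V}"

definition tword_rels ::
  "('b, 'x) ring_scheme \<Rightarrow> ('b, 'b, 'v, 'y) bimod_scheme \<Rightarrow> (('b + 'v list) \<Rightarrow>\<^sub>0 int) set" where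
  "tword_rels B V =
     {frag_of (Inl (b \<oplus>\<^bsub>B\<^esub> c)) - frag_of (Inl b) - frag_of (Inl c) | b c.
        b \<in> carrier B \<and> c \<in> carrier B}
   \<union> {frag_of (Inr (us @ [v \<otimes>\<^bsub>V\<^esub> w] @ ws)) - frag_of (Inr (us @ [v] @ ws))
        - frag_of (Inr (us @ [w] @ ws)) | us v w ws.
        set us \<subseteq> carrier V \<and> v \<in> carrier V \<and> w \<in> carrier V \<and> set ws \<subseteq> carrier V}
   \<union> {frag_of (Inr (us @ [v \<leftharpoonup>\<^bsub>V\<^esub> b, w] @ ws)) - frag_of (Inr (us @ [v, b \<rightharpoonup>\<^bsub>V\<^esub> w] @ ws))
        | us v b w ws.
        set us \<subseteq> carrier V \<and> v \<in> carrier V \<and> b \<in> carrier B \<and> w \<in> carrier V \<and> set ws \<subseteq> carrier V}"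

fun tword_mult ::
  "('b, 'x) ring_scheme \<Rightarrow> ('b, 'b, 'v, 'y) bimod_scheme
    \<Rightarrow> 'b + 'v list \<Rightarrow> 'b + 'v list \<Rightarrow> 'b + 'v list" where
  "tword_mult B V (Inl b) (Inl c) = Inl (b \<otimes>\<^bsub>B\<^esub> c)"
| "tword_mult B V (Inl b) (Inr vs) = Inr ((b \<rightharpoonup>\<^bsub>V\<^esub> hd vs) # tl vs)"
| "tword_mult B V (Inr vs) (Inl c) = Inr (butlast vs @ [last vs \<leftharpoonup>\<^bsub>V\<^esub> c])"
| "tword_mult B V (Inr vs) (Inr ws) = Inr (vs @ ws)"

definition tens_alg ::
  "('b, 'x) ring_scheme \<Rightarrow> ('b, 'b, 'v, 'y) bimod_scheme \<Rightarrow> (('b + 'v list) \<Rightarrow>\<^sub>0 int) set ring"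
  where
  "tens_alg B V =
    (let T = agp (tword B V) (tword_rels B V)
     in \<lparr>carrier = carrier T,
         monoid.mult = (\<lambda>s t. agp_ext T (\<lambda>g. agp_ext T (\<lambda>h.
            agp_gen (tword B V) (tword_rels B V) (tword_mult B V g h)) t) s),
         one = agp_gen (tword B V) (tword_rels B V) (Inl \<one>\<^bsub>B\<^esub>),
         ring.zero = one T,
         ring.add = monoid.mult T\<rparr>)"

definition ta_base ::
  "('b, 'x) ring_scheme \<Rightarrow> ('b, 'b, 'v, 'y) bimod_scheme \<Rightarrow> 'b \<Rightarrow> (('b + 'v list) \<Rightarrow>\<^sub>0 int) set" where
  "ta_base B V b = agp_gen (tword B V) (tword_rels B V) (Inl b)"

definition ta_gen ::
  "('b, 'x) ring_scheme \<Rightarrow> ('b, 'b, 'v, 'y) bimod_scheme \<Rightarrow> 'v \<Rightarrow> (('b + 'v list) \<Rightarrow>\<^sub>0 int) set" where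
  "ta_gen B V v = agp_gen (tword B V) (tword_rels B V) (Inr [v])"


section \<open>Dual bimodules\<close>

definition left_dual ::
  "('a, 'x) ring_scheme \<Rightarrow> ('a, 'a, 'w, 'y) bimod_scheme \<Rightarrow> ('a, 'a, 'w \<Rightarrow> 'a) bimod" where
  "left_dual A \<Omega> = bimod_on
     \<lparr>carrier = rmod_hom A \<Omega> (reg_bimod A),
      monoid.mult = (\<lambda>x x'. \<lambda>\<omega>\<in>carrier \<Omega>. x \<omega> \<oplus>\<^bsub>A\<^esub> x' \<omega>),
      one = (\<lambda>\<omega>\<in>carrier \<Omega>. \<zero>\<^bsub>A\<^esub>)\<rparr>
     (\<lambda>a x. \<lambda>\<omega>\<in>carrier \<Omega>. a \<otimes>\<^bsub>A\<^esub> x \<omega>) (\<lambda>x a. \<lambda>\<omega>\<in>carrier \<Omega>. x (a \<rightharpoonup>\<^bsub>\<Omega>\<^esub> \<omega>))"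

definition right_dual ::
  "('a, 'x) ring_scheme \<Rightarrow> ('a, 'a, 'w, 'y) bimod_scheme \<Rightarrow> ('a, 'a, 'w \<Rightarrow> 'a) bimod" where
  "right_dual A \<Omega> = bimod_on
     \<lparr>carrier = lmod_hom A \<Omega> (reg_bimod A),
      monoid.mult = (\<lambda>y y'. \<lambda>\<omega>\<in>carrier \<Omega>. y \<omega> \<oplus>\<^bsub>A\<^esub> y' \<omega>),
      one = (\<lambda>\<omega>\<in>carrier \<Omega>. \<zero>\<^bsub>A\<^esub>)\<rparr>
     (\<lambda>a y. \<lambda>\<omega>\<in>carrier \<Omega>. y (\<omega> \<leftharpoonup>\<^bsub>\<Omega>\<^esub> a)) (\<lambda>y a. \<lambda>\<omega>\<in>carrier \<Omega>. y \<omega> \<otimes>\<^bsub>A\<^esub> a)"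

text \<open>\<open>is_coev\<close> says that the pairs \<open>(\<omega>\<^sub>i, x\<^sub>i)\<close> in the list satisfy \<open>coev(1) = \<Sum>\<^sub>i \<omega>\<^sub>i \<otimes> x\<^sub>i\<close>, i.e.
  both triangle identities \<open>\<Sum>\<^sub>i \<omega>\<^sub>i x\<^sub>i(\<omega>) = \<omega>\<close> and \<open>\<Sum>\<^sub>i x(\<omega>\<^sub>i) x\<^sub>i = x\<close>; \<open>is_coev'\<close> is the
  corresponding statement for the pairs \<open>(y\<^sub>j, \<rho>\<^sub>j)\<close> and the underlined coevaluation.  Such lists
  exist when \<open>\<Omega>\<close> is finitely generated projective on the relevant side; one of them is fixed, as
  the ideal defining \<open>IB\<close> does not depend on the choice.\<close>

definition is_coev ::
  "('a, 'x) ring_scheme \<Rightarrow> ('a, 'a, 'w, 'y) bimod_scheme \<Rightarrow> ('w \<times> ('w \<Rightarrow> 'a)) list \<Rightarrow> bool" where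
  "is_coev A \<Omega> ds \<longleftrightarrow>
     set ds \<subseteq> carrier \<Omega> \<times> carrier (left_dual A \<Omega>)
   \<and> (\<forall>\<omega>\<in>carrier \<Omega>. (\<Otimes>\<^bsub>\<Omega>\<^esub>i\<in>{..<length ds}. fst (ds ! i) \<leftharpoonup>\<^bsub>\<Omega>\<^esub> snd (ds ! i) \<omega>) = \<omega>)
   \<and> (\<forall>x\<in>carrier (left_dual A \<Omega>).
        (\<Otimes>\<^bsub>left_dual A \<Omega>\<^esub>i\<in>{..<length ds}. x (fst (ds ! i)) \<rightharpoonup>\<^bsub>left_dual A \<Omega>\<^esub> snd (ds ! i)) = x)"

definition is_coev' ::
  "('a, 'x) ring_scheme \<Rightarrow> ('a, 'a, 'w, 'y) bimod_scheme \<Rightarrow> (('w \<Rightarrow> 'a) \<times> 'w) list \<Rightarrow> bool" where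
  "is_coev' A \<Omega> ds \<longleftrightarrow>
     set ds \<subseteq> carrier (right_dual A \<Omega>) \<times> carrier \<Omega>
   \<and> (\<forall>\<omega>\<in>carrier \<Omega>. (\<Otimes>\<^bsub>\<Omega>\<^esub>i\<in>{..<length ds}. fst (ds ! i) \<omega> \<rightharpoonup>\<^bsub>\<Omega>\<^esub> snd (ds ! i)) = \<omega>)
   \<and> (\<forall>y\<in>carrier (right_dual A \<Omega>).
        (\<Otimes>\<^bsub>right_dual A \<Omega>\<^esub>i\<in>{..<length ds}. fst (ds ! i) \<leftharpoonup>\<^bsub>right_dual A \<Omega>\<^esub> y (snd (ds ! i))) = y)"

definition coev :: "('a, 'x) ring_scheme \<Rightarrow> ('a, 'a, 'w, 'y) bimod_scheme \<Rightarrow> ('w \<times> ('w \<Rightarrow> 'a)) list"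
  where "coev A \<Omega> = (SOME ds. is_coev A \<Omega> ds)"

definition coev' :: "('a, 'x) ring_scheme \<Rightarrow> ('a, 'a, 'w, 'y) bimod_scheme \<Rightarrow> (('w \<Rightarrow> 'a) \<times> 'w) list"
  where "coev' A \<Omega> = (SOME ds. is_coev' A \<Omega> ds)"


section \<open>The algebra \<open>IB(\<Omega>)\<close>\<close>

type_synonym 'a env = "(('a \<times> 'a) \<Rightarrow>\<^sub>0 int) set"

type_synonym ('a, 'w) zz =
  "((('w \<Rightarrow> 'a) \<times> 'w) \<Rightarrow>\<^sub>0 int) set \<times> (('w \<times> ('w \<Rightarrow> 'a)) \<Rightarrow>\<^sub>0 int) set"

type_synonym ('a, 'w) tz = "(('a env + ('a, 'w) zz list) \<Rightarrow>\<^sub>0 int) set"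

definition ZZ ::
  "('k, 'x) ring_scheme \<Rightarrow> ('k, 'a, 'y) module_scheme \<Rightarrow> ('a, 'a, 'w, 'z) bimod_scheme
    \<Rightarrow> ('a env, 'a env, ('a, 'w) zz) bimod" where
  "ZZ K A \<Omega> = bimod_sum (tensK K A (left_dual A \<Omega>) \<Omega>) (tensK K A \<Omega> (right_dual A \<Omega>))"

definition TZ ::
  "('k, 'x) ring_scheme \<Rightarrow> ('k, 'a, 'y) module_scheme \<Rightarrow> ('a, 'a, 'w, 'z) bimod_scheme
    \<Rightarrow> ('a, 'w) tz ring" where
  "TZ K A \<Omega> = tens_alg (env_alg K A) (ZZ K A \<Omega>)"

text \<open>The generators \<open>(x, \<omega>)\<close> and \<open>(\<rho>, y)\<close>, and the elements \<open>a\<close> and \<open>a\<close>-bar of \<open>A\<^sup>e\<close>, in the tensor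
  algebra.\<close>

definition gen_X ::
  "('k, 'x) ring_scheme \<Rightarrow> ('k, 'a, 'y) module_scheme \<Rightarrow> ('a, 'a, 'w, 'z) bimod_scheme
    \<Rightarrow> ('w \<Rightarrow> 'a) \<Rightarrow> 'w \<Rightarrow> ('a, 'w) tz" where
  "gen_X K A \<Omega> x \<omega> = ta_gen (env_alg K A) (ZZ K A \<Omega>)
     (tensK_pure K A (left_dual A \<Omega>) \<Omega> x \<omega>, \<one>\<^bsub>tensK K A \<Omega> (right_dual A \<Omega>)\<^esub>)"

definition gen_Y ::
  "('k, 'x) ring_scheme \<Rightarrow> ('k, 'a, 'y) module_scheme \<Rightarrow> ('a, 'a, 'w, 'z) bimod_scheme
    \<Rightarrow> 'w \<Rightarrow> ('w \<Rightarrow> 'a) \<Rightarrow> ('a, 'w) tz" where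
  "gen_Y K A \<Omega> \<rho> y = ta_gen (env_alg K A) (ZZ K A \<Omega>)
     (\<one>\<^bsub>tensK K A (left_dual A \<Omega>) \<Omega>\<^esub>, tensK_pure K A \<Omega> (right_dual A \<Omega>) \<rho> y)"

definition base_el ::
  "('k, 'x) ring_scheme \<Rightarrow> ('k, 'a, 'y) module_scheme \<Rightarrow> ('a, 'a, 'w, 'z) bimod_scheme
    \<Rightarrow> 'a \<Rightarrow> ('a, 'w) tz" where
  "base_el K A \<Omega> a = ta_base (env_alg K A) (ZZ K A \<Omega>) (env_pure K A a \<one>\<^bsub>A\<^esub>)"

definition base_bar ::
  "('k, 'x) ring_scheme \<Rightarrow> ('k, 'a, 'y) module_scheme \<Rightarrow> ('a, 'a, 'w, 'z) bimod_scheme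
    \<Rightarrow> 'a \<Rightarrow> ('a, 'w) tz" where
  "base_bar K A \<Omega> a = ta_base (env_alg K A) (ZZ K A \<Omega>) (env_pure K A \<one>\<^bsub>A\<^esub> a)"

definition IB_rels ::
  "('k, 'x) ring_scheme \<Rightarrow> ('k, 'a, 'y) module_scheme \<Rightarrow> ('a, 'a, 'w, 'z) bimod_scheme
    \<Rightarrow> ('a, 'w) tz set" where
  "IB_rels K A \<Omega> =
     {(\<Oplus>\<^bsub>TZ K A \<Omega>\<^esub>i\<in>{..<length (coev A \<Omega>)}.
          gen_Y K A \<Omega> (fst (coev A \<Omega> ! i)) y \<otimes>\<^bsub>TZ K A \<Omega>\<^esub> gen_X K A \<Omega> (snd (coev A \<Omega> ! i)) \<omega>)
        \<ominus>\<^bsub>TZ K A \<Omega>\<^esub> base_bar K A \<Omega> (y \<omega>) | y \<omega>.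
        y \<in> carrier (right_dual A \<Omega>) \<and> \<omega> \<in> carrier \<Omega>}
   \<union> {(\<Oplus>\<^bsub>TZ K A \<Omega>\<^esub>j\<in>{..<length (coev' A \<Omega>)}.
          gen_X K A \<Omega> x (snd (coev' A \<Omega> ! j)) \<otimes>\<^bsub>TZ K A \<Omega>\<^esub> gen_Y K A \<Omega> \<omega> (fst (coev' A \<Omega> ! j)))
        \<ominus>\<^bsub>TZ K A \<Omega>\<^esub> base_el K A \<Omega> (x \<omega>) | x \<omega>.
        x \<in> carrier (left_dual A \<Omega>) \<and> \<omega> \<in> carrier \<Omega>}"

definition IB ::
  "('k, 'x) ring_scheme \<Rightarrow> ('k, 'a, 'y) module_scheme \<Rightarrow> ('a, 'a, 'w, 'z) bimod_scheme
    \<Rightarrow> ('a, 'w) tz set ring" where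
  "IB K A \<Omega> = TZ K A \<Omega> Quot (Idl\<^bsub>TZ K A \<Omega>\<^esub> IB_rels K A \<Omega>)"


section \<open>The two categories\<close>

text \<open>Modules and bimodules have their carrier in a fixed type \<open>'m\<close>, which plays the role of the
  universe.  The operations of an object are required to be \<open>undefined\<close> off the carrier, so that
  objects with the same carrier and the same operations are equal.\<close>

definition ext_lmod :: "('r, 'x) ring_scheme \<Rightarrow> ('r, 'm, 'y) lmod_scheme \<Rightarrow> bool" where
  "ext_lmod R M \<longleftrightarrow>
     (\<lambda>(m, n). m \<otimes>\<^bsub>M\<^esub> n) \<in> extensional (carrier M \<times> carrier M)
   \<and> (\<lambda>(r, m). r \<rightharpoonup>\<^bsub>M\<^esub> m) \<in> extensional (carrier R \<times> carrier M)"

definition ext_bimod :: "('a, 'x) ring_scheme \<Rightarrow> ('a, 'a, 'm, 'y) bimod_scheme \<Rightarrow> bool" where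
  "ext_bimod A M \<longleftrightarrow> ext_lmod A M
   \<and> (\<lambda>(m, a). m \<leftharpoonup>\<^bsub>M\<^esub> a) \<in> extensional (carrier M \<times> carrier A)"

definition lmod_cat :: "('r, 'x) ring_scheme \<Rightarrow> (('r, 'm) lmod, 'm \<Rightarrow> 'm) cat" where
  "lmod_cat R =
     \<lparr>Ob = {M. left_mod R M \<and> ext_lmod R M},
      Hom = (\<lambda>M N. lmod_hom R M N),
      Id = (\<lambda>M. \<lambda>m\<in>carrier M. m),
      Comp = (\<lambda>M N P g f. compose (carrier M) g f)\<rparr>"

definition inv_bimod_hom ::
  "('a, 'x) ring_scheme \<Rightarrow> ('a, 'a, 'm, 'y) bimod_scheme \<Rightarrow> ('a, 'a, 'n, 'z) bimod_scheme
    \<Rightarrow> ('m \<Rightarrow> 'n) set" where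
  "inv_bimod_hom A M N = {f \<in> bimod_hom A M N. \<exists>g\<in>bimod_hom A N M.
     (\<forall>m\<in>carrier M. g (f m) = m) \<and> (\<forall>n\<in>carrier N. f (g n) = n)}"

type_synonym ('a, 'w, 'm) intertwining =
  "('a, 'a, 'm) bimod \<times> ((('m \<times> 'w) \<Rightarrow>\<^sub>0 int) set \<Rightarrow> (('w \<times> 'm) \<Rightarrow>\<^sub>0 int) set)"

definition IM_cat ::
  "('k, 'x) ring_scheme \<Rightarrow> ('k, 'a, 'y) module_scheme \<Rightarrow> ('a, 'a, 'w, 'z) bimod_scheme
    \<Rightarrow> (('a, 'w, 'm) intertwining, 'm \<Rightarrow> 'm) cat" where
  "IM_cat K A \<Omega> =
     \<lparr>Ob = {(M, \<sigma>). bimodule K A M \<and> ext_bimod A M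
              \<and> \<sigma> \<in> inv_bimod_hom A (tensA A M \<Omega>) (tensA A \<Omega> M)},
      Hom = (\<lambda>(M, \<sigma>\<^sub>M) (N, \<sigma>\<^sub>N). {f \<in> bimod_hom A M N.
              \<forall>t\<in>carrier (tensA A M \<Omega>).
                \<sigma>\<^sub>N (tensA_map A N \<Omega> f (\<lambda>\<omega>. \<omega>) t) = tensA_map A \<Omega> N (\<lambda>\<omega>. \<omega>) f (\<sigma>\<^sub>M t)}),
      Id = (\<lambda>(M, \<sigma>). \<lambda>m\<in>carrier M. m),
      Comp = (\<lambda>(M, _) _ _ g f. compose (carrier M) g f)\<rparr>"

end

theory Submission
  imports Defs
begin

text \<open>
  By the universal property of the tensor algebra, a left \<open>IB(\<Omega>)\<close>-module is a bimodule \<open>N\<close> together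
  with additive operators for the generators \<open>(x, \<omega>)\<close> and \<open>(\<rho>, y)\<close> that are compatible with the
  actions of \<open>A\<close> and satisfy the two relations with the coevaluations.  These operators and the
  intertwining \<open>\<sigma>\<close> determine each other by \<open>(x, \<omega>) n = (ev \<otimes> id) (x \<otimes> \<sigma> (n \<otimes> \<omega>))\<close> and
  \<open>(\<rho>, y) n = (id \<otimes> ev') (\<sigma>\<inverse> (\<rho> \<otimes> n) \<otimes> y)\<close>, where \<open>ev'\<close> is the underlined evaluation; conversely
  \<open>\<sigma> (n \<otimes> \<omega>) = \<Sum>\<^sub>i \<omega>\<^sub>i \<otimes> (x\<^sub>i, \<omega>) n\<close> and \<open>\<sigma>\<inverse> (\<rho> \<otimes> n) = \<Sum>\<^sub>j (\<rho>, y\<^sub>j) n \<otimes> \<rho>\<^sub>j\<close>, and the two relations say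
  that these maps are mutually inverse.  Since \<open>\<Omega> \<otimes> N\<close> is separated by the maps \<open>x \<otimes> id\<close>, and
  \<open>N \<otimes> \<Omega>\<close> by the maps \<open>id \<otimes> y\<close>, every identity between such maps reduces to one for generators.
  Both constructions keep the underlying set and the underlying maps, so the functor is bijective
  on objects and the identity on morphisms.
\<close>

section \<open>Groups presented by generators and relations\<close>

lemma hom_eq_carrier_mult:
  "\<lbrakk>carrier G = carrier G'; monoid.mult G = monoid.mult G'; carrier H = carrier H';
    monoid.mult H = monoid.mult H'\<rbrakk> \<Longrightarrow> hom G H = hom G' H'"
  by (simp add: hom_def)

lemma const_one_hom: "group G \<Longrightarrow> (\<lambda>_. \<one>\<^bsub>G\<^esub>) \<in> hom T G"
  by (auto simp: hom_def group.is_monoid monoid.l_one monoid.one_closed)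

lemma hom_pointwise_mult:
  assumes "comm_group G" "f \<in> hom T G" "g \<in> hom T G"
  shows "(\<lambda>t. f t \<otimes>\<^bsub>G\<^esub> g t) \<in> hom T G"
proof -
  interpret comm_group G by fact
  show ?thesis
    using assms(2,3) by (auto simp: hom_def Pi_iff m_ac)
qed

lemma hom_pointwise_inv:
  assumes "comm_group G" "f \<in> hom T G"
  shows "(\<lambda>t. inv\<^bsub>G\<^esub> f t) \<in> hom T G"
proof -
  interpret comm_group G by fact
  show ?thesis
    using assms(2) by (auto simp: hom_def Pi_iff inv_mult)
qed

lemma hom_compose_lam:
  "\<lbrakk>f \<in> hom G H; g \<in> hom H I\<rbrakk> \<Longrightarrow> (\<lambda>x. g (f x)) \<in> hom G I"
  by (auto simp: hom_def Pi_iff)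

lemma hom_finprod_lessThan:
  assumes "comm_group G" "comm_group H" "h \<in> hom G H" "\<And>i. i < n \<Longrightarrow> f i \<in> carrier G"
  shows "h (\<Otimes>\<^bsub>G\<^esub>i\<in>{..<n::nat}. f i) = (\<Otimes>\<^bsub>H\<^esub>i\<in>{..<n}. h (f i))"
proof -
  interpret G: comm_group G by fact
  interpret H: comm_group H by fact
  interpret h: group_hom G H h
    using assms(3) by unfold_locales
  show ?thesis
    using assms(4)
  proof (induction n)
    case (Suc n)
    have "f \<in> {..<n} \<rightarrow> carrier G" "f n \<in> carrier G"
      using Suc.prems by auto
    moreover have "(\<lambda>i. h (f i)) \<in> {..<n} \<rightarrow> carrier H" "h (f n) \<in> carrier H"
      using Suc.prems by auto
    ultimately show ?case
      using Suc by (simp add: lessThan_Suc)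
  qed simp
qed

lemma finprod_hom:
  assumes "comm_group G" "\<And>i. i < n \<Longrightarrow> h i \<in> hom T G"
  shows "(\<lambda>t. \<Otimes>\<^bsub>G\<^esub>i\<in>{..<n::nat}. h i t) \<in> hom T G"
proof -
  interpret comm_group G by fact
  have h: "\<And>i t. i < n \<Longrightarrow> t \<in> carrier T \<Longrightarrow> h i t \<in> carrier G"
    "\<And>i t s. i < n \<Longrightarrow> t \<in> carrier T \<Longrightarrow> s \<in> carrier T \<Longrightarrow>  h i (t \<otimes>\<^bsub>T\<^esub> s) = h i t \<otimes>\<^bsub>G\<^esub> h i s"
    using assms(2) by (auto simp: hom_def Pi_iff)
  show ?thesis
  proof (rule homI)
    fix s t assume st: "s \<in> carrier T" "t \<in> carrier T"
    have "(\<Otimes>\<^bsub>G\<^esub>i\<in>{..<n}. h i (s \<otimes>\<^bsub>T\<^esub> t)) = (\<Otimes>\<^bsub>G\<^esub>i\<in>{..<n}. h i s \<otimes>\<^bsub>G\<^esub> h i t)"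
      by (rule finprod_cong') (use st h in auto)
    also have "\<dots> = (\<Otimes>\<^bsub>G\<^esub>i\<in>{..<n}. h i s) \<otimes>\<^bsub>G\<^esub> (\<Otimes>\<^bsub>G\<^esub>i\<in>{..<n}. h i t)"
      by (rule finprod_multf) (use st h in auto)
    finally show "(\<Otimes>\<^bsub>G\<^esub>i\<in>{..<n}. h i (s \<otimes>\<^bsub>T\<^esub> t)) = (\<Otimes>\<^bsub>G\<^esub>i\<in>{..<n}. h i s) \<otimes>\<^bsub>G\<^esub> (\<Otimes>\<^bsub>G\<^esub>i\<in>{..<n}. h i t)" .
  qed (use h in auto)
qed

lemma free_ext_hom:
  assumes "comm_group G" "\<phi> \<in> S \<rightarrow> carrier G"
  shows "free_ext G \<phi> \<in> hom (free_Abelian_group S) G"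
    and "s \<in> S \<Longrightarrow> free_ext G \<phi> (frag_of s) = \<phi> s"
proof -
  interpret comm_group G by fact
  have \<phi>: "\<phi> s \<in> carrier G" if "s \<in> S" for s
    using assms(2) that by auto
  \<comment> \<open>Generators with coefficient 0 contribute trivial powers, so the product may run
    over any finite superset of the support. This gives \<open>x\<close>, \<open>y\<close> and
    \<open>x + y\<close> one common index set even when coefficients cancel.\<close>
  have ext: "free_ext G \<phi> c = (\<Otimes>\<^bsub>G\<^esub>s\<in>U. \<phi> s [^]\<^bsub>G\<^esub> Poly_Mapping.lookup c s)"
    if "finite U" "Poly_Mapping.keys c \<subseteq> U" "U \<subseteq> S" for U c
    unfolding free_ext_def
    by (rule finprod_mono_neutral_cong_left) (use that \<phi> in \<open>auto simp: in_keys_iff\<close>)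
  show "free_ext G \<phi> \<in> hom (free_Abelian_group S) G"
  proof (rule homI)
    fix x assume "x \<in> carrier (free_Abelian_group S)"
    then show "free_ext G \<phi> x \<in> carrier G"
      using \<phi> unfolding free_ext_def by (auto intro!: finprod_closed)
  next
    fix x y assume xy: "x \<in> carrier (free_Abelian_group S)" "y \<in> carrier (free_Abelian_group S)"
    define U where "U = Poly_Mapping.keys x \<union> Poly_Mapping.keys y"
    have U: "finite U" "Poly_Mapping.keys x \<subseteq> U" "Poly_Mapping.keys y \<subseteq> U" "U \<subseteq> S"
      using xy by (auto simp: U_def)
    have "Poly_Mapping.keys (x + y) \<subseteq> U"
      using keys_add[of x y] by (simp add: U_def)
    then have "free_ext G \<phi> (x + y) = (\<Otimes>\<^bsub>G\<^esub>s\<in>U. \<phi> s [^]\<^bsub>G\<^esub> Poly_Mapping.lookup (x + y) s)"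
      using ext U by blast
    also have "\<dots> = (\<Otimes>\<^bsub>G\<^esub>s\<in>U. (\<phi> s [^]\<^bsub>G\<^esub> Poly_Mapping.lookup x s) \<otimes>\<^bsub>G\<^esub> (\<phi> s [^]\<^bsub>G\<^esub> Poly_Mapping.lookup y s))"
      by (rule finprod_cong') (use U \<phi> in \<open>auto simp: lookup_add int_pow_mult subset_iff\<close>)
    also have "\<dots> = free_ext G \<phi> x \<otimes>\<^bsub>G\<^esub> free_ext G \<phi> y"
      unfolding ext[OF U(1,2,4)] ext[OF U(1,3,4)]
      by (rule finprod_multf) (use U \<phi> in auto)
    finally show "free_ext G \<phi> (x \<otimes>\<^bsub>free_Abelian_group S\<^esub> y) = free_ext G \<phi> x \<otimes>\<^bsub>G\<^esub> free_ext G \<phi> y"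
      by simp
  qed
  show "free_ext G \<phi> (frag_of s) = \<phi> s" if "s \<in> S"
    using that \<phi>[OF that] by (subst ext[of "{s}"]) (auto simp: finprod_singleton)
qed

text \<open>\<open>agp_ext\<close> is the single element of the image of a coset; this condition is
  what makes that image a singleton.\<close>

definition respects_rels ::
  "'s set \<Rightarrow> ('s \<Rightarrow>\<^sub>0 int) set \<Rightarrow> ('g, 'x) monoid_scheme \<Rightarrow> ('s \<Rightarrow> 'g) \<Rightarrow> bool" where
  "respects_rels S E G \<phi> \<longleftrightarrow> \<phi> \<in> S \<rightarrow> carrier G \<and> (\<forall>e\<in>E. free_ext G \<phi> e = \<one>\<^bsub>G\<^esub>)"

text \<open>Relators come in just two shapes: \<open>a - b\<close> for balancing and
  \<open>a - b - c\<close> for additivity. The lemmas with suffixes 2 and 3 treat these shapes once,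
  for the tensor products and for the tensor algebra alike.\<close>

lemma keys_frag_rel2:
  "\<lbrakk>a \<in> S; b \<in> S\<rbrakk> \<Longrightarrow> Poly_Mapping.keys (frag_of a - frag_of b :: _ \<Rightarrow>\<^sub>0 int) \<subseteq> S"
  using keys_diff[of "frag_of a :: _ \<Rightarrow>\<^sub>0 int" "frag_of b"] by (auto simp: keys_frag_of)

lemma keys_frag_rel3:
  assumes "a \<in> S" "b \<in> S" "c \<in> S"
  shows "Poly_Mapping.keys (frag_of a - frag_of b - frag_of c :: _ \<Rightarrow>\<^sub>0 int) \<subseteq> S"
  using keys_diff[of "frag_of a - frag_of b :: _ \<Rightarrow>\<^sub>0 int" "frag_of c"] keys_frag_rel2[OF assms(1,2)] assms(3)
  by (auto simp: keys_frag_of)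

lemma free_ext_diff:
  assumes "comm_group G" "\<phi> \<in> S \<rightarrow> carrier G" "Poly_Mapping.keys x \<subseteq> S" "Poly_Mapping.keys y \<subseteq> S"
  shows "free_ext G \<phi> (x - y) = free_ext G \<phi> x \<otimes>\<^bsub>G\<^esub> inv\<^bsub>G\<^esub> free_ext G \<phi> y"
proof -
  interpret comm_group G by fact
  interpret h: group_hom "free_Abelian_group S" G "free_ext G \<phi>"
    using free_ext_hom(1)[OF assms(1,2)] by (simp add: group_hom_def group_hom_axioms_def)
  show ?thesis
    using h.hom_mult[of x "- y"] h.hom_inv[of y] assms(3,4) by simp
qed

lemma free_ext_rel2:
  assumes "comm_group G" "\<phi> \<in> S \<rightarrow> carrier G" "a \<in> S" "b \<in> S" "\<phi> a = \<phi> b"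
  shows "free_ext G \<phi> (frag_of a - frag_of b) = \<one>\<^bsub>G\<^esub>"
proof -
  interpret comm_group G by fact
  show ?thesis
    using assms(2-) by (auto simp: free_ext_diff[OF assms(1,2)] free_ext_hom(2)[OF assms(1,2)] keys_frag_of Pi_iff)
qed

lemma free_ext_rel3:
  assumes "comm_group G" "\<phi> \<in> S \<rightarrow> carrier G" "a \<in> S" "b \<in> S" "c \<in> S" "\<phi> a = \<phi> b \<otimes>\<^bsub>G\<^esub> \<phi> c"
  shows "free_ext G \<phi> (frag_of a - frag_of b - frag_of c) = \<one>\<^bsub>G\<^esub>"
proof -
  interpret comm_group G by fact
  have "Poly_Mapping.keys (frag_of a - frag_of b :: _ \<Rightarrow>\<^sub>0 int) \<subseteq> S"
    using assms by (intro keys_frag_rel2)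
  moreover have \<phi>: "\<phi> b \<in> carrier G" "\<phi> c \<in> carrier G"
    using assms by auto
  moreover have "\<phi> b \<otimes>\<^bsub>G\<^esub> \<phi> c \<otimes>\<^bsub>G\<^esub> inv\<^bsub>G\<^esub> \<phi> b \<otimes>\<^bsub>G\<^esub> inv\<^bsub>G\<^esub> \<phi> c = \<one>\<^bsub>G\<^esub>"
    using \<phi> by (simp add: m_comm m_assoc[symmetric] inv_solve_right')
  ultimately show ?thesis
    using assms by (simp add: free_ext_diff[OF assms(1,2)] free_ext_hom(2)[OF assms(1,2)])
qed

locale presentation =
  fixes S :: "'s set" and E :: "('s \<Rightarrow>\<^sub>0 int) set"
  assumes rels_closed: "e \<in> E \<Longrightarrow> Poly_Mapping.keys e \<subseteq> S"
begin

abbreviation "FA \<equiv> free_Abelian_group S"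
abbreviation "NE \<equiv> generate FA E"
abbreviation "proj c \<equiv> NE #>\<^bsub>FA\<^esub> c"

lemma subgroup_NE: "subgroup NE FA"
  by (rule group.generate_is_subgroup) (use rels_closed in auto)

lemma normal_NE: "NE \<lhd> FA"
  by (rule comm_group.subgroup_imp_normal[OF abelian_free_Abelian_group subgroup_NE])

lemma agp_comm_group: "comm_group (agp S E)"
  unfolding agp_def
  by (rule comm_group.abelian_FactGroup[OF abelian_free_Abelian_group subgroup_NE])

lemma proj_hom: "proj \<in> hom FA (agp S E)"
  unfolding agp_def by (rule normal.r_coset_hom_Mod[OF normal_NE])

lemma agp_carrier: "carrier (agp S E) = proj ` carrier FA"
  by (auto simp: agp_def FactGroup_def RCOSETS_def)

lemma agp_gen_closed [simp]: "s \<in> S \<Longrightarrow> agp_gen S E s \<in> carrier (agp S E)"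
  by (auto simp: agp_gen_def agp_carrier keys_frag_of)

lemma proj_rel: "e \<in> E \<Longrightarrow> proj e = \<one>\<^bsub>agp S E\<^esub>"
  unfolding agp_def FactGroup_def
  using group.coset_join2[OF group_free_Abelian_group _ subgroup_NE] rels_closed
  by (simp add: generate.incl)

lemma proj_diff:
  assumes "Poly_Mapping.keys x \<subseteq> S" "Poly_Mapping.keys y \<subseteq> S"
  shows "proj (x - y) = proj x \<otimes>\<^bsub>agp S E\<^esub> inv\<^bsub>agp S E\<^esub> proj y"
proof -
  interpret G: comm_group "agp S E" by (rule agp_comm_group)
  interpret h: group_hom FA "agp S E" proj
    using proj_hom by (simp add: group_hom_def group_hom_axioms_def)
  show ?thesis
    using h.hom_mult[of x "- y"] h.hom_inv[of y] assms by simp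
qed

lemma agp_gen_eq:
  assumes "frag_of a - frag_of b \<in> E" "a \<in> S" "b \<in> S"
  shows "agp_gen S E a = agp_gen S E b"
proof -
  interpret G: comm_group "agp S E" by (rule agp_comm_group)
  have "agp_gen S E a \<otimes>\<^bsub>agp S E\<^esub> inv\<^bsub>agp S E\<^esub> agp_gen S E b = \<one>\<^bsub>agp S E\<^esub>"
    using proj_rel[OF assms(1)] proj_diff[of "frag_of a" "frag_of b"] assms
    by (simp add: agp_gen_def keys_frag_of)
  then show ?thesis
    using assms by (metis G.inv_solve_right' G.l_one G.one_closed agp_gen_closed)
qed

lemma agp_gen_mult:
  assumes "frag_of a - frag_of b - frag_of c \<in> E" "a \<in> S" "b \<in> S" "c \<in> S"
  shows "agp_gen S E a = agp_gen S E b \<otimes>\<^bsub>agp S E\<^esub> agp_gen S E c"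
proof -
  interpret G: comm_group "agp S E" by (rule agp_comm_group)
  have "Poly_Mapping.keys (frag_of a - frag_of b :: _ \<Rightarrow>\<^sub>0 int) \<subseteq> S"
    using assms by (intro keys_frag_rel2)
  then have "agp_gen S E a \<otimes>\<^bsub>agp S E\<^esub> inv\<^bsub>agp S E\<^esub> agp_gen S E b \<otimes>\<^bsub>agp S E\<^esub> inv\<^bsub>agp S E\<^esub> agp_gen S E c = \<one>\<^bsub>agp S E\<^esub>"
    using proj_rel[OF assms(1)] proj_diff[of "frag_of a - frag_of b" "frag_of c"]
      proj_diff[of "frag_of a" "frag_of b"] assms
    by (simp add: agp_gen_def keys_frag_of)
  moreover have g: "agp_gen S E a \<in> carrier (agp S E)" "agp_gen S E b \<in> carrier (agp S E)"
    "agp_gen S E c \<in> carrier (agp S E)"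
    using assms by auto
  ultimately have "agp_gen S E a \<otimes>\<^bsub>agp S E\<^esub> inv\<^bsub>agp S E\<^esub> agp_gen S E b = agp_gen S E c"
    by (metis G.inv_closed G.inv_solve_right' G.l_one G.m_closed G.one_closed)
  then show ?thesis
    using g by (metis G.inv_solve_right' G.m_comm G.m_closed)
qed

text \<open>Inherited from induction on the free abelian group, whose step is the difference of two
  elements; sums and inverses therefore need no cases of their own.\<close>

lemma agp_induct [consumes 1, case_names one gen diff]:
  assumes "x \<in> carrier (agp S E)"
    and "P \<one>\<^bsub>agp S E\<^esub>"
    and "\<And>s. s \<in> S \<Longrightarrow> P (agp_gen S E s)"
    and "\<And>x y. \<lbrakk>x \<in> carrier (agp S E); y \<in> carrier (agp S E); P x; P y\<rbrakk>
      \<Longrightarrow> P (x \<otimes>\<^bsub>agp S E\<^esub> inv\<^bsub>agp S E\<^esub> y)"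
  shows "P x"
proof -
  interpret G: comm_group "agp S E" by (rule agp_comm_group)
  interpret h: group_hom FA "agp S E" proj
    using proj_hom by (simp add: group_hom_def group_hom_axioms_def)
  obtain c where c: "Poly_Mapping.keys c \<subseteq> S" "x = proj c"
    using assms(1) by (auto simp: agp_carrier)
  have "P (proj c)"
    using c(1)
  proof (induction c rule: free_Abelian_group_induct[consumes 1])
    case 1
    then show ?case using h.hom_one assms(2) by simp
  next
    case (2 x y)
    then show ?case
      using assms(4)[of "proj x" "proj y"] h.hom_closed by (simp add: proj_diff)
  next
    case (3 a)
    then show ?case using assms(3) by (simp add: agp_gen_def)
  qed
  then show ?thesis by (simp add: c)
qed

lemma agp_hom_eqI:
  assumes "group G" "f \<in> hom (agp S E) G" "g \<in> hom (agp S E) G"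
    and "\<And>s. s \<in> S \<Longrightarrow> f (agp_gen S E s) = g (agp_gen S E s)"
    and "x \<in> carrier (agp S E)"
  shows "f x = g x"
proof -
  interpret A: comm_group "agp S E" by (rule agp_comm_group)
  interpret f: group_hom "agp S E" G f
    using assms by (simp add: group_hom_def group_hom_axioms_def A.is_group)
  interpret g: group_hom "agp S E" G g
    using assms by (simp add: group_hom_def group_hom_axioms_def A.is_group)
  show ?thesis
    using assms(5) by (induction x rule: agp_induct) (auto simp: assms(4))
qed

text \<open>The relators lie in the kernel of \<open>free_ext\<close>, hence so does the subgroup
  they generate. So \<open>free_ext\<close> is constant on the coset of \<open>c\<close>, and its
  image there is a singleton.\<close>

lemma agp_ext_proj:
  assumes "comm_group G" "respects_rels S E G \<phi>" "Poly_Mapping.keys c \<subseteq> S"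
  shows "agp_ext G \<phi> (proj c) = free_ext G \<phi> c"
proof -
  interpret comm_group G by fact
  have \<phi>: "\<phi> \<in> S \<rightarrow> carrier G" "\<And>e. e \<in> E \<Longrightarrow> free_ext G \<phi> e = \<one>\<^bsub>G\<^esub>"
    using assms(2) by (auto simp: respects_rels_def)
  interpret h: group_hom FA G "free_ext G \<phi>"
    using free_ext_hom(1)[OF assms(1) \<phi>(1)] by (simp add: group_hom_def group_hom_axioms_def)
  have "NE \<subseteq> kernel FA G (free_ext G \<phi>)"
    by (rule group.generate_subgroup_incl[OF group_free_Abelian_group _ h.subgroup_kernel])
      (use \<phi> rels_closed in \<open>auto simp: kernel_def\<close>)
  then have "free_ext G \<phi> (n + c) = free_ext G \<phi> c" if "n \<in> NE" for n
    using that h.hom_mult[of n c] assms(3) by (auto simp: kernel_def)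
  moreover have "0 \<in> NE"
    using generate.one[of FA E] by simp
  ultimately have "free_ext G \<phi> ` proj c = {free_ext G \<phi> c}"
    by (force simp: r_coset_def)
  then show ?thesis
    by (simp add: agp_ext_def)
qed

lemma agp_ext_hom:
  assumes "comm_group G" "respects_rels S E G \<phi>"
  shows "agp_ext G \<phi> \<in> hom (agp S E) G"
proof -
  have \<phi>: "\<phi> \<in> S \<rightarrow> carrier G"
    using assms(2) by (auto simp: respects_rels_def)
  interpret comm_group G by fact
  interpret h: group_hom FA G "free_ext G \<phi>"
    using free_ext_hom(1)[OF assms(1) \<phi>(1)] by (simp add: group_hom_def group_hom_axioms_def)
  interpret A: comm_group "agp S E" by (rule agp_comm_group)
  interpret p: group_hom FA "agp S E" proj
    using proj_hom by (simp add: group_hom_def group_hom_axioms_def)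
  show ?thesis
  proof (rule homI)
    fix x assume "x \<in> carrier (agp S E)"
    then show "agp_ext G \<phi> x \<in> carrier G"
      using h.hom_closed by (auto simp: agp_carrier agp_ext_proj[OF assms])
  next
    fix x y assume "x \<in> carrier (agp S E)" "y \<in> carrier (agp S E)"
    then obtain c d where "Poly_Mapping.keys c \<subseteq> S" "x = proj c" "Poly_Mapping.keys d \<subseteq> S" "y = proj d"
      by (auto simp: agp_carrier)
    moreover from this have "Poly_Mapping.keys (c + d) \<subseteq> S"
      using keys_add[of c d] by blast
    ultimately show "agp_ext G \<phi> (x \<otimes>\<^bsub>agp S E\<^esub> y) = agp_ext G \<phi> x \<otimes>\<^bsub>G\<^esub> agp_ext G \<phi> y"
      using h.hom_mult[of c d] p.hom_mult[of c d] agp_ext_proj[OF assms, of "c + d"]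
      by (simp add: agp_ext_proj[OF assms])
  qed
qed

lemma agp_ext_gen:
  assumes "comm_group G" "respects_rels S E G \<phi>" "s \<in> S"
  shows "agp_ext G \<phi> (agp_gen S E s) = \<phi> s"
  using assms agp_ext_proj[OF assms(1,2), of "frag_of s"] free_ext_hom(2)[OF assms(1), of \<phi> S s]
  by (simp add: agp_gen_def respects_rels_def keys_frag_of)

end

text \<open>An integer combination of homomorphisms into an abelian group is again a homomorphism.
  The induction on \<open>c\<close> builds \<open>h\<close> from pointwise products and inverses, so
  agreement with \<open>free_ext\<close> is claimed on the carrier alone.\<close>

lemma free_ext_pointwise_hom:
  assumes "comm_group G" "\<And>g. g \<in> S \<Longrightarrow> \<psi> g \<in> hom T G" "Poly_Mapping.keys c \<subseteq> S"
  shows "\<exists>h\<in>hom T G. \<forall>t\<in>carrier T. h t = free_ext G (\<lambda>g. \<psi> g t) c"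
proof -
  interpret comm_group G by fact
  show ?thesis
    using assms(3)
  proof (induction c rule: free_Abelian_group_induct[consumes 1])
    case 1
    show ?case by (intro bexI[OF _ const_one_hom]) (auto simp: free_ext_def)
  next
    case (2 x y)
    obtain h k where hk: "h \<in> hom T G" "\<forall>t\<in>carrier T. h t = free_ext G (\<lambda>g. \<psi> g t) x"
      "k \<in> hom T G" "\<forall>t\<in>carrier T. k t = free_ext G (\<lambda>g. \<psi> g t) y"
      using 2(3,4) by blast
    have "(\<lambda>g. \<psi> g t) \<in> S \<rightarrow> carrier G" if "t \<in> carrier T" for t
      using assms(2) that by (auto simp: hom_def)
    then have "free_ext G (\<lambda>g. \<psi> g t) (x - y) = h t \<otimes>\<^bsub>G\<^esub> inv\<^bsub>G\<^esub> k t" if "t \<in> carrier T" for t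
      using free_ext_diff[OF assms(1) _ 2(1,2)] hk(2,4) that by simp
    with hk show ?case
      by (intro bexI[of _ "\<lambda>t. h t \<otimes>\<^bsub>G\<^esub> inv\<^bsub>G\<^esub> k t"] hom_pointwise_mult[OF assms(1)] hom_pointwise_inv[OF assms(1)])
        simp_all
  next
    case (3 a)
    have "(\<lambda>g. \<psi> g t) \<in> S \<rightarrow> carrier G" if "t \<in> carrier T" for t
      using assms(2) that by (auto simp: hom_def)
    with 3 show ?case
      by (intro bexI[of _ "\<psi> a"] ballI) (simp_all add: free_ext_hom(2)[OF assms(1), of _ S] assms(2))
  qed
qed

text \<open>The common frame for all operations defined by nesting one \<open>agp_ext\<close> in
  another: the products of \<open>A^e\<close> and of the tensor algebra, and the two actions of
  \<open>A^e\<close> on a tensor product over \<open>K\<close>. The function \<beta> gives the value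
  on a pair of generators.\<close>

locale two_presentations = P: presentation S E + Q: presentation S' E'
  for S :: "'s set" and E and S' :: "'t set" and E' +
  fixes G :: "('g, 'x) monoid_scheme" and \<beta> :: "'s \<Rightarrow> 't \<Rightarrow> 'g"
  assumes comm_group_target: "comm_group G"
    and respects_right: "g \<in> S \<Longrightarrow> respects_rels S' E' G (\<beta> g)"
    and respects_left: "h \<in> S' \<Longrightarrow> respects_rels S E G (\<lambda>g. \<beta> g h)"
begin

definition "bi_ext s t = agp_ext G (\<lambda>g. agp_ext G (\<beta> g) t) s"

text \<open>For a fixed relator of the outer group, the value in question is a homomorphism in
  \<open>t\<close>. It is therefore enough to see that it vanishes at the generators of the inner
  group, and there it does by \<open>respects_left\<close>.\<close>

lemma respects_inner:
  assumes t: "t \<in> carrier (agp S' E')"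
  shows "respects_rels S E G (\<lambda>g. agp_ext G (\<beta> g) t)"
  unfolding respects_rels_def
proof (intro conjI ballI)
  interpret comm_group G by (rule comm_group_target)
  show "(\<lambda>g. agp_ext G (\<beta> g) t) \<in> S \<rightarrow> carrier G"
    using Q.agp_ext_hom[OF comm_group_target respects_right] t by (auto simp: hom_def)
  fix e assume e: "e \<in> E"
  obtain h where h: "h \<in> hom (agp S' E') G"
    "\<And>t. t \<in> carrier (agp S' E') \<Longrightarrow> h t = free_ext G (\<lambda>g. agp_ext G (\<beta> g) t) e"
    using free_ext_pointwise_hom[where \<psi> = "\<lambda>g. agp_ext G (\<beta> g)", OF comm_group_target
        Q.agp_ext_hom[OF comm_group_target respects_right] P.rels_closed[OF e]] by blast
  have "h t = \<one>\<^bsub>G\<^esub>"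
  proof (rule Q.agp_hom_eqI[OF _ h(1) const_one_hom _ t])
    fix s assume s: "s \<in> S'"
    have "free_ext G (\<lambda>g. agp_ext G (\<beta> g) (agp_gen S' E' s)) e = free_ext G (\<lambda>g. \<beta> g s) e"
      unfolding free_ext_def
    proof (rule finprod_cong')
      show "(\<lambda>sa. \<beta> sa s [^]\<^bsub>G\<^esub> poly_mapping.lookup e sa) \<in> Poly_Mapping.keys e \<rightarrow> carrier G"
        using respects_left[OF s] P.rels_closed[OF e] by (auto simp: respects_rels_def)
    qed (use P.rels_closed[OF e] s in \<open>auto simp: Q.agp_ext_gen[OF comm_group_target respects_right]\<close>)
    also have "\<dots> = \<one>\<^bsub>G\<^esub>"
      using respects_left[OF s] e by (simp add: respects_rels_def)
    finally show "h (agp_gen S' E' s) = \<one>\<^bsub>G\<^esub>"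
      using h(2) s by simp
  qed (auto)
  then show "free_ext G (\<lambda>g. agp_ext G (\<beta> g) t) e = \<one>\<^bsub>G\<^esub>"
    using h(2)[OF t] by simp
qed

lemma bi_ext_hom_left: "t \<in> carrier (agp S' E') \<Longrightarrow> (\<lambda>s. bi_ext s t) \<in> hom (agp S E) G"
  unfolding bi_ext_def
  using P.agp_ext_hom[OF comm_group_target respects_inner] by (simp add: eta_contract_eq)

text \<open>A representative \<open>c\<close> of \<open>s\<close> turns the outer extension into an
  integer combination of the homomorphisms \<open>agp_ext G (\<beta> g)\<close>, which is additive
  in \<open>t\<close>.\<close>

lemma bi_ext_hom_right:
  assumes "s \<in> carrier (agp S E)" shows "bi_ext s \<in> hom (agp S' E') G"
proof -
  interpret comm_group G by (rule comm_group_target)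
  obtain c where c: "Poly_Mapping.keys c \<subseteq> S" "s = P.proj c"
    using assms by (auto simp: P.agp_carrier)
  obtain h where h: "h \<in> hom (agp S' E') G"
    "\<And>t. t \<in> carrier (agp S' E') \<Longrightarrow> h t = free_ext G (\<lambda>g. agp_ext G (\<beta> g) t) c"
    using free_ext_pointwise_hom[where \<psi> = "\<lambda>g. agp_ext G (\<beta> g)", OF comm_group_target
        Q.agp_ext_hom[OF comm_group_target respects_right] c(1)] by blast
  interpret A: comm_group "agp S' E'" by (rule Q.agp_comm_group)
  have eq: "h t = bi_ext s t" if "t \<in> carrier (agp S' E')" for t
    using h(2)[OF that] P.agp_ext_proj[OF comm_group_target respects_inner[OF that] c(1)]
    by (simp add: c bi_ext_def)
  show ?thesis
  proof (rule homI)
    fix x y assume xy: "x \<in> carrier (agp S' E')" "y \<in> carrier (agp S' E')"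
    with h(1) show "bi_ext s (x \<otimes>\<^bsub>agp S' E'\<^esub> y) = bi_ext s x \<otimes>\<^bsub>G\<^esub> bi_ext s y"
      by (simp add: eq[symmetric] hom_mult[OF h(1)])
  qed (use h(1) in \<open>auto simp: eq[symmetric] hom_def\<close>)
qed

lemma bi_ext_gen:
  "\<lbrakk>g \<in> S; h \<in> S'\<rbrakk> \<Longrightarrow> bi_ext (agp_gen S E g) (agp_gen S' E' h) = \<beta> g h"
  by (simp add: bi_ext_def P.agp_ext_gen[OF comm_group_target respects_inner]
      Q.agp_ext_gen[OF comm_group_target respects_right])

end

text \<open>Associativity and the unit laws of \<mu> are asked for only after passing to classes.
  The tensor algebra depends on this freedom: multiplying two words through a scalar between them
  gives different words in the two bracketings, related by a balancing relator.\<close>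

lemma (in presentation) agp_ring:
  assumes \<mu>: "\<And>g h. \<lbrakk>g \<in> S; h \<in> S\<rbrakk> \<Longrightarrow> \<mu> g h \<in> S" and e: "e \<in> S"
    and right: "\<And>g. g \<in> S \<Longrightarrow> respects_rels S E (agp S E) (\<lambda>h. agp_gen S E (\<mu> g h))"
    and left: "\<And>h. h \<in> S \<Longrightarrow> respects_rels S E (agp S E) (\<lambda>g. agp_gen S E (\<mu> g h))"
    and assoc: "\<And>g h k. \<lbrakk>g \<in> S; h \<in> S; k \<in> S\<rbrakk>
      \<Longrightarrow> agp_gen S E (\<mu> (\<mu> g h) k) = agp_gen S E (\<mu> g (\<mu> h k))"
    and units: "\<And>g. g \<in> S \<Longrightarrow> agp_gen S E (\<mu> e g) = agp_gen S E g"
      "\<And>g. g \<in> S \<Longrightarrow> agp_gen S E (\<mu> g e) = agp_gen S E g"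
    and m: "m = (\<lambda>s t. agp_ext (agp S E) (\<lambda>g. agp_ext (agp S E) (\<lambda>h. agp_gen S E (\<mu> g h)) t) s)"
  shows "ring \<lparr>carrier = carrier (agp S E), monoid.mult = m, one = agp_gen S E e,
      ring.zero = one (agp S E), ring.add = monoid.mult (agp S E)\<rparr>" (is "ring ?R")
    and "\<lbrakk>g \<in> S; h \<in> S\<rbrakk> \<Longrightarrow> m (agp_gen S E g) (agp_gen S E h) = agp_gen S E (\<mu> g h)"
proof -
  interpret A: comm_group "agp S E" by (rule agp_comm_group)
  interpret B: two_presentations S E S E "agp S E" "\<lambda>g h. agp_gen S E (\<mu> g h)"
    by unfold_locales (use right left in auto)
  have m_bi: "m = B.bi_ext"
    by (intro ext) (simp add: m B.bi_ext_def)
  have ml: "(\<lambda>s. m s t) \<in> hom (agp S E) (agp S E)" if "t \<in> carrier (agp S E)" for t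
    using B.bi_ext_hom_left[OF that] by (simp add: m_bi)
  have mr: "m s \<in> hom (agp S E) (agp S E)" if "s \<in> carrier (agp S E)" for s
    using B.bi_ext_hom_right[OF that] by (simp add: m_bi)
  have mg: "m (agp_gen S E g) (agp_gen S E h) = agp_gen S E (\<mu> g h)" if "g \<in> S" "h \<in> S" for g h
    using B.bi_ext_gen[OF that] by (simp add: m_bi)
  show "\<lbrakk>g \<in> S; h \<in> S\<rbrakk> \<Longrightarrow> m (agp_gen S E g) (agp_gen S E h) = agp_gen S E (\<mu> g h)"
    by (rule mg)
  have mc: "m s t \<in> carrier (agp S E)" if "s \<in> carrier (agp S E)" "t \<in> carrier (agp S E)" for s t
    using mr[OF that(1)] that by (auto simp: hom_def)
  \<comment> \<open>Associativity passes from generators to arbitrary elements one argument at a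
    time, starting with the last; in each round both sides are additive in the argument being
    freed.\<close>
  have assoc1: "m (m (agp_gen S E g) (agp_gen S E h)) z = m (agp_gen S E g) (m (agp_gen S E h) z)"
    if "g \<in> S" "h \<in> S" "z \<in> carrier (agp S E)" for g h z
  proof (rule agp_hom_eqI[OF A.is_group _ _ _ that(3)])
    show "m (m (agp_gen S E g) (agp_gen S E h)) \<in> hom (agp S E) (agp S E)"
      using that by (intro mr mc) auto
    show "(\<lambda>z. m (agp_gen S E g) (m (agp_gen S E h) z)) \<in> hom (agp S E) (agp S E)"
      by (rule hom_compose_lam[OF mr mr]) (use that in auto)
  qed (use that in \<open>simp add: mg \<mu> assoc\<close>)
  have assoc2: "m (m (agp_gen S E g) y) z = m (agp_gen S E g) (m y z)"
    if "g \<in> S" "y \<in> carrier (agp S E)" "z \<in> carrier (agp S E)" for g y z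
  proof (rule agp_hom_eqI[OF A.is_group _ _ _ that(2)])
    show "(\<lambda>y. m (m (agp_gen S E g) y) z) \<in> hom (agp S E) (agp S E)"
      by (rule hom_compose_lam[OF mr ml]) (use that in auto)
    show "(\<lambda>y. m (agp_gen S E g) (m y z)) \<in> hom (agp S E) (agp S E)"
      by (rule hom_compose_lam[OF ml mr]) (use that in auto)
  qed (use that in \<open>simp add: assoc1\<close>)
  have assoc3: "m (m x y) z = m x (m y z)"
    if "x \<in> carrier (agp S E)" "y \<in> carrier (agp S E)" "z \<in> carrier (agp S E)" for x y z
  proof (rule agp_hom_eqI[OF A.is_group _ _ _ that(1)])
    show "(\<lambda>x. m (m x y) z) \<in> hom (agp S E) (agp S E)"
      by (rule hom_compose_lam[OF ml ml]) (use that in auto)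
    show "(\<lambda>x. m x (m y z)) \<in> hom (agp S E) (agp S E)"
      using that by (intro ml mc) auto
  qed (use that in \<open>simp add: assoc2\<close>)
  have u1: "m (agp_gen S E e) x = x" if "x \<in> carrier (agp S E)" for x
    by (rule agp_hom_eqI[OF A.is_group _ _ _ that])
      (use e mr units in \<open>auto simp: hom_def mg\<close>)
  have u2: "m x (agp_gen S E e) = x" if "x \<in> carrier (agp S E)" for x
    by (rule agp_hom_eqI[OF A.is_group _ _ _ that])
      (use e ml units in \<open>auto simp: hom_def mg\<close>)
  show "ring ?R"
  proof (rule ringI)
    show "abelian_group ?R"
      by (rule abelian_groupI) (auto simp: A.m_ac intro!: bexI[of _ "inv\<^bsub>agp S E\<^esub> x" for x])
    show "monoid ?R"
      by (rule monoidI) (use e in \<open>auto simp: mc assoc3 u1 u2\<close>)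
  qed (use hom_mult[OF mr] hom_mult[OF ml] in auto)
qed


section \<open>Tensor products\<close>

text \<open>One interface for three kinds of tensor product: \<open>A^e\<close>, tensor products of
  bimodules over \<open>K\<close>, and tensor products of bimodules over \<open>A\<close>.\<close>

locale tensor_data = M: comm_group M + N: comm_group N
  for M :: "('m, 'x) monoid_scheme" and N :: "('n, 'y) monoid_scheme" +
  fixes R :: "'r set" and r :: "'m \<Rightarrow> 'r \<Rightarrow> 'm" and l :: "'r \<Rightarrow> 'n \<Rightarrow> 'n"
  assumes r_closed: "\<lbrakk>m \<in> carrier M; a \<in> R\<rbrakk> \<Longrightarrow> r m a \<in> carrier M"
    and l_closed: "\<lbrakk>n \<in> carrier N; a \<in> R\<rbrakk> \<Longrightarrow> l a n \<in> carrier N"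
begin

abbreviation "T \<equiv> tens R M r N l"
abbreviation "pt \<equiv> pure_tens R M r N l"

sublocale P: presentation "carrier M \<times> carrier N" "tens_rels R M r N l"
proof
  fix e assume "e \<in> tens_rels R M r N l"
  then show "Poly_Mapping.keys e \<subseteq> carrier M \<times> carrier N"
    unfolding tens_rels_def
    by (elim UnE CollectE exE conjE) (simp_all add: keys_frag_rel2 keys_frag_rel3 r_closed l_closed)
qed

lemma tens_comm_group: "comm_group T"
  unfolding tens_def by (rule P.agp_comm_group)

lemma pure_closed [simp]: "\<lbrakk>m \<in> carrier M; n \<in> carrier N\<rbrakk> \<Longrightarrow> pt m n \<in> carrier T"
  unfolding tens_def pure_tens_def by (rule P.agp_gen_closed) auto

lemma pure_add_left:
  "\<lbrakk>m \<in> carrier M; m' \<in> carrier M; n \<in> carrier N\<rbrakk> \<Longrightarrow> pt (m \<otimes>\<^bsub>M\<^esub> m') n = pt m n \<otimes>\<^bsub>T\<^esub> pt m' n"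
  unfolding tens_def pure_tens_def
  by (rule P.agp_gen_mult) (auto simp: tens_rels_def)

lemma pure_add_right:
  "\<lbrakk>m \<in> carrier M; n \<in> carrier N; n' \<in> carrier N\<rbrakk> \<Longrightarrow> pt m (n \<otimes>\<^bsub>N\<^esub> n') = pt m n \<otimes>\<^bsub>T\<^esub> pt m n'"
  unfolding tens_def pure_tens_def
  by (rule P.agp_gen_mult) (auto simp: tens_rels_def)

lemma pure_balanced:
  "\<lbrakk>m \<in> carrier M; n \<in> carrier N; a \<in> R\<rbrakk> \<Longrightarrow> pt (r m a) n = pt m (l a n)"
  unfolding pure_tens_def
  by (rule P.agp_gen_eq) (auto simp: tens_rels_def r_closed l_closed)

lemma pure_hom_left: "n \<in> carrier N \<Longrightarrow> (\<lambda>m. pt m n) \<in> hom M T"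
  by (rule homI) (auto simp: pure_add_left)

lemma pure_hom_right: "m \<in> carrier M \<Longrightarrow> pt m \<in> hom N T"
  by (rule homI) (auto simp: pure_add_right)

lemma tens_induct [consumes 1, case_names one pure diff]:
  assumes "x \<in> carrier T" "P \<one>\<^bsub>T\<^esub>"
    and "\<And>m n. \<lbrakk>m \<in> carrier M; n \<in> carrier N\<rbrakk> \<Longrightarrow> P (pt m n)"
    and "\<And>x y. \<lbrakk>x \<in> carrier T; y \<in> carrier T; P x; P y\<rbrakk> \<Longrightarrow> P (x \<otimes>\<^bsub>T\<^esub> inv\<^bsub>T\<^esub> y)"
  shows "P x"
  using assms(1) unfolding tens_def
  by (rule P.agp_induct) (use assms(2-) in \<open>auto simp: pure_tens_def tens_def\<close>)

lemma tens_respects: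
  assumes "comm_group G"
    and "\<And>m. m \<in> carrier M \<Longrightarrow> (\<lambda>n. \<phi> (m, n)) \<in> hom N G"
    and "\<And>n. n \<in> carrier N \<Longrightarrow> (\<lambda>m. \<phi> (m, n)) \<in> hom M G"
    and "\<And>m a n. \<lbrakk>m \<in> carrier M; a \<in> R; n \<in> carrier N\<rbrakk> \<Longrightarrow> \<phi> (r m a, n) = \<phi> (m, l a n)"
  shows "respects_rels (carrier M \<times> carrier N) (tens_rels R M r N l) G \<phi>"
proof -
  have \<phi>: "\<phi> \<in> carrier M \<times> carrier N \<rightarrow> carrier G"
    using assms(2) by (auto simp: hom_def)
  show ?thesis
    unfolding respects_rels_def
  proof (intro conjI ballI \<phi>)
    fix e assume "e \<in> tens_rels R M r N l"
    then consider
      (left) m m' n where "e = frag_of (m \<otimes>\<^bsub>M\<^esub> m', n) - frag_of (m, n) - frag_of (m', n)"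
        "m \<in> carrier M" "m' \<in> carrier M" "n \<in> carrier N"
      | (right) m n n' where "e = frag_of (m, n \<otimes>\<^bsub>N\<^esub> n') - frag_of (m, n) - frag_of (m, n')"
        "m \<in> carrier M" "n \<in> carrier N" "n' \<in> carrier N"
      | (bal) m a n where "e = frag_of (r m a, n) - frag_of (m, l a n)"
        "m \<in> carrier M" "a \<in> R" "n \<in> carrier N"
      unfolding tens_rels_def by blast
    then show "free_ext G \<phi> e = \<one>\<^bsub>G\<^esub>"
    proof cases
      case left
      then show ?thesis
        using free_ext_rel3[OF assms(1) \<phi>] hom_mult[OF assms(3)] by simp
    next
      case right
      then show ?thesis
        using free_ext_rel3[OF assms(1) \<phi>] hom_mult[OF assms(2)] by simp
    next
      case bal
      then show ?thesis
        using free_ext_rel2[OF assms(1) \<phi>] assms(4) by (simp add: r_closed l_closed)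
    qed
  qed
qed

lemma tens_ext:
  assumes "comm_group G"
    and "\<And>m. m \<in> carrier M \<Longrightarrow> (\<lambda>n. \<phi> (m, n)) \<in> hom N G"
    and "\<And>n. n \<in> carrier N \<Longrightarrow> (\<lambda>m. \<phi> (m, n)) \<in> hom M G"
    and "\<And>m a n. \<lbrakk>m \<in> carrier M; a \<in> R; n \<in> carrier N\<rbrakk> \<Longrightarrow> \<phi> (r m a, n) = \<phi> (m, l a n)"
  shows "agp_ext G \<phi> \<in> hom T G"
    and "\<lbrakk>m \<in> carrier M; n \<in> carrier N\<rbrakk> \<Longrightarrow> agp_ext G \<phi> (pt m n) = \<phi> (m, n)"
proof -
  have "respects_rels (carrier M \<times> carrier N) (tens_rels R M r N l) G \<phi>"
    by (rule tens_respects) (use assms in auto)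
  from P.agp_ext_hom[OF assms(1) this] P.agp_ext_gen[OF assms(1) this]
  show "agp_ext G \<phi> \<in> hom T G"
    and "\<lbrakk>m \<in> carrier M; n \<in> carrier N\<rbrakk> \<Longrightarrow> agp_ext G \<phi> (pt m n) = \<phi> (m, n)"
    by (auto simp: tens_def pure_tens_def)
qed

end

section \<open>Spanning sets\<close>

text \<open>Generation of a group by \<open>X\<close>, put as an induction principle instead of
  through \<open>generate\<close>. This form comes directly from the induction rules of the
  presentations and is the form in which equality of homomorphisms is checked.\<close>

definition spans :: "('g, 'x) monoid_scheme \<Rightarrow> 'g set \<Rightarrow> bool" where
  "spans T X \<longleftrightarrow> group T \<and> X \<subseteq> carrier T \<and>
    (\<forall>P. P \<one>\<^bsub>T\<^esub> \<longrightarrow> (\<forall>x\<in>X. P x)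
      \<longrightarrow> (\<forall>x\<in>carrier T. \<forall>y\<in>carrier T. P x \<longrightarrow> P y \<longrightarrow> P (x \<otimes>\<^bsub>T\<^esub> inv\<^bsub>T\<^esub> y))
      \<longrightarrow> (\<forall>x\<in>carrier T. P x))"

lemma spansI:
  assumes "group T" "X \<subseteq> carrier T"
    and "\<And>P x. \<lbrakk>P \<one>\<^bsub>T\<^esub>; \<And>x. x \<in> X \<Longrightarrow> P x;
      \<And>x y. \<lbrakk>x \<in> carrier T; y \<in> carrier T; P x; P y\<rbrakk> \<Longrightarrow> P (x \<otimes>\<^bsub>T\<^esub> inv\<^bsub>T\<^esub> y); x \<in> carrier T\<rbrakk> \<Longrightarrow> P x"
  shows "spans T X"
  unfolding spans_def using assms by blast

lemma spans_induct [consumes 2, case_names one gen diff]: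
  assumes "spans T X" "x \<in> carrier T" "P \<one>\<^bsub>T\<^esub>" "\<And>x. x \<in> X \<Longrightarrow> P x"
    "\<And>x y. \<lbrakk>x \<in> carrier T; y \<in> carrier T; P x; P y\<rbrakk> \<Longrightarrow> P (x \<otimes>\<^bsub>T\<^esub> inv\<^bsub>T\<^esub> y)"
  shows "P x"
proof -
  have "P \<one>\<^bsub>T\<^esub> \<longrightarrow> (\<forall>x\<in>X. P x)
      \<longrightarrow> (\<forall>x\<in>carrier T. \<forall>y\<in>carrier T. P x \<longrightarrow> P y \<longrightarrow> P (x \<otimes>\<^bsub>T\<^esub> inv\<^bsub>T\<^esub> y))
      \<longrightarrow> (\<forall>x\<in>carrier T. P x)"
    using assms(1) unfolding spans_def by blast
  then show ?thesis
    using assms(2-) by blast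
qed

lemma spans_hom_eqI:
  assumes "spans T X" "group G" "f \<in> hom T G" "g \<in> hom T G" "\<And>x. x \<in> X \<Longrightarrow> f x = g x" "x \<in> carrier T"
  shows "f x = g x"
proof -
  have T: "group T"
    using assms(1) by (simp add: spans_def)
  interpret f: group_hom T G f
    using assms T by (simp add: group_hom_def group_hom_axioms_def)
  interpret g: group_hom T G g
    using assms T by (simp add: group_hom_def group_hom_axioms_def)
  show ?thesis
    using assms(1,6) by (induction x rule: spans_induct) (auto simp: assms(5))
qed

lemma spans_bi_eqI:
  assumes "spans T X" "spans T' X'" "group G"
    and "\<And>y. y \<in> carrier T' \<Longrightarrow> (\<lambda>x. f x y) \<in> hom T G" "\<And>y. y \<in> carrier T' \<Longrightarrow> (\<lambda>x. g x y) \<in> hom T G"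
    and "\<And>x. x \<in> carrier T \<Longrightarrow> f x \<in> hom T' G" "\<And>x. x \<in> carrier T \<Longrightarrow> g x \<in> hom T' G"
    and "\<And>x y. \<lbrakk>x \<in> X; y \<in> X'\<rbrakk> \<Longrightarrow> f x y = g x y" "x \<in> carrier T" "y \<in> carrier T'"
  shows "f x y = g x y"
proof (rule spans_hom_eqI[OF assms(2,3)])
  fix y assume y: "y \<in> X'"
  then have "y \<in> carrier T'"
    using assms(2) by (auto simp: spans_def)
  with assms(9) show "f x y = g x y"
    using spans_hom_eqI[OF assms(1,3) assms(4,5)] assms(8) y by blast
qed (use assms in auto)

text \<open>Suited to laws such as \<open>(r s) m = r (s m)\<close>, whose two sides are additive in
  each of three arguments.\<close>

lemma spans_tri_eqI:
  assumes "spans T X" "spans T' X'" "spans T'' X''" "group G"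
    and "\<And>y z. \<lbrakk>y \<in> carrier T'; z \<in> carrier T''\<rbrakk> \<Longrightarrow> (\<lambda>x. f x y z) \<in> hom T G"
      "\<And>y z. \<lbrakk>y \<in> carrier T'; z \<in> carrier T''\<rbrakk> \<Longrightarrow> (\<lambda>x. g x y z) \<in> hom T G"
    and "\<And>x z. \<lbrakk>x \<in> carrier T; z \<in> carrier T''\<rbrakk> \<Longrightarrow> (\<lambda>y. f x y z) \<in> hom T' G"
      "\<And>x z. \<lbrakk>x \<in> carrier T; z \<in> carrier T''\<rbrakk> \<Longrightarrow> (\<lambda>y. g x y z) \<in> hom T' G"
    and "\<And>x y. \<lbrakk>x \<in> carrier T; y \<in> carrier T'\<rbrakk> \<Longrightarrow> f x y \<in> hom T'' G"
      "\<And>x y. \<lbrakk>x \<in> carrier T; y \<in> carrier T'\<rbrakk> \<Longrightarrow> g x y \<in> hom T'' G"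
    and "\<And>x y z. \<lbrakk>x \<in> X; y \<in> X'; z \<in> X''\<rbrakk> \<Longrightarrow> f x y z = g x y z"
      "x \<in> carrier T" "y \<in> carrier T'" "z \<in> carrier T''"
  shows "f x y z = g x y z"
proof (rule spans_hom_eqI[OF assms(3,4)])
  fix z assume z: "z \<in> X''"
  then have z': "z \<in> carrier T''"
    using assms(3) by (auto simp: spans_def)
  show "f x y z = g x y z"
    by (rule spans_bi_eqI[OF assms(1,2,4), of "\<lambda>x y. f x y z" "\<lambda>x y. g x y z"])
      (use assms z z' in auto)
qed (use assms in auto)

lemma (in tensor_data) spans_tens: "spans T {pt m n | m n. m \<in> carrier M \<and> n \<in> carrier N}"
proof (rule spansI)
  show "group T"
    using tens_comm_group by (simp add: comm_group_def)
next
  fix P x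
  assume P: "P \<one>\<^bsub>T\<^esub>" "\<And>x. x \<in> {pt m n | m n. m \<in> carrier M \<and> n \<in> carrier N} \<Longrightarrow> P x"
    "\<And>x y. \<lbrakk>x \<in> carrier T; y \<in> carrier T; P x; P y\<rbrakk> \<Longrightarrow> P (x \<otimes>\<^bsub>T\<^esub> inv\<^bsub>T\<^esub> y)" "x \<in> carrier T"
  from P(4) show "P x"
  proof (induction x rule: tens_induct)
    case one
    show ?case by (rule P(1))
  next
    case (pure m n)
    then show ?case by (intro P(2)) auto
  next
    case (diff x y)
    then show ?case by (rule P(3))
  qed
qed auto

lemma (in presentation) spans_agp: "spans (agp S E) (agp_gen S E ` S)"
proof (rule spansI)
  show "group (agp S E)"
    using agp_comm_group by (simp add: comm_group_def)
next
  fix P x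
  assume P: "P \<one>\<^bsub>agp S E\<^esub>" "\<And>x. x \<in> agp_gen S E ` S \<Longrightarrow> P x"
    "\<And>x y. \<lbrakk>x \<in> carrier (agp S E); y \<in> carrier (agp S E); P x; P y\<rbrakk> \<Longrightarrow> P (x \<otimes>\<^bsub>agp S E\<^esub> inv\<^bsub>agp S E\<^esub> y)"
    "x \<in> carrier (agp S E)"
  from P(4) show "P x"
  proof (induction x rule: agp_induct)
    case one
    show ?case by (rule P(1))
  next
    case (gen s)
    then show ?case by (intro P(2) imageI)
  next
    case (diff x y)
    then show ?case by (rule P(3))
  qed
qed auto


section \<open>Modules and bimodules over rings\<close>

lemma ring_mult_homs:
  assumes "ring R" "a \<in> carrier R"
  shows "(\<lambda>b. a \<otimes>\<^bsub>R\<^esub> b) \<in> hom (add_monoid R) (add_monoid R)"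
    and "(\<lambda>b. b \<otimes>\<^bsub>R\<^esub> a) \<in> hom (add_monoid R) (add_monoid R)"
proof -
  interpret ring R by fact
  show "(\<lambda>b. a \<otimes>\<^bsub>R\<^esub> b) \<in> hom (add_monoid R) (add_monoid R)"
    "(\<lambda>b. b \<otimes>\<^bsub>R\<^esub> a) \<in> hom (add_monoid R) (add_monoid R)"
    using assms(2) by (auto intro!: homI simp: r_distr l_distr)
qed

lemma bimod_on_simps [simp]:
  "carrier (bimod_on G l r) = carrier G" "monoid.mult (bimod_on G l r) = monoid.mult G"
  "one (bimod_on G l r) = one G" "lact (bimod_on G l r) = l" "ract (bimod_on G l r) = r"
  by (simp_all add: bimod_on_def)

lemma comm_group_cong:
  assumes "carrier G = carrier H" "monoid.mult G = monoid.mult H" "one G = one H" "comm_group H"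
  shows "comm_group G"
proof -
  interpret comm_group H by fact
  show ?thesis
  proof (rule comm_groupI)
    show "\<exists>y\<in>carrier G. y \<otimes>\<^bsub>G\<^esub> x = \<one>\<^bsub>G\<^esub>" if "x \<in> carrier G" for x
      using that l_inv inv_closed unfolding assms(1-3) by blast
  qed (simp_all add: assms(1-3) m_ac)
qed

lemma m_inv_cong:
  "\<lbrakk>carrier G = carrier H; monoid.mult G = monoid.mult H; one G = one H\<rbrakk> \<Longrightarrow> m_inv G = m_inv H"
  by (simp add: m_inv_def fun_eq_iff)

lemma spans_cong:
  assumes "carrier G = carrier H" "monoid.mult G = monoid.mult H" "one G = one H" "comm_group H" "spans H X"
  shows "spans G X"
proof -
  have "group G"
    using comm_group_cong[OF assms(1-4)] by (simp add: comm_group_def)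
  then show ?thesis
  proof (rule spansI)
    show "X \<subseteq> carrier G"
      using assms(1,5) by (simp add: spans_def)
    fix P x
    assume P: "P \<one>\<^bsub>G\<^esub>" "\<And>x. x \<in> X \<Longrightarrow> P x"
      "\<And>x y. \<lbrakk>x \<in> carrier G; y \<in> carrier G; P x; P y\<rbrakk> \<Longrightarrow> P (x \<otimes>\<^bsub>G\<^esub> inv\<^bsub>G\<^esub> y)" "x \<in> carrier G"
    from assms(5) P(4)[unfolded assms(1)] show "P x"
    proof (induction x rule: spans_induct)
      case one
      show ?case using P(1) by (simp add: assms(3))
    next
      case (gen x)
      then show ?case by (rule P(2))
    next
      case (diff x y)
      then show ?case
        using P(3)[of x y] by (simp add: assms(1,2) m_inv_cong[OF assms(1-3)])
    qed
  qed
qed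

text \<open>A bimodule over a plain ring, with no ground field in the signature. The tensor algebra
  is built over \<open>A^e\<close>, which is only a \<open>ring\<close> record, so
  \<open>bimodule\<close> would not fit there; every \<open>bimodule\<close> is an instance.\<close>

locale ring_bimod = left_mod B V
  for B :: "('b, 'x) ring_scheme" and V :: "('b, 'b, 'v, 'z) bimod_scheme" +
  assumes ract_closed: "\<lbrakk>m \<in> carrier V; a \<in> carrier B\<rbrakk> \<Longrightarrow> m \<leftharpoonup>\<^bsub>V\<^esub> a \<in> carrier V"
    and add_ract: "\<lbrakk>m \<in> carrier V; n \<in> carrier V; a \<in> carrier B\<rbrakk>
      \<Longrightarrow> (m \<otimes>\<^bsub>V\<^esub> n) \<leftharpoonup>\<^bsub>V\<^esub> a = (m \<leftharpoonup>\<^bsub>V\<^esub> a) \<otimes>\<^bsub>V\<^esub> (n \<leftharpoonup>\<^bsub>V\<^esub> a)"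
    and ract_add: "\<lbrakk>m \<in> carrier V; a \<in> carrier B; b \<in> carrier B\<rbrakk>
      \<Longrightarrow> m \<leftharpoonup>\<^bsub>V\<^esub> (a \<oplus>\<^bsub>B\<^esub> b) = (m \<leftharpoonup>\<^bsub>V\<^esub> a) \<otimes>\<^bsub>V\<^esub> (m \<leftharpoonup>\<^bsub>V\<^esub> b)"
    and ract_mult: "\<lbrakk>m \<in> carrier V; a \<in> carrier B; b \<in> carrier B\<rbrakk>
      \<Longrightarrow> m \<leftharpoonup>\<^bsub>V\<^esub> (a \<otimes>\<^bsub>B\<^esub> b) = m \<leftharpoonup>\<^bsub>V\<^esub> a \<leftharpoonup>\<^bsub>V\<^esub> b"
    and ract_one: "m \<in> carrier V \<Longrightarrow> m \<leftharpoonup>\<^bsub>V\<^esub> \<one>\<^bsub>B\<^esub> = m"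
    and lact_ract: "\<lbrakk>m \<in> carrier V; a \<in> carrier B; b \<in> carrier B\<rbrakk>
      \<Longrightarrow> (a \<rightharpoonup>\<^bsub>V\<^esub> m) \<leftharpoonup>\<^bsub>V\<^esub> b = a \<rightharpoonup>\<^bsub>V\<^esub> (m \<leftharpoonup>\<^bsub>V\<^esub> b)"

context left_mod begin
lemma lact_hom: "r \<in> carrier R \<Longrightarrow> lact M r \<in> hom M M"
  by (rule homI) (auto simp: lact_closed lact_add)
lemma lact_hom_left: "m \<in> carrier M \<Longrightarrow> (\<lambda>r. r \<rightharpoonup>\<^bsub>M\<^esub> m) \<in> hom (add_monoid R) M"
  by (rule homI) (auto simp: lact_closed add_lact)
end

context ring_bimod begin
lemma ract_hom: "r \<in> carrier B \<Longrightarrow> (\<lambda>v. v \<leftharpoonup>\<^bsub>V\<^esub> r) \<in> hom V V"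
  by (rule homI) (auto simp: ract_closed add_ract)
lemma ract_hom_right: "m \<in> carrier V \<Longrightarrow> ract V m \<in> hom (add_monoid B) V"
  by (rule homI) (auto simp: ract_closed ract_add)
end

sublocale bimodule \<subseteq> ring_bimod A M
  by unfold_locales (auto simp: ract_closed add_ract ract_add ract_mult ract_one lact_ract)

context bimodule begin

text \<open>The image of a scalar in \<open>A\<close>. Since \<open>k a\<close> is a product with
  this element on either side, balancedness over \<open>K\<close> reduces to the module laws and the
  centrality of \<open>kone k\<close>.\<close>

definition "kone k = k \<odot>\<^bsub>A\<^esub> \<one>\<^bsub>A\<^esub>"

lemma kone_closed [simp]: "k \<in> carrier K \<Longrightarrow> kone k \<in> carrier A"
  by (simp add: kone_def)

lemma smult_kone:
  "\<lbrakk>k \<in> carrier K; a \<in> carrier A\<rbrakk> \<Longrightarrow> k \<odot>\<^bsub>A\<^esub> a = kone k \<otimes>\<^bsub>A\<^esub> a"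
  "\<lbrakk>k \<in> carrier K; a \<in> carrier A\<rbrakk> \<Longrightarrow> k \<odot>\<^bsub>A\<^esub> a = a \<otimes>\<^bsub>A\<^esub> kone k"
  by (simp_all add: kone_def smult_mult_left smult_mult_right)

lemma kone_central: "\<lbrakk>k \<in> carrier K; m \<in> carrier M\<rbrakk> \<Longrightarrow> kone k \<rightharpoonup>\<^bsub>M\<^esub> m = m \<leftharpoonup>\<^bsub>M\<^esub> kone k"
  by (simp add: kone_def K_central)

end


section \<open>The enveloping algebra\<close>

context k_algebra begin

abbreviation "env_group \<equiv>
  tens (carrier K) (add_monoid A) (\<lambda>a k. k \<odot>\<^bsub>A\<^esub> a) (add_monoid A) (\<lambda>k a. k \<odot>\<^bsub>A\<^esub> a)"

sublocale E: tensor_data "add_monoid A" "add_monoid A" "carrier K"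
  "\<lambda>a k. k \<odot>\<^bsub>A\<^esub> a" "\<lambda>k a. k \<odot>\<^bsub>A\<^esub> a"
  by (intro tensor_data.intro tensor_data_axioms.intro A.a_comm_group) auto

lemma env_pure_eq: "env_pure K A = E.pt"
  by (simp add: env_pure_def)

lemma add_monoid_env: "add_monoid (env_alg K A) = env_group"
  by (simp add: env_alg_def Let_def)

lemma env_simps:
  "carrier (env_alg K A) = carrier env_group"
  "ring.add (env_alg K A) = monoid.mult env_group"
  "ring.zero (env_alg K A) = one env_group"
  "one (env_alg K A) = env_pure K A \<one>\<^bsub>A\<^esub> \<one>\<^bsub>A\<^esub>"
  by (simp_all add: env_alg_def Let_def)

text \<open>An instance of \<open>agp_ring\<close> with the componentwise product, reversed in the
  second component. The relators are respected because scalars can be pulled out of either factor of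
  a product in \<open>A\<close> and then moved across the tensor sign.\<close>

lemma env_ring: "ring (env_alg K A)"
  and env_mult: "\<lbrakk>a \<in> carrier A; a' \<in> carrier A; b \<in> carrier A; b' \<in> carrier A\<rbrakk>
    \<Longrightarrow> env_pure K A a a' \<otimes>\<^bsub>env_alg K A\<^esub> env_pure K A b b' = env_pure K A (a \<otimes>\<^bsub>A\<^esub> b) (b' \<otimes>\<^bsub>A\<^esub> a')"
proof -
  let ?S = "carrier A \<times> carrier A"
  let ?E = "tens_rels (carrier K) (add_monoid A) (\<lambda>a k. k \<odot>\<^bsub>A\<^esub> a) (add_monoid A) (\<lambda>k a. k \<odot>\<^bsub>A\<^esub> a)"
  define \<mu> where "\<mu> = (\<lambda>g h. (fst g \<otimes>\<^bsub>A\<^esub> fst h, snd h \<otimes>\<^bsub>A\<^esub> snd g))"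
  have T: "env_group = agp ?S ?E"
    by (simp add: tens_def)
  have pt: "E.pt a b = agp_gen ?S ?E (a, b)" for a b
    by (simp add: pure_tens_def)
  have cg: "comm_group (agp ?S ?E)"
    using E.tens_comm_group by (simp add: T)
  have hl: "(\<lambda>a. agp_gen ?S ?E (f a, b)) \<in> hom (add_monoid A) (agp ?S ?E)"
    if "f \<in> hom (add_monoid A) (add_monoid A)" "b \<in> carrier A" for f b
    using hom_compose_lam[OF that(1) E.pure_hom_left[of b]] that by (simp add: T pt)
  have hr: "(\<lambda>b. agp_gen ?S ?E (a, f b)) \<in> hom (add_monoid A) (agp ?S ?E)"
    if "f \<in> hom (add_monoid A) (add_monoid A)" "a \<in> carrier A" for f a
    using hom_compose_lam[OF that(1) E.pure_hom_right[of a]] that by (simp add: T pt)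
  have bal: "agp_gen ?S ?E (k \<odot>\<^bsub>A\<^esub> a, b) = agp_gen ?S ?E (a, k \<odot>\<^bsub>A\<^esub> b)"
    if "k \<in> carrier K" "a \<in> carrier A" "b \<in> carrier A" for k a b
    using E.pure_balanced[of a b k] that by (simp add: pt)
  have m: "monoid.mult (env_alg K A) = (\<lambda>s t. agp_ext (agp ?S ?E) (\<lambda>g. agp_ext (agp ?S ?E) (\<lambda>h. agp_gen ?S ?E (\<mu> g h)) t) s)"
    by (simp add: env_alg_def Let_def T env_pure_eq pt \<mu>_def case_prod_unfold)
  have env: "env_alg K A = \<lparr>carrier = carrier (agp ?S ?E), monoid.mult = monoid.mult (env_alg K A),
     one = agp_gen ?S ?E (\<one>\<^bsub>A\<^esub>, \<one>\<^bsub>A\<^esub>),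
      ring.zero = one (agp ?S ?E), ring.add = monoid.mult (agp ?S ?E)\<rparr>"
    by (rule ring.equality) (simp_all add: env_simps T env_pure_eq pt)
  have pres: "presentation ?S ?E"
    using E.P.presentation_axioms by simp
  have right: "respects_rels ?S ?E (agp ?S ?E) (\<lambda>h. agp_gen ?S ?E (\<mu> g h))" if "g \<in> ?S" for g
    using that by (intro E.tens_respects[simplified, OF cg])
        (auto simp: \<mu>_def hl hr ring_mult_homs[OF A.ring_axioms] bal smult_mult_left smult_mult_right)
  have left: "respects_rels ?S ?E (agp ?S ?E) (\<lambda>g. agp_gen ?S ?E (\<mu> g h))" if "h \<in> ?S" for h
    using that by (intro E.tens_respects[simplified, OF cg])
        (auto simp: \<mu>_def hl hr ring_mult_homs[OF A.ring_axioms] bal smult_mult_left smult_mult_right)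
  have \<mu>: "\<mu> g h \<in> ?S" if "g \<in> ?S" "h \<in> ?S" for g h
    using that by (auto simp: \<mu>_def)
  have e: "(\<one>\<^bsub>A\<^esub>, \<one>\<^bsub>A\<^esub>) \<in> ?S"
    by simp
  have assoc: "agp_gen ?S ?E (\<mu> (\<mu> g h) k) = agp_gen ?S ?E (\<mu> g (\<mu> h k))"
    if "g \<in> ?S" "h \<in> ?S" "k \<in> ?S" for g h k
    using that by (auto simp: \<mu>_def A.m_assoc)
  have units: "agp_gen ?S ?E (\<mu> (\<one>\<^bsub>A\<^esub>, \<one>\<^bsub>A\<^esub>) g) = agp_gen ?S ?E g"
    "agp_gen ?S ?E (\<mu> g (\<one>\<^bsub>A\<^esub>, \<one>\<^bsub>A\<^esub>)) = agp_gen ?S ?E g" if "g \<in> ?S" for g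
    using that by (auto simp: \<mu>_def)
  note R = presentation.agp_ring[where \<mu> = \<mu>, OF pres \<mu> e right left assoc units m]
  show "ring (env_alg K A)"
    using R(1) env by simp
  show "\<lbrakk>a \<in> carrier A; a' \<in> carrier A; b \<in> carrier A; b' \<in> carrier A\<rbrakk>
    \<Longrightarrow> env_pure K A a a' \<otimes>\<^bsub>env_alg K A\<^esub> env_pure K A b b' = env_pure K A (a \<otimes>\<^bsub>A\<^esub> b) (b' \<otimes>\<^bsub>A\<^esub> a')"
    using R(2)[of "(a, a')" "(b, b')"] by (simp add: env_pure_eq pt \<mu>_def)
qed

lemma env_pure_closed [simp]:
  "\<lbrakk>a \<in> carrier A; b \<in> carrier A\<rbrakk> \<Longrightarrow> env_pure K A a b \<in> carrier (env_alg K A)"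
  using E.pure_closed[of a b] by (simp add: env_simps env_pure_eq)

lemma spans_env: "spans (add_monoid (env_alg K A)) {env_pure K A a b | a b. a \<in> carrier A \<and> b \<in> carrier A}"
  unfolding add_monoid_env env_pure_eq using E.spans_tens by simp

end

section \<open>Tensor products over the ground field\<close>

locale bimod_pair = M: bimodule K A M + N: bimodule K A N
  for K :: "('k, 'x) ring_scheme" and A :: "('k, 'a, 'y) module_scheme"
    and M :: "('a, 'a, 'm, 'z) bimod_scheme" and N :: "('a, 'a, 'n, 'w) bimod_scheme"
begin

sublocale Tn: tensor_data M N "carrier K"
  "\<lambda>m k. m \<leftharpoonup>\<^bsub>M\<^esub> (k \<odot>\<^bsub>A\<^esub> \<one>\<^bsub>A\<^esub>)" "\<lambda>k n. (k \<odot>\<^bsub>A\<^esub> \<one>\<^bsub>A\<^esub>) \<rightharpoonup>\<^bsub>N\<^esub> n"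
  by unfold_locales (auto simp: M.ract_closed N.lact_closed)

abbreviation "EA \<equiv> env_alg K A"
abbreviation "TK \<equiv> tensK K A M N"
abbreviation "tp \<equiv> tensK_pure K A M N"

lemma tp_eq: "tp = Tn.pt"
  by (simp add: tensK_pure_def)

lemma TK_simps: "carrier TK = carrier Tn.T" "monoid.mult TK = monoid.mult Tn.T" "one TK = one Tn.T"
  by (simp_all add: tensK_def Let_def)

lemma TK_comm_group: "comm_group TK"
  by (rule comm_group_cong[OF TK_simps Tn.tens_comm_group])

text \<open>\<open>hom\<close> reads only carrier and multiplication, so the bimodule record and the
  bare tensor group have literally the same homomorphisms. Facts about the group can thus be used
  for the record.\<close>

lemma hom_TK: "hom TK G = hom Tn.T G" "hom G TK = hom G Tn.T"
  by (rule hom_eq_carrier_mult; simp add: TK_simps)+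

lemma spans_TK: "spans TK {tp m n | m n. m \<in> carrier M \<and> n \<in> carrier N}"
  unfolding tp_eq by (rule spans_cong[OF TK_simps Tn.tens_comm_group Tn.spans_tens])

lemma tp_closed [simp]: "\<lbrakk>m \<in> carrier M; n \<in> carrier N\<rbrakk> \<Longrightarrow> tp m n \<in> carrier TK"
  by (simp add: TK_simps tp_eq)

lemma tp_hom_left: "n \<in> carrier N \<Longrightarrow> (\<lambda>m. tp m n) \<in> hom M TK"
  unfolding hom_TK tp_eq by (rule Tn.pure_hom_left)

lemma tp_hom_right: "m \<in> carrier M \<Longrightarrow> tp m \<in> hom N TK"
  unfolding hom_TK tp_eq by (rule Tn.pure_hom_right)

lemma tp_balanced: "\<lbrakk>m \<in> carrier M; n \<in> carrier N; k \<in> carrier K\<rbrakk>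
  \<Longrightarrow> tp (m \<leftharpoonup>\<^bsub>M\<^esub> M.kone k) n = tp m (M.kone k \<rightharpoonup>\<^bsub>N\<^esub> n)"
  unfolding tp_eq M.kone_def by (rule Tn.pure_balanced)

text \<open>Balancing moves scalars between the two inner sides of a pure tensor; centrality in
  \<open>M\<close> and in \<open>N\<close> transfers this to the two outer sides. That is where the
  left action of \<open>A^e\<close> places its scalars.\<close>

lemma kone_swap:
  assumes "m \<in> carrier M" "n \<in> carrier N" "k \<in> carrier K"
  shows "tp (M.kone k \<rightharpoonup>\<^bsub>M\<^esub> m) n = tp m (n \<leftharpoonup>\<^bsub>N\<^esub> M.kone k)"
  using tp_balanced[OF assms] M.kone_central[OF assms(3,1)] N.kone_central[OF assms(3,2)]
  by (simp add: M.kone_def N.kone_def)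

abbreviation "eS \<equiv> carrier (add_monoid A) \<times> carrier (add_monoid A)"
abbreviation "eE \<equiv> tens_rels (carrier K) (add_monoid A) (\<lambda>a k. k \<odot>\<^bsub>A\<^esub> a) (add_monoid A) (\<lambda>k a. k \<odot>\<^bsub>A\<^esub> a)"
abbreviation "tS \<equiv> carrier M \<times> carrier N"
abbreviation "tE \<equiv> tens_rels (carrier K) M (\<lambda>m k. m \<leftharpoonup>\<^bsub>M\<^esub> (k \<odot>\<^bsub>A\<^esub> \<one>\<^bsub>A\<^esub>)) N (\<lambda>k n. (k \<odot>\<^bsub>A\<^esub> \<one>\<^bsub>A\<^esub>) \<rightharpoonup>\<^bsub>N\<^esub> n)"

text \<open>Two kinds of balancedness over \<open>K\<close> have to be checked. In the argument from
  \<open>M\<close> and \<open>N\<close> the scalar sits between the factors and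
  \<open>tp_balanced\<close> applies; in the argument from \<open>A^e\<close> it ends up on the
  outside, which calls for \<open>kone_swap\<close>.\<close>

lemma L_two_presentations:
  "two_presentations eS eE tS tE Tn.T (\<lambda>g h. tp (fst g \<rightharpoonup>\<^bsub>M\<^esub> fst h) (snd h \<leftharpoonup>\<^bsub>N\<^esub> snd g))"
proof (intro two_presentations.intro two_presentations_axioms.intro M.E.P.presentation_axioms
    Tn.P.presentation_axioms Tn.tens_comm_group)
  fix g assume "g \<in> eS"
  then have g: "fst g \<in> carrier A" "snd g \<in> carrier A" by auto
  show "respects_rels tS tE Tn.T (\<lambda>h. tp (fst g \<rightharpoonup>\<^bsub>M\<^esub> fst h) (snd h \<leftharpoonup>\<^bsub>N\<^esub> snd g))"
  proof (rule Tn.tens_respects[OF Tn.tens_comm_group], goal_cases)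
    case (1 m)
    with g show ?case
      using hom_compose_lam[OF N.ract_hom tp_hom_right, of "snd g" "fst g \<rightharpoonup>\<^bsub>M\<^esub> m"]
      by (simp add: M.lact_closed hom_TK)
  next
    case (2 n)
    with g show ?case
      using hom_compose_lam[OF M.lact_hom tp_hom_left, of "fst g" "n \<leftharpoonup>\<^bsub>N\<^esub> snd g"]
      by (simp add: N.ract_closed hom_TK)
  next
    case (3 m k n)
    with g show ?case
      using tp_balanced[of "fst g \<rightharpoonup>\<^bsub>M\<^esub> m" "n \<leftharpoonup>\<^bsub>N\<^esub> snd g" k]
      by (simp add: M.lact_ract N.lact_ract M.lact_closed N.ract_closed M.kone_def)
  qed
next
  fix h assume "h \<in> tS"
  then have h: "fst h \<in> carrier M" "snd h \<in> carrier N" by auto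
  show "respects_rels eS eE Tn.T (\<lambda>g. tp (fst g \<rightharpoonup>\<^bsub>M\<^esub> fst h) (snd h \<leftharpoonup>\<^bsub>N\<^esub> snd g))"
  proof (rule M.E.tens_respects[OF Tn.tens_comm_group], goal_cases)
    case (1 a)
    with h show ?case
      using hom_compose_lam[OF N.ract_hom_right tp_hom_right, of "snd h" "a \<rightharpoonup>\<^bsub>M\<^esub> fst h"]
      by (simp add: M.lact_closed hom_TK)
  next
    case (2 a)
    with h show ?case
      using hom_compose_lam[OF M.lact_hom_left tp_hom_left, of "fst h" "snd h \<leftharpoonup>\<^bsub>N\<^esub> a"]
      by (simp add: N.ract_closed hom_TK)
  next
    case (3 a k b)
    with h have "tp ((M.kone k \<otimes>\<^bsub>A\<^esub> a) \<rightharpoonup>\<^bsub>M\<^esub> fst h) (snd h \<leftharpoonup>\<^bsub>N\<^esub> b) = tp (a \<rightharpoonup>\<^bsub>M\<^esub> fst h) (snd h \<leftharpoonup>\<^bsub>N\<^esub> (b \<otimes>\<^bsub>A\<^esub> M.kone k))"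
      using kone_swap[of "a \<rightharpoonup>\<^bsub>M\<^esub> fst h" "snd h \<leftharpoonup>\<^bsub>N\<^esub> b" k]
      by (simp add: M.lact_closed N.ract_closed M.mult_lact N.ract_mult)
    with 3 show ?case
      by (simp add: M.smult_kone(1)[of k a] M.smult_kone(2)[of k b])
  qed
qed

lemma R_two_presentations:
  "two_presentations eS eE tS tE Tn.T (\<lambda>g h. tp (fst h \<leftharpoonup>\<^bsub>M\<^esub> fst g) (snd g \<rightharpoonup>\<^bsub>N\<^esub> snd h))"
proof (intro two_presentations.intro two_presentations_axioms.intro M.E.P.presentation_axioms
    Tn.P.presentation_axioms Tn.tens_comm_group)
  fix g assume "g \<in> eS"
  then have g: "fst g \<in> carrier A" "snd g \<in> carrier A" by auto
  show "respects_rels tS tE Tn.T (\<lambda>h. tp (fst h \<leftharpoonup>\<^bsub>M\<^esub> fst g) (snd g \<rightharpoonup>\<^bsub>N\<^esub> snd h))"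
  proof (rule Tn.tens_respects[OF Tn.tens_comm_group], goal_cases)
    case (1 m)
    with g show ?case
      using hom_compose_lam[OF N.lact_hom tp_hom_right, of "snd g" "m \<leftharpoonup>\<^bsub>M\<^esub> fst g"]
      by (simp add: M.ract_closed hom_TK)
  next
    case (2 n)
    with g show ?case
      using hom_compose_lam[OF M.ract_hom tp_hom_left, of "fst g" "snd g \<rightharpoonup>\<^bsub>N\<^esub> n"]
      by (simp add: N.lact_closed hom_TK)
  next
    case (3 m k n)
    with g have "tp ((M.kone k \<rightharpoonup>\<^bsub>M\<^esub> m) \<leftharpoonup>\<^bsub>M\<^esub> fst g) (snd g \<rightharpoonup>\<^bsub>N\<^esub> n) = tp (m \<leftharpoonup>\<^bsub>M\<^esub> fst g) (snd g \<rightharpoonup>\<^bsub>N\<^esub> (n \<leftharpoonup>\<^bsub>N\<^esub> M.kone k))"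
      using kone_swap[of "m \<leftharpoonup>\<^bsub>M\<^esub> fst g" "snd g \<rightharpoonup>\<^bsub>N\<^esub> n" k]
      by (simp add: M.lact_ract N.lact_ract[symmetric] M.ract_closed N.lact_closed)
    with 3 g show ?case
      using M.kone_central[of k m] N.kone_central[of k n] by (simp add: M.kone_def N.kone_def)
  qed
next
  fix h assume "h \<in> tS"
  then have h: "fst h \<in> carrier M" "snd h \<in> carrier N" by auto
  show "respects_rels eS eE Tn.T (\<lambda>g. tp (fst h \<leftharpoonup>\<^bsub>M\<^esub> fst g) (snd g \<rightharpoonup>\<^bsub>N\<^esub> snd h))"
  proof (rule M.E.tens_respects[OF Tn.tens_comm_group], goal_cases)
    case (1 a)
    with h show ?case
      using hom_compose_lam[OF N.lact_hom_left tp_hom_right, of "snd h" "fst h \<leftharpoonup>\<^bsub>M\<^esub> a"]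
      by (simp add: M.ract_closed hom_TK)
  next
    case (2 a)
    with h show ?case
      using hom_compose_lam[OF M.ract_hom_right tp_hom_left, of "fst h" "a \<rightharpoonup>\<^bsub>N\<^esub> snd h"]
      by (simp add: N.lact_closed hom_TK)
  next
    case (3 a k b)
    with h have "tp (fst h \<leftharpoonup>\<^bsub>M\<^esub> (a \<otimes>\<^bsub>A\<^esub> M.kone k)) (b \<rightharpoonup>\<^bsub>N\<^esub> snd h) = tp (fst h \<leftharpoonup>\<^bsub>M\<^esub> a) ((M.kone k \<otimes>\<^bsub>A\<^esub> b) \<rightharpoonup>\<^bsub>N\<^esub> snd h)"
      using tp_balanced[of "fst h \<leftharpoonup>\<^bsub>M\<^esub> a" "b \<rightharpoonup>\<^bsub>N\<^esub> snd h" k]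
      by (simp add: M.ract_closed N.lact_closed M.ract_mult N.mult_lact)
    with 3 show ?case
      by (simp add: M.smult_kone(2)[of k a] M.smult_kone(1)[of k b])
  qed
qed

lemma TK_lact: "lact TK = two_presentations.bi_ext Tn.T (\<lambda>g h. tp (fst g \<rightharpoonup>\<^bsub>M\<^esub> fst h) (snd h \<leftharpoonup>\<^bsub>N\<^esub> snd g))"
  unfolding two_presentations.bi_ext_def[OF L_two_presentations]
  by (simp add: tensK_def Let_def case_prod_unfold)

lemma TK_ract: "ract TK t s = two_presentations.bi_ext Tn.T (\<lambda>g h. tp (fst h \<leftharpoonup>\<^bsub>M\<^esub> fst g) (snd g \<rightharpoonup>\<^bsub>N\<^esub> snd h)) s t"
  unfolding two_presentations.bi_ext_def[OF R_two_presentations]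
  by (simp add: tensK_def Let_def case_prod_unfold)

lemma agp_eqs: "agp eS eE = add_monoid EA" "agp tS tE = Tn.T"
  unfolding M.add_monoid_env by (simp_all add: tens_def)

lemma TK_homs:
  "t \<in> carrier TK \<Longrightarrow> (\<lambda>s. s \<rightharpoonup>\<^bsub>TK\<^esub> t) \<in> hom (add_monoid EA) TK"
  "s \<in> carrier EA \<Longrightarrow> lact TK s \<in> hom TK TK"
  "t \<in> carrier TK \<Longrightarrow> ract TK t \<in> hom (add_monoid EA) TK"
  "s \<in> carrier EA \<Longrightarrow> (\<lambda>t. t \<leftharpoonup>\<^bsub>TK\<^esub> s) \<in> hom TK TK"
  using two_presentations.bi_ext_hom_left[OF L_two_presentations, unfolded agp_eqs]
    two_presentations.bi_ext_hom_right[OF L_two_presentations, unfolded agp_eqs]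
    two_presentations.bi_ext_hom_left[OF R_two_presentations, unfolded agp_eqs]
    two_presentations.bi_ext_hom_right[OF R_two_presentations, unfolded agp_eqs]
  unfolding hom_TK TK_lact TK_ract[abs_def] TK_simps by auto

lemma TK_act_pure:
  assumes "a \<in> carrier A" "b \<in> carrier A" "m \<in> carrier M" "n \<in> carrier N"
  shows "env_pure K A a b \<rightharpoonup>\<^bsub>TK\<^esub> tp m n = tp (a \<rightharpoonup>\<^bsub>M\<^esub> m) (n \<leftharpoonup>\<^bsub>N\<^esub> b)"
    and "tp m n \<leftharpoonup>\<^bsub>TK\<^esub> env_pure K A a b = tp (m \<leftharpoonup>\<^bsub>M\<^esub> a) (b \<rightharpoonup>\<^bsub>N\<^esub> n)"
  using two_presentations.bi_ext_gen[OF L_two_presentations, of "(a, b)" "(m, n)"]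
    two_presentations.bi_ext_gen[OF R_two_presentations, of "(a, b)" "(m, n)"] assms
  by (simp_all add: TK_lact TK_ract M.env_pure_eq tp_eq pure_tens_def)

text \<open>The distributive laws are the additivity statements of \<open>TK_homs\<close>. The laws
  for products and for commuting actions compare maps additive in three arguments, so pure tensors
  suffice, and there each law splits into one law of \<open>M\<close> and one of
  \<open>N\<close>.\<close>

lemma TK_ring_bimod: "ring_bimod EA TK"
proof -
  interpret E: ring EA by (rule M.env_ring)
  interpret T: comm_group TK by (rule TK_comm_group)
  note cl = hom_in_carrier[OF TK_homs(2)] hom_in_carrier[OF TK_homs(4)]
  note mu = ring_mult_homs[OF M.env_ring, simplified]
  note hs = TK_homs[simplified]
  note sp = M.spans_env spans_TK
  show ?thesis
  proof (intro ring_bimod.intro ring_bimod_axioms.intro left_mod.intro left_mod_axioms.intro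
      E.ring_axioms T.comm_group_axioms, goal_cases)
    case (4 r s m)
    show ?case
      by (rule spans_tri_eqI[OF sp(1,1,2) T.is_group, of "\<lambda>r s m. (r \<otimes>\<^bsub>EA\<^esub> s) \<rightharpoonup>\<^bsub>TK\<^esub> m" "\<lambda>r s m. r \<rightharpoonup>\<^bsub>TK\<^esub> s \<rightharpoonup>\<^bsub>TK\<^esub> m"])
        (use 4 in \<open>auto intro!: hs hom_compose_lam[OF mu(1) hs(1)] hom_compose_lam[OF mu(2) hs(1)]
          hom_compose_lam[OF hs(1) hs(2)] hom_compose_lam[OF hs(2) hs(2)]
          simp: cl M.env_mult TK_act_pure M.lact_closed N.ract_closed M.mult_lact N.ract_mult\<close>)
  next
    case (5 m)
    show ?case
      by (rule spans_hom_eqI[OF sp(2) T.is_group TK_homs(2) _ _ 5, of _ "\<lambda>x. x"])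
        (auto simp: M.env_simps(4) TK_act_pure M.one_lact N.ract_one hom_def)
  next
    case (9 m r s)
    show ?case
      by (rule spans_tri_eqI[OF sp(1,1,2) T.is_group, of "\<lambda>r s m. m \<leftharpoonup>\<^bsub>TK\<^esub> (r \<otimes>\<^bsub>EA\<^esub> s)" "\<lambda>r s m. m \<leftharpoonup>\<^bsub>TK\<^esub> r \<leftharpoonup>\<^bsub>TK\<^esub> s"])
        (use 9 in \<open>auto intro!: hs hom_compose_lam[OF mu(1) hs(3)] hom_compose_lam[OF mu(2) hs(3)]
          hom_compose_lam[OF hs(3) hs(4)] hom_compose_lam[OF hs(4) hs(4)]
          simp: cl M.env_mult TK_act_pure M.ract_closed N.lact_closed M.ract_mult N.mult_lact\<close>)
  next
    case (10 m)
    show ?case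
      by (rule spans_hom_eqI[OF sp(2) T.is_group TK_homs(4) _ _ 10, of _ "\<lambda>x. x"])
        (auto simp: M.env_simps(4) TK_act_pure N.one_lact M.ract_one hom_def)
  next
    case (11 m r s)
    show ?case
      by (rule spans_tri_eqI[OF sp(1,1,2) T.is_group, of "\<lambda>r s m. (r \<rightharpoonup>\<^bsub>TK\<^esub> m) \<leftharpoonup>\<^bsub>TK\<^esub> s" "\<lambda>r s m. r \<rightharpoonup>\<^bsub>TK\<^esub> (m \<leftharpoonup>\<^bsub>TK\<^esub> s)"])
        (use 11 in \<open>auto intro!: hs hom_compose_lam[OF hs(1) hs(4)] hom_compose_lam[OF hs(2) hs(4)]
          hom_compose_lam[OF hs(3) hs(2)] hom_compose_lam[OF hs(4) hs(2)]
          simp: cl TK_act_pure M.lact_closed N.ract_closed M.ract_closed N.lact_closed M.lact_ract N.lact_ract\<close>)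
  qed (use cl hom_mult[OF TK_homs(1)] hom_mult[OF TK_homs(2)] hom_mult[OF TK_homs(3)] hom_mult[OF TK_homs(4)] in auto)
qed

end


subsection \<open>Direct sums\<close>

lemma bimod_sum_simps [simp]:
  "carrier (bimod_sum M N) = carrier M \<times> carrier N"
  "(a, b) \<otimes>\<^bsub>bimod_sum M N\<^esub> (c, d) = (a \<otimes>\<^bsub>M\<^esub> c, b \<otimes>\<^bsub>N\<^esub> d)"
  "\<one>\<^bsub>bimod_sum M N\<^esub> = (\<one>\<^bsub>M\<^esub>, \<one>\<^bsub>N\<^esub>)"
  "r \<rightharpoonup>\<^bsub>bimod_sum M N\<^esub> (a, b) = (r \<rightharpoonup>\<^bsub>M\<^esub> a, r \<rightharpoonup>\<^bsub>N\<^esub> b)"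
  "(a, b) \<leftharpoonup>\<^bsub>bimod_sum M N\<^esub> r = (a \<leftharpoonup>\<^bsub>M\<^esub> r, b \<leftharpoonup>\<^bsub>N\<^esub> r)"
  by (auto simp: bimod_sum_def DirProd_def)

lemma ring_bimod_sum:
  assumes "ring_bimod B M" "ring_bimod B N"
  shows "ring_bimod B (bimod_sum M N)"
proof -
  interpret M: ring_bimod B M by fact
  interpret N: ring_bimod B N by fact
  have "comm_group (bimod_sum M N)"
  proof (rule comm_groupI)
    show "\<exists>y\<in>carrier (bimod_sum M N). y \<otimes>\<^bsub>bimod_sum M N\<^esub> x = \<one>\<^bsub>bimod_sum M N\<^esub>"
      if "x \<in> carrier (bimod_sum M N)" for x
      using that by (cases x) (auto intro!: bexI[of _ "inv\<^bsub>M\<^esub> fst x"] bexI[of _ "inv\<^bsub>N\<^esub> snd x"])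
  qed (auto simp: M.M.m_ac N.M.m_ac)
  then show ?thesis
    by (intro ring_bimod.intro ring_bimod_axioms.intro left_mod.intro left_mod_axioms.intro M.R.ring_axioms)
      (auto simp: M.lact_closed M.lact_add M.add_lact M.mult_lact M.one_lact M.ract_closed M.add_ract
        M.ract_add M.ract_mult M.ract_one M.lact_ract
        N.lact_closed N.lact_add N.add_lact N.mult_lact N.one_lact N.ract_closed N.add_ract
        N.ract_add N.ract_mult N.ract_one N.lact_ract)
qed

section \<open>Dual bimodules and coevaluation\<close>

lemma reg_bimod_simps [simp]:
  "carrier (reg_bimod A) = carrier A" "monoid.mult (reg_bimod A) = ring.add A"
  "one (reg_bimod A) = ring.zero A" "lact (reg_bimod A) = monoid.mult A" "ract (reg_bimod A) = monoid.mult A"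
  by (simp_all add: reg_bimod_def)

lemma left_dual_simps:
  "monoid.mult (left_dual A \<Omega>) x x' = (\<lambda>\<omega>\<in>carrier \<Omega>. x \<omega> \<oplus>\<^bsub>A\<^esub> x' \<omega>)"
  "one (left_dual A \<Omega>) = (\<lambda>\<omega>\<in>carrier \<Omega>. \<zero>\<^bsub>A\<^esub>)"
  "lact (left_dual A \<Omega>) a x = (\<lambda>\<omega>\<in>carrier \<Omega>. a \<otimes>\<^bsub>A\<^esub> x \<omega>)"
  "ract (left_dual A \<Omega>) x a = (\<lambda>\<omega>\<in>carrier \<Omega>. x (a \<rightharpoonup>\<^bsub>\<Omega>\<^esub> \<omega>))"
  by (simp_all add: left_dual_def)

lemma right_dual_simps:
  "monoid.mult (right_dual A \<Omega>) x x' = (\<lambda>\<omega>\<in>carrier \<Omega>. x \<omega> \<oplus>\<^bsub>A\<^esub> x' \<omega>)"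
  "one (right_dual A \<Omega>) = (\<lambda>\<omega>\<in>carrier \<Omega>. \<zero>\<^bsub>A\<^esub>)"
  "lact (right_dual A \<Omega>) a y = (\<lambda>\<omega>\<in>carrier \<Omega>. y (\<omega> \<leftharpoonup>\<^bsub>\<Omega>\<^esub> a))"
  "ract (right_dual A \<Omega>) y a = (\<lambda>\<omega>\<in>carrier \<Omega>. y \<omega> \<otimes>\<^bsub>A\<^esub> a)"
  by (simp_all add: right_dual_def)

lemma left_dual_carrier:
  "x \<in> carrier (left_dual A \<Omega>) \<longleftrightarrow> x \<in> extensional (carrier \<Omega>)
    \<and> (\<forall>\<omega>\<in>carrier \<Omega>. x \<omega> \<in> carrier A)
    \<and> (\<forall>\<omega>\<in>carrier \<Omega>. \<forall>\<eta>\<in>carrier \<Omega>. x (\<omega> \<otimes>\<^bsub>\<Omega>\<^esub> \<eta>) = x \<omega> \<oplus>\<^bsub>A\<^esub> x \<eta>)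
    \<and> (\<forall>\<omega>\<in>carrier \<Omega>. \<forall>a\<in>carrier A. x (\<omega> \<leftharpoonup>\<^bsub>\<Omega>\<^esub> a) = x \<omega> \<otimes>\<^bsub>A\<^esub> a)"
  by (auto simp: left_dual_def rmod_hom_def hom_def Pi_iff)

lemma right_dual_carrier:
  "x \<in> carrier (right_dual A \<Omega>) \<longleftrightarrow> x \<in> extensional (carrier \<Omega>)
    \<and> (\<forall>\<omega>\<in>carrier \<Omega>. x \<omega> \<in> carrier A)
    \<and> (\<forall>\<omega>\<in>carrier \<Omega>. \<forall>\<eta>\<in>carrier \<Omega>. x (\<omega> \<otimes>\<^bsub>\<Omega>\<^esub> \<eta>) = x \<omega> \<oplus>\<^bsub>A\<^esub> x \<eta>)
    \<and> (\<forall>\<omega>\<in>carrier \<Omega>. \<forall>a\<in>carrier A. x (a \<rightharpoonup>\<^bsub>\<Omega>\<^esub> \<omega>) = a \<otimes>\<^bsub>A\<^esub> x \<omega>)"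
  by (auto simp: right_dual_def lmod_hom_def hom_def Pi_iff)

context bimodule begin

lemma ext_eqI: "\<lbrakk>x \<in> extensional (carrier M); y \<in> extensional (carrier M); \<And>\<omega>. \<omega> \<in> carrier M \<Longrightarrow> x \<omega> = y \<omega>\<rbrakk> \<Longrightarrow> x = y"
  by (rule extensionalityI)

lemma left_dual_bimodule: "bimodule K A (left_dual A M)"
proof -
  note c = left_dual_carrier[of _ A M]
  note s = left_dual_simps[of A M]
  note ms = lact_closed ract_closed lact_add add_lact mult_lact one_lact add_ract ract_add ract_mult ract_one lact_ract[symmetric]
  have cg: "comm_group (left_dual A M)"
  proof (rule comm_groupI)
    fix x assume x: "x \<in> carrier (left_dual A M)"
    then have "(\<lambda>\<omega>\<in>carrier M. \<ominus>\<^bsub>A\<^esub> x \<omega>) \<in> carrier (left_dual A M)"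
      unfolding c by (auto simp: A.minus_add A.l_minus ms)
    moreover have "(\<lambda>\<omega>\<in>carrier M. \<ominus>\<^bsub>A\<^esub> x \<omega>) \<otimes>\<^bsub>left_dual A M\<^esub> x = \<one>\<^bsub>left_dual A M\<^esub>"
      using x unfolding c by (auto simp: s A.l_neg fun_eq_iff)
    ultimately show "\<exists>y\<in>carrier (left_dual A M). y \<otimes>\<^bsub>left_dual A M\<^esub> x = \<one>\<^bsub>left_dual A M\<^esub>"
      by blast
  qed (unfold c s, auto intro!: ext_eqI simp: A.a_ac A.l_distr ms)
  show ?thesis
  proof (intro bimodule.intro bimodule_axioms.intro left_mod.intro left_mod_axioms.intro
      k_algebra_axioms A.ring_axioms cg, goal_cases)
    \<comment> \<open>This goal is \<open>K_central\<close>. The right action feeds \<open>k\<close>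
      into the argument of \<open>x\<close>, where it can be moved to the right and taken out by
      right linearity; the left action multiplies the value by \<open>k\<close>, which is central in
      \<open>A\<close>.\<close>
    case (12 k x)
    show ?case
    proof (rule ext_eqI)
      fix \<omega> assume \<omega>: "\<omega> \<in> carrier M"
      with 12 have "x (kone k \<rightharpoonup>\<^bsub>M\<^esub> \<omega>) = x \<omega> \<otimes>\<^bsub>A\<^esub> kone k"
        by (simp add: kone_central c)
      moreover have "kone k \<otimes>\<^bsub>A\<^esub> x \<omega> = x \<omega> \<otimes>\<^bsub>A\<^esub> kone k"
        using smult_kone[of k "x \<omega>"] 12 \<omega> by (simp add: c)
      ultimately show "((k \<odot>\<^bsub>A\<^esub> \<one>\<^bsub>A\<^esub>) \<rightharpoonup>\<^bsub>left_dual A M\<^esub> x) \<omega> = (x \<leftharpoonup>\<^bsub>left_dual A M\<^esub> (k \<odot>\<^bsub>A\<^esub> \<one>\<^bsub>A\<^esub>)) \<omega>"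
        using \<omega> by (simp add: s kone_def)
    qed (auto simp: s)
  qed (unfold c s, auto intro!: ext_eqI simp: A.m_assoc A.l_distr A.r_distr A.a_ac ms)
qed

lemma right_dual_bimodule: "bimodule K A (right_dual A M)"
proof -
  note c = right_dual_carrier[of _ A M]
  note s = right_dual_simps[of A M]
  note ms = lact_closed ract_closed lact_add add_lact mult_lact one_lact add_ract ract_add ract_mult ract_one lact_ract
  have cg: "comm_group (right_dual A M)"
  proof (rule comm_groupI)
    fix x assume x: "x \<in> carrier (right_dual A M)"
    then have "(\<lambda>\<omega>\<in>carrier M. \<ominus>\<^bsub>A\<^esub> x \<omega>) \<in> carrier (right_dual A M)"
      unfolding c by (auto simp: A.minus_add A.r_minus ms)
    moreover have "(\<lambda>\<omega>\<in>carrier M. \<ominus>\<^bsub>A\<^esub> x \<omega>) \<otimes>\<^bsub>right_dual A M\<^esub> x = \<one>\<^bsub>right_dual A M\<^esub>"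
      using x unfolding c by (auto simp: s A.l_neg fun_eq_iff)
    ultimately show "\<exists>y\<in>carrier (right_dual A M). y \<otimes>\<^bsub>right_dual A M\<^esub> x = \<one>\<^bsub>right_dual A M\<^esub>"
      by blast
  qed (unfold c s, auto intro!: ext_eqI simp: A.a_ac A.r_distr ms)
  show ?thesis
  proof (intro bimodule.intro bimodule_axioms.intro left_mod.intro left_mod_axioms.intro
      k_algebra_axioms A.ring_axioms cg, goal_cases)
    case (12 k x)
    show ?case
    proof (rule ext_eqI)
      fix \<omega> assume \<omega>: "\<omega> \<in> carrier M"
      with 12 have "x (\<omega> \<leftharpoonup>\<^bsub>M\<^esub> kone k) = kone k \<otimes>\<^bsub>A\<^esub> x \<omega>"
        by (simp add: kone_central[symmetric] c)
      moreover have "kone k \<otimes>\<^bsub>A\<^esub> x \<omega> = x \<omega> \<otimes>\<^bsub>A\<^esub> kone k"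
        using smult_kone[of k "x \<omega>"] 12 \<omega> by (simp add: c)
      ultimately show "((k \<odot>\<^bsub>A\<^esub> \<one>\<^bsub>A\<^esub>) \<rightharpoonup>\<^bsub>right_dual A M\<^esub> x) \<omega> = (x \<leftharpoonup>\<^bsub>right_dual A M\<^esub> (k \<odot>\<^bsub>A\<^esub> \<one>\<^bsub>A\<^esub>)) \<omega>"
        using \<omega> by (simp add: s kone_def)
    qed (auto simp: s)
  qed (unfold c s, auto intro!: ext_eqI simp: A.m_assoc A.l_distr A.r_distr A.a_ac ms)
qed

lemma left_dual_eval_hom: "\<omega> \<in> carrier M \<Longrightarrow> (\<lambda>x. x \<omega>) \<in> hom (left_dual A M) (add_monoid A)"
  by (rule homI) (auto simp: left_dual_carrier left_dual_simps)

lemma right_dual_eval_hom: "\<omega> \<in> carrier M \<Longrightarrow> (\<lambda>x. x \<omega>) \<in> hom (right_dual A M) (add_monoid A)"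
  by (rule homI) (auto simp: right_dual_carrier right_dual_simps)

lemma left_dual_hom: "x \<in> carrier (left_dual A M) \<Longrightarrow> x \<in> hom M (add_monoid A)"
  by (rule homI) (auto simp: left_dual_carrier)

lemma right_dual_hom: "x \<in> carrier (right_dual A M) \<Longrightarrow> x \<in> hom M (add_monoid A)"
  by (rule homI) (auto simp: right_dual_carrier)

section \<open>Dual bases of a finitely generated projective module\<close>

lemma free_bimod_simps:
  "carrier (free_bimod A n) = (\<Pi>\<^sub>E i\<in>{..<n}. carrier A)"
  "v \<otimes>\<^bsub>free_bimod A n\<^esub> w = (\<lambda>i\<in>{..<n}. v i \<oplus>\<^bsub>A\<^esub> w i)"
  "\<one>\<^bsub>free_bimod A n\<^esub> = (\<lambda>i\<in>{..<n}. \<zero>\<^bsub>A\<^esub>)"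
  "a \<rightharpoonup>\<^bsub>free_bimod A n\<^esub> v = (\<lambda>i\<in>{..<n}. a \<otimes>\<^bsub>A\<^esub> v i)"
  "v \<leftharpoonup>\<^bsub>free_bimod A n\<^esub> a = (\<lambda>i\<in>{..<n}. v i \<otimes>\<^bsub>A\<^esub> a)"
  by (simp_all add: free_bimod_def product_group_def)

definition "unit_vec n i = (\<lambda>k\<in>{..<n::nat}. if k = i then \<one>\<^bsub>A\<^esub> else \<zero>\<^bsub>A\<^esub>)"
definition "coord_vec n i a = (\<lambda>k\<in>{..<n::nat}. if k = i then a else \<zero>\<^bsub>A\<^esub>)"

text \<open>A vector is the sum of its one-coordinate parts; the proof adds these parts one after
  the other and uses only the additivity of \<open>p\<close>.\<close>

lemma hom_free_bimod_expand:
  assumes ph: "p \<in> hom (free_bimod A n) M" and v: "v \<in> carrier (free_bimod A n)"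
  shows "p v = (\<Otimes>\<^bsub>M\<^esub>i\<in>{..<n}. p (coord_vec n i (v i)))"
proof -
  let ?F = "free_bimod A n"
  \<comment> \<open>The truncation of \<open>v\<close> to its first \<open>k\<close> coordinates:
    the zero vector for \<open>k = 0\<close>, and \<open>v\<close> itself for \<open>k = n\<close>
    because \<open>v\<close> is extensional.\<close>
  let ?t = "\<lambda>k. \<lambda>i\<in>{..<n}. if i < k then v i else \<zero>\<^bsub>A\<^esub>"
  have vi: "v i \<in> carrier A" if "i < n" for i
    using v that by (auto simp: free_bimod_simps)
  have cl: "coord_vec n i (v i) \<in> carrier ?F" "?t k \<in> carrier ?F" if "i < n" for i k
    using vi that by (auto simp: coord_vec_def free_bimod_simps)
  have "k \<le> n \<Longrightarrow> p (?t k) = (\<Otimes>\<^bsub>M\<^esub>i\<in>{..<k}. p (coord_vec n i (v i)))" for k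
  proof (induction k)
    case 0
    \<comment> \<open>\<open>p\<close> sends zero to zero since the image is idempotent in the group
      \<open>M\<close>; this argument makes no use of inverses in the free module.\<close>
    let ?z = "\<one>\<^bsub>?F\<^esub>"
    have z: "?z \<in> carrier ?F" "?z \<otimes>\<^bsub>?F\<^esub> ?z = ?z" "?t 0 = ?z"
      by (auto simp: free_bimod_simps)
    then have "p ?z \<otimes>\<^bsub>M\<^esub> p ?z = p ?z"
      using hom_mult[OF ph z(1) z(1)] by simp
    then have "p ?z = \<one>\<^bsub>M\<^esub>"
      using hom_in_carrier[OF ph z(1)] M.l_cancel_one by blast
    then show ?case
      using z(3) by simp
  next
    case (Suc k)
    then have k: "k < n" by simp
    have eq: "?t (Suc k) = coord_vec n k (v k) \<otimes>\<^bsub>?F\<^esub> ?t k"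
      using vi k by (auto simp: coord_vec_def free_bimod_simps fun_eq_iff less_Suc_eq)
    have IH: "p (?t k) = (\<Otimes>\<^bsub>M\<^esub>i\<in>{..<k}. p (coord_vec n i (v i)))"
      using k by (intro Suc.IH) simp
    show ?case
      unfolding eq hom_mult[OF ph cl(1)[OF k] cl(2)[OF k]] IH lessThan_Suc
      by (subst M.finprod_insert) (use k hom_in_carrier[OF ph cl(1)] in auto)
  qed
  moreover have "v \<in> extensional {..<n}"
    using v by (simp add: free_bimod_simps PiE_def)
  then have "?t n = v"
    by (intro extensionalityI[of _ "{..<n}"]) simp_all
  ultimately show ?thesis
    by (metis order_refl)
qed

text \<open>The dual basis lemma. The \<omega>-part of the list consists of the images
  \<open>p e_i\<close> of the unit vectors, and the \<open>x\<close>-part of the coordinate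
  functions of \<open>j\<close>. The first triangle identity is
  \<open>p (j \<omega>) = \<omega>\<close> written in coordinates; the second follows by applying
  \<open>x\<close> to the first and using right linearity.\<close>

lemma coev_exists:
  assumes "fgp_right A M"
  shows "\<exists>ds. is_coev A M ds"
proof -
  obtain n j p where j: "j \<in> rmod_hom A M (free_bimod A n)" and p: "p \<in> rmod_hom A (free_bimod A n) M"
    and pj: "\<And>m. m \<in> carrier M \<Longrightarrow> p (j m) = m"
    using assms by (auto simp: fgp_right_def)
  have ph: "p \<in> hom (free_bimod A n) M"
    and pa: "\<And>v a. \<lbrakk>v \<in> carrier (free_bimod A n); a \<in> carrier A\<rbrakk> \<Longrightarrow> p (v \<leftharpoonup>\<^bsub>free_bimod A n\<^esub> a) = p v \<leftharpoonup>\<^bsub>M\<^esub> a"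
    using p by (auto simp: rmod_hom_def)
  have jc: "j m \<in> carrier (free_bimod A n)" if "m \<in> carrier M" for m
    using j that by (auto simp: rmod_hom_def hom_def)
  have uv: "unit_vec n i \<in> carrier (free_bimod A n)" for i
    by (auto simp: unit_vec_def free_bimod_simps)
  define ds where "ds = map (\<lambda>i. (p (unit_vec n i), \<lambda>\<omega>\<in>carrier M. j \<omega> i)) [0..<n]"
  have dl: "length ds = n" and d: "\<And>i. i < n \<Longrightarrow> ds ! i = (p (unit_vec n i), \<lambda>\<omega>\<in>carrier M. j \<omega> i)"
    by (simp_all add: ds_def)
  have xc: "(\<lambda>\<omega>\<in>carrier M. j \<omega> i) \<in> carrier (left_dual A M)" if "i < n" for i
    unfolding left_dual_carrier using j jc that
    by (auto simp: rmod_hom_def hom_def free_bimod_simps ract_closed)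
  have wc: "p (unit_vec n i) \<in> carrier M" for i
    using hom_in_carrier[OF ph uv] .
  have triangle: "(\<Otimes>\<^bsub>M\<^esub>i\<in>{..<n}. p (unit_vec n i) \<leftharpoonup>\<^bsub>M\<^esub> (\<lambda>\<omega>\<in>carrier M. j \<omega> i) \<omega>) = \<omega>" if "\<omega> \<in> carrier M" for \<omega>
  proof -
    have eq: "p (coord_vec n i (j \<omega> i)) = p (unit_vec n i) \<leftharpoonup>\<^bsub>M\<^esub> (\<lambda>\<omega>\<in>carrier M. j \<omega> i) \<omega>"
      and c: "p (unit_vec n i) \<leftharpoonup>\<^bsub>M\<^esub> (\<lambda>\<omega>\<in>carrier M. j \<omega> i) \<omega> \<in> carrier M" if i: "i < n" for i
    proof -
      have ji: "j \<omega> i \<in> carrier A"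
        using jc[OF \<open>\<omega> \<in> carrier M\<close>] i by (auto simp: free_bimod_simps)
      have "coord_vec n i (j \<omega> i) = unit_vec n i \<leftharpoonup>\<^bsub>free_bimod A n\<^esub> j \<omega> i"
        using ji by (auto simp: coord_vec_def unit_vec_def free_bimod_simps fun_eq_iff)
      then show "p (coord_vec n i (j \<omega> i)) = p (unit_vec n i) \<leftharpoonup>\<^bsub>M\<^esub> (\<lambda>\<omega>\<in>carrier M. j \<omega> i) \<omega>" "p (unit_vec n i) \<leftharpoonup>\<^bsub>M\<^esub> (\<lambda>\<omega>\<in>carrier M. j \<omega> i) \<omega> \<in> carrier M"
        using ji pa[OF uv ji, of i] ract_closed[OF wc ji] \<open>\<omega> \<in> carrier M\<close> by simp_all
    qed
    show ?thesis
      using hom_free_bimod_expand[OF ph jc[OF that]] pj[OF that] c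
        M.finprod_cong'[OF refl, of "\<lambda>i. p (unit_vec n i) \<leftharpoonup>\<^bsub>M\<^esub> (\<lambda>\<omega>\<in>carrier M. j \<omega> i) \<omega>" "{..<n}" "\<lambda>i. p (coord_vec n i (j \<omega> i))"]
      by (simp add: eq)
  qed
  interpret D: bimodule K A "left_dual A M" by (rule left_dual_bimodule)
  have "is_coev A M ds"
    unfolding is_coev_def dl
  proof (intro conjI ballI)
    show "set ds \<subseteq> carrier M \<times> carrier (left_dual A M)"
      using xc wc by (auto simp: ds_def)
    show "(\<Otimes>\<^bsub>M\<^esub>i\<in>{..<n}. fst (ds ! i) \<leftharpoonup>\<^bsub>M\<^esub> snd (ds ! i) \<omega>) = \<omega>" if "\<omega> \<in> carrier M" for \<omega>
      using triangle[OF that] ract_closed wc jc[OF that] that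
      by (subst M.finprod_cong'[OF refl, of "\<lambda>i. p (unit_vec n i) \<leftharpoonup>\<^bsub>M\<^esub> (\<lambda>\<omega>\<in>carrier M. j \<omega> i) \<omega>"])
        (auto simp: d free_bimod_simps)
    fix x assume x: "x \<in> carrier (left_dual A M)"
    let ?g = "\<lambda>i. x (fst (ds ! i)) \<rightharpoonup>\<^bsub>left_dual A M\<^esub> snd (ds ! i)"
    have xw: "x (p (unit_vec n i)) \<in> carrier A" for i
      using x wc by (simp add: left_dual_carrier)
    have g: "?g i \<in> carrier (left_dual A M)" if "i < n" for i
      using D.lact_closed xw xc that by (simp add: d)
    have fc: "(\<Otimes>\<^bsub>left_dual A M\<^esub>i\<in>{..<n}. ?g i) \<in> carrier (left_dual A M)"
      using g by (intro D.M.finprod_closed) auto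
    show "(\<Otimes>\<^bsub>left_dual A M\<^esub>i\<in>{..<n}. ?g i) = x"
    proof (rule ext_eqI)
      fix \<omega> assume \<omega>: "\<omega> \<in> carrier M"
      have jci: "j \<omega> i \<in> carrier A" if "i < n" for i
        using jc[OF \<omega>] that by (auto simp: free_bimod_simps)
      have "(\<Otimes>\<^bsub>left_dual A M\<^esub>i\<in>{..<n}. ?g i) \<omega> = (\<Otimes>\<^bsub>add_monoid A\<^esub>i\<in>{..<n}. ?g i \<omega>)"
        by (rule hom_finprod_lessThan[OF D.M.comm_group_axioms A.a_comm_group left_dual_eval_hom[OF \<omega>] g])
      also have "\<dots> = (\<Otimes>\<^bsub>add_monoid A\<^esub>i\<in>{..<n}. x (p (unit_vec n i) \<leftharpoonup>\<^bsub>M\<^esub> (\<lambda>\<omega>\<in>carrier M. j \<omega> i) \<omega>))"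
      proof (rule comm_monoid.finprod_cong'[OF comm_group.axioms(1)[OF A.a_comm_group] refl])
        fix i assume i: "i \<in> {..<n}"
        with jci have "j \<omega> i \<in> carrier A"
          by simp
        with i show "?g i \<omega> = x (p (unit_vec n i) \<leftharpoonup>\<^bsub>M\<^esub> (\<lambda>\<omega>\<in>carrier M. j \<omega> i) \<omega>)"
          using x wc jc[OF \<omega>] \<omega> by (auto simp: d left_dual_simps left_dual_carrier free_bimod_simps)
      qed (use hom_in_carrier[OF left_dual_hom[OF x]] wc jci \<omega> ract_closed in auto)
      also have "\<dots> = x (\<Otimes>\<^bsub>M\<^esub>i\<in>{..<n}. p (unit_vec n i) \<leftharpoonup>\<^bsub>M\<^esub> (\<lambda>\<omega>\<in>carrier M. j \<omega> i) \<omega>)"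
        by (rule hom_finprod_lessThan[OF M.comm_group_axioms A.a_comm_group left_dual_hom[OF x], symmetric])
          (use wc jc[OF \<omega>] \<omega> ract_closed in \<open>auto simp: free_bimod_simps\<close>)
      finally show "(\<Otimes>\<^bsub>left_dual A M\<^esub>i\<in>{..<n}. ?g i) \<omega> = x \<omega>"
        using triangle[OF \<omega>] by simp
    qed (use fc x in \<open>auto simp: left_dual_carrier\<close>)
  qed
  then show ?thesis ..
qed

text \<open>The mirror image of \<open>coev_exists\<close>: \<open>j\<close> and \<open>p\<close>
  are now left linear, and the coordinate functions come first in each pair.\<close>

lemma coev'_exists:
  assumes "fgp_left A M"
  shows "\<exists>ds. is_coev' A M ds"
proof -
  obtain n j p where j: "j \<in> lmod_hom A M (free_bimod A n)" and p: "p \<in> lmod_hom A (free_bimod A n) M"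
    and pj: "\<And>m. m \<in> carrier M \<Longrightarrow> p (j m) = m"
    using assms by (auto simp: fgp_left_def)
  have ph: "p \<in> hom (free_bimod A n) M"
    and pa: "\<And>v a. \<lbrakk>v \<in> carrier (free_bimod A n); a \<in> carrier A\<rbrakk> \<Longrightarrow> p (a \<rightharpoonup>\<^bsub>free_bimod A n\<^esub> v) = a \<rightharpoonup>\<^bsub>M\<^esub> p v"
    using p by (auto simp: lmod_hom_def)
  have jc: "j m \<in> carrier (free_bimod A n)" if "m \<in> carrier M" for m
    using j that by (auto simp: lmod_hom_def hom_def)
  have uv: "unit_vec n i \<in> carrier (free_bimod A n)" for i
    by (auto simp: unit_vec_def free_bimod_simps)
  define ds where "ds = map (\<lambda>i. (\<lambda>\<omega>\<in>carrier M. j \<omega> i, p (unit_vec n i))) [0..<n]"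
  have dl: "length ds = n" and d: "\<And>i. i < n \<Longrightarrow> ds ! i = (\<lambda>\<omega>\<in>carrier M. j \<omega> i, p (unit_vec n i))"
    by (simp_all add: ds_def)
  have xc: "(\<lambda>\<omega>\<in>carrier M. j \<omega> i) \<in> carrier (right_dual A M)" if "i < n" for i
    unfolding right_dual_carrier using j jc that
    by (auto simp: lmod_hom_def hom_def free_bimod_simps lact_closed)
  have wc: "p (unit_vec n i) \<in> carrier M" for i
    using hom_in_carrier[OF ph uv] .
  have triangle: "(\<Otimes>\<^bsub>M\<^esub>i\<in>{..<n}. (\<lambda>\<omega>\<in>carrier M. j \<omega> i) \<omega> \<rightharpoonup>\<^bsub>M\<^esub> p (unit_vec n i)) = \<omega>" if "\<omega> \<in> carrier M" for \<omega>
  proof -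
    have eq: "p (coord_vec n i (j \<omega> i)) = (\<lambda>\<omega>\<in>carrier M. j \<omega> i) \<omega> \<rightharpoonup>\<^bsub>M\<^esub> p (unit_vec n i)"
      and c: "(\<lambda>\<omega>\<in>carrier M. j \<omega> i) \<omega> \<rightharpoonup>\<^bsub>M\<^esub> p (unit_vec n i) \<in> carrier M" if i: "i < n" for i
    proof -
      have ji: "j \<omega> i \<in> carrier A"
        using jc[OF \<open>\<omega> \<in> carrier M\<close>] i by (auto simp: free_bimod_simps)
      have "coord_vec n i (j \<omega> i) = j \<omega> i \<rightharpoonup>\<^bsub>free_bimod A n\<^esub> unit_vec n i"
        using ji by (auto simp: coord_vec_def unit_vec_def free_bimod_simps fun_eq_iff)
      then show "p (coord_vec n i (j \<omega> i)) = (\<lambda>\<omega>\<in>carrier M. j \<omega> i) \<omega> \<rightharpoonup>\<^bsub>M\<^esub> p (unit_vec n i)" "(\<lambda>\<omega>\<in>carrier M. j \<omega> i) \<omega> \<rightharpoonup>\<^bsub>M\<^esub> p (unit_vec n i) \<in> carrier M"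
        using ji pa[OF uv ji, of i] lact_closed[OF ji wc] \<open>\<omega> \<in> carrier M\<close> by simp_all
    qed
    show ?thesis
      using hom_free_bimod_expand[OF ph jc[OF that]] pj[OF that] c
        M.finprod_cong'[OF refl, of "\<lambda>i. (\<lambda>\<omega>\<in>carrier M. j \<omega> i) \<omega> \<rightharpoonup>\<^bsub>M\<^esub> p (unit_vec n i)" "{..<n}" "\<lambda>i. p (coord_vec n i (j \<omega> i))"]
      by (simp add: eq)
  qed
  interpret D: bimodule K A "right_dual A M" by (rule right_dual_bimodule)
  have "is_coev' A M ds"
    unfolding is_coev'_def dl
  proof (intro conjI ballI)
    show "set ds \<subseteq> carrier (right_dual A M) \<times> carrier M"
      using xc wc by (auto simp: ds_def)
    show "(\<Otimes>\<^bsub>M\<^esub>i\<in>{..<n}. fst (ds ! i) \<omega> \<rightharpoonup>\<^bsub>M\<^esub> snd (ds ! i)) = \<omega>" if "\<omega> \<in> carrier M" for \<omega>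
      using triangle[OF that] lact_closed wc jc[OF that] that
      by (subst M.finprod_cong'[OF refl, of "\<lambda>i. (\<lambda>\<omega>\<in>carrier M. j \<omega> i) \<omega> \<rightharpoonup>\<^bsub>M\<^esub> p (unit_vec n i)"])
        (auto simp: d free_bimod_simps)
    fix x assume x: "x \<in> carrier (right_dual A M)"
    let ?g = "\<lambda>i. fst (ds ! i) \<leftharpoonup>\<^bsub>right_dual A M\<^esub> x (snd (ds ! i))"
    have xw: "x (p (unit_vec n i)) \<in> carrier A" for i
      using x wc by (simp add: right_dual_carrier)
    have g: "?g i \<in> carrier (right_dual A M)" if "i < n" for i
      using D.ract_closed xw xc that by (simp add: d)
    have fc: "(\<Otimes>\<^bsub>right_dual A M\<^esub>i\<in>{..<n}. ?g i) \<in> carrier (right_dual A M)"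
      using g by (intro D.M.finprod_closed) auto
    show "(\<Otimes>\<^bsub>right_dual A M\<^esub>i\<in>{..<n}. ?g i) = x"
    proof (rule ext_eqI)
      fix \<omega> assume \<omega>: "\<omega> \<in> carrier M"
      have jci: "j \<omega> i \<in> carrier A" if "i < n" for i
        using jc[OF \<omega>] that by (auto simp: free_bimod_simps)
      have "(\<Otimes>\<^bsub>right_dual A M\<^esub>i\<in>{..<n}. ?g i) \<omega> = (\<Otimes>\<^bsub>add_monoid A\<^esub>i\<in>{..<n}. ?g i \<omega>)"
        by (rule hom_finprod_lessThan[OF D.M.comm_group_axioms A.a_comm_group right_dual_eval_hom[OF \<omega>] g])
      also have "\<dots> = (\<Otimes>\<^bsub>add_monoid A\<^esub>i\<in>{..<n}. x ((\<lambda>\<omega>\<in>carrier M. j \<omega> i) \<omega> \<rightharpoonup>\<^bsub>M\<^esub> p (unit_vec n i)))"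
      proof (rule comm_monoid.finprod_cong'[OF comm_group.axioms(1)[OF A.a_comm_group] refl])
        fix i assume i: "i \<in> {..<n}"
        with jci have "j \<omega> i \<in> carrier A"
          by simp
        with i show "?g i \<omega> = x ((\<lambda>\<omega>\<in>carrier M. j \<omega> i) \<omega> \<rightharpoonup>\<^bsub>M\<^esub> p (unit_vec n i))"
          using x wc jc[OF \<omega>] \<omega> by (auto simp: d right_dual_simps right_dual_carrier free_bimod_simps)
      qed (use hom_in_carrier[OF right_dual_hom[OF x]] wc jci \<omega> lact_closed in auto)
      also have "\<dots> = x (\<Otimes>\<^bsub>M\<^esub>i\<in>{..<n}. (\<lambda>\<omega>\<in>carrier M. j \<omega> i) \<omega> \<rightharpoonup>\<^bsub>M\<^esub> p (unit_vec n i))"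
        by (rule hom_finprod_lessThan[OF M.comm_group_axioms A.a_comm_group right_dual_hom[OF x], symmetric])
          (use wc jc[OF \<omega>] \<omega> lact_closed in \<open>auto simp: free_bimod_simps\<close>)
      finally show "(\<Otimes>\<^bsub>right_dual A M\<^esub>i\<in>{..<n}. ?g i) \<omega> = x \<omega>"
        using triangle[OF \<omega>] by simp
    qed (use fc x in \<open>auto simp: right_dual_carrier\<close>)
  qed
  then show ?thesis ..
qed

end

section \<open>The tensor algebra\<close>

lemma foldr_mult_append:
  assumes "monoid R" "set xs \<subseteq> carrier R" "set ys \<subseteq> carrier R"
  shows "foldr (\<otimes>\<^bsub>R\<^esub>) (xs @ ys) \<one>\<^bsub>R\<^esub> = foldr (\<otimes>\<^bsub>R\<^esub>) xs \<one>\<^bsub>R\<^esub> \<otimes>\<^bsub>R\<^esub> foldr (\<otimes>\<^bsub>R\<^esub>) ys \<one>\<^bsub>R\<^esub>"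
    and "foldr (\<otimes>\<^bsub>R\<^esub>) xs \<one>\<^bsub>R\<^esub> \<in> carrier R"
proof -
  interpret monoid R by fact
  have c: "foldr (\<otimes>\<^bsub>R\<^esub>) zs \<one>\<^bsub>R\<^esub> \<in> carrier R" if "set zs \<subseteq> carrier R" for zs
    using that by (induction zs) auto
  show "foldr (\<otimes>\<^bsub>R\<^esub>) xs \<one>\<^bsub>R\<^esub> \<in> carrier R"
    by (rule c[OF assms(2)])
  show "foldr (\<otimes>\<^bsub>R\<^esub>) (xs @ ys) \<one>\<^bsub>R\<^esub> = foldr (\<otimes>\<^bsub>R\<^esub>) xs \<one>\<^bsub>R\<^esub> \<otimes>\<^bsub>R\<^esub> foldr (\<otimes>\<^bsub>R\<^esub>) ys \<one>\<^bsub>R\<^esub>"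
    using assms(2) c[OF assms(3)] by (induction xs) (auto simp: m_assoc c)
qed

context ring_bimod begin

abbreviation "W \<equiv> tword B V"
abbreviation "WE \<equiv> tword_rels B V"
abbreviation "wg \<equiv> agp_gen W WE"
abbreviation "TA \<equiv> tens_alg B V"

lemma tword_Inl [simp]: "Inl b \<in> W \<longleftrightarrow> b \<in> carrier B"
  and tword_Inr [simp]: "Inr vs \<in> W \<longleftrightarrow> vs \<noteq> [] \<and> set vs \<subseteq> carrier V"
  by (auto simp: tword_def)

lemma tword_rels_cases:
  assumes "e \<in> WE"
  obtains (base) b c where "e = frag_of (Inl (b \<oplus>\<^bsub>B\<^esub> c)) - frag_of (Inl b) - frag_of (Inl c)"
      "b \<in> carrier B" "c \<in> carrier B"
  | (add) us v w ws where "e = frag_of (Inr (us @ [v \<otimes>\<^bsub>V\<^esub> w] @ ws)) - frag_of (Inr (us @ [v] @ ws))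
        - frag_of (Inr (us @ [w] @ ws))"
      "set us \<subseteq> carrier V" "v \<in> carrier V" "w \<in> carrier V" "set ws \<subseteq> carrier V"
  | (bal) us v b w ws where "e = frag_of (Inr (us @ [v \<leftharpoonup>\<^bsub>V\<^esub> b, w] @ ws)) - frag_of (Inr (us @ [v, b \<rightharpoonup>\<^bsub>V\<^esub> w] @ ws))"
      "set us \<subseteq> carrier V" "v \<in> carrier V" "b \<in> carrier B" "w \<in> carrier V" "set ws \<subseteq> carrier V"
  using assms unfolding tword_rels_def by blast

sublocale W: presentation W WE
proof
  fix e assume "e \<in> WE"
  then show "Poly_Mapping.keys e \<subseteq> W"
  proof (cases rule: tword_rels_cases)
    case (base b c)
    then show ?thesis
      by (simp add: keys_frag_rel3)
  next
    case (add us v w ws)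
    then show ?thesis
      by (simp add: keys_frag_rel3)
  next
    case (bal us v b w ws)
    then show ?thesis
      by (simp add: keys_frag_rel2 lact_closed ract_closed)
  qed
qed

lemma tword_respects:
  assumes "comm_group G" and \<phi>: "\<phi> \<in> W \<rightarrow> carrier G"
    and base: "\<And>b c. \<lbrakk>b \<in> carrier B; c \<in> carrier B\<rbrakk> \<Longrightarrow> \<phi> (Inl (b \<oplus>\<^bsub>B\<^esub> c)) = \<phi> (Inl b) \<otimes>\<^bsub>G\<^esub> \<phi> (Inl c)"
    and add: "\<And>us v w ws. \<lbrakk>set us \<subseteq> carrier V; v \<in> carrier V; w \<in> carrier V; set ws \<subseteq> carrier V\<rbrakk>
      \<Longrightarrow> \<phi> (Inr (us @ (v \<otimes>\<^bsub>V\<^esub> w) # ws)) = \<phi> (Inr (us @ v # ws)) \<otimes>\<^bsub>G\<^esub> \<phi> (Inr (us @ w # ws))"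
    and bal: "\<And>us v b w ws. \<lbrakk>set us \<subseteq> carrier V; v \<in> carrier V; b \<in> carrier B; w \<in> carrier V; set ws \<subseteq> carrier V\<rbrakk>
      \<Longrightarrow> \<phi> (Inr (us @ (v \<leftharpoonup>\<^bsub>V\<^esub> b) # w # ws)) = \<phi> (Inr (us @ v # (b \<rightharpoonup>\<^bsub>V\<^esub> w) # ws))"
  shows "respects_rels W WE G \<phi>"
  unfolding respects_rels_def
proof (intro conjI ballI \<phi>)
  fix e assume "e \<in> WE"
  then show "free_ext G \<phi> e = \<one>\<^bsub>G\<^esub>"
  proof (cases rule: tword_rels_cases)
    case (base b c)
    then show ?thesis
      using free_ext_rel3[OF assms(1) \<phi>] assms(3) by simp
  next
    case (add us v w ws)
    then show ?thesis
      using free_ext_rel3[OF assms(1) \<phi>] assms(4) by simp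
  next
    case (bal us v b w ws)
    then show ?thesis
      using free_ext_rel2[OF assms(1) \<phi>] assms(5) by (simp add: lact_closed ract_closed)
  qed
qed

lemma tword_rels_intros:
  "\<lbrakk>b \<in> carrier B; c \<in> carrier B\<rbrakk>
    \<Longrightarrow> frag_of (Inl (b \<oplus>\<^bsub>B\<^esub> c)) - frag_of (Inl b) - frag_of (Inl c) \<in> WE"
  "\<lbrakk>set us \<subseteq> carrier V; v \<in> carrier V; w \<in> carrier V; set ws \<subseteq> carrier V\<rbrakk>
    \<Longrightarrow> frag_of (Inr (us @ [v \<otimes>\<^bsub>V\<^esub> w] @ ws)) - frag_of (Inr (us @ [v] @ ws)) - frag_of (Inr (us @ [w] @ ws)) \<in> WE"
  "\<lbrakk>set us \<subseteq> carrier V; v \<in> carrier V; b \<in> carrier B; w \<in> carrier V; set ws \<subseteq> carrier V\<rbrakk>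
    \<Longrightarrow> frag_of (Inr (us @ [v \<leftharpoonup>\<^bsub>V\<^esub> b, w] @ ws)) - frag_of (Inr (us @ [v, b \<rightharpoonup>\<^bsub>V\<^esub> w] @ ws)) \<in> WE"
  unfolding tword_rels_def by blast+

lemma wg_base: "\<lbrakk>b \<in> carrier B; c \<in> carrier B\<rbrakk> \<Longrightarrow> wg (Inl (b \<oplus>\<^bsub>B\<^esub> c)) = wg (Inl b) \<otimes>\<^bsub>agp W WE\<^esub> wg (Inl c)"
  by (rule W.agp_gen_mult[OF tword_rels_intros(1)]) simp_all

lemma wg_add: "\<lbrakk>set us \<subseteq> carrier V; v \<in> carrier V; w \<in> carrier V; set ws \<subseteq> carrier V\<rbrakk>
    \<Longrightarrow> wg (Inr (us @ (v \<otimes>\<^bsub>V\<^esub> w) # ws)) = wg (Inr (us @ v # ws)) \<otimes>\<^bsub>agp W WE\<^esub> wg (Inr (us @ w # ws))"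
  using W.agp_gen_mult[OF tword_rels_intros(2)[of us v w ws]] by simp

lemma wg_bal: "\<lbrakk>set us \<subseteq> carrier V; v \<in> carrier V; b \<in> carrier B; w \<in> carrier V; set ws \<subseteq> carrier V\<rbrakk>
    \<Longrightarrow> wg (Inr (us @ (v \<leftharpoonup>\<^bsub>V\<^esub> b) # w # ws)) = wg (Inr (us @ v # (b \<rightharpoonup>\<^bsub>V\<^esub> w) # ws))"
  using W.agp_gen_eq[OF tword_rels_intros(3)[of us v b w ws]] by (simp add: lact_closed ract_closed)

lemma tword_mult_closed:
  assumes "g \<in> W" "h \<in> W" shows "tword_mult B V g h \<in> W"
proof (cases g)
  case g: (Inl b)
  show ?thesis
  proof (cases h)
    case (Inr vs)
    then show ?thesis using g assms by (cases vs) (auto simp: lact_closed)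
  qed (use g assms in auto)
next
  case g: (Inr us)
  show ?thesis
  proof (cases h)
    case (Inl c)
    then show ?thesis using g assms by (cases us rule: rev_cases) (auto simp: ract_closed)
  qed (use g assms in auto)
qed

text \<open>Multiplying a relator by a word on the left only lengthens its unaffected prefix. The
  exceptional cases have a scalar in degree 0: it is absorbed by an end letter, and if that letter
  takes part in the relator, the linearity of the actions gives a relator of the same kind. The
  split on \<open>us\<close> decides whether this happens.\<close>

lemma respects_mult_right:
  assumes "g \<in> W" shows "respects_rels W WE (agp W WE) (\<lambda>h. wg (tword_mult B V g h))"
proof (rule tword_respects[OF W.agp_comm_group])
  show "(\<lambda>h. wg (tword_mult B V g h)) \<in> W \<rightarrow> carrier (agp W WE)"
    by (intro Pi_I W.agp_gen_closed tword_mult_closed assms)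
next
  fix b c assume bc: "b \<in> carrier B" "c \<in> carrier B"
  show "wg (tword_mult B V g (Inl (b \<oplus>\<^bsub>B\<^esub> c))) = wg (tword_mult B V g (Inl b)) \<otimes>\<^bsub>agp W WE\<^esub> wg (tword_mult B V g (Inl c))"
  proof (cases g)
    case (Inl a)
    then show ?thesis
      using assms bc by (simp add: R.r_distr wg_base)
  next
    case (Inr vs)
    then obtain us v where "vs = us @ [v]"
      using assms by (cases vs rule: rev_cases) auto
    then show ?thesis
      using assms bc Inr wg_add[of us "v \<leftharpoonup>\<^bsub>V\<^esub> b" "v \<leftharpoonup>\<^bsub>V\<^esub> c" "[]"] by (simp add: ract_add ract_closed)
  qed
next
  fix us v w ws assume h: "set us \<subseteq> carrier V" "v \<in> carrier V" "w \<in> carrier V" "set ws \<subseteq> carrier V"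
  show "wg (tword_mult B V g (Inr (us @ (v \<otimes>\<^bsub>V\<^esub> w) # ws)))
    = wg (tword_mult B V g (Inr (us @ v # ws))) \<otimes>\<^bsub>agp W WE\<^esub> wg (tword_mult B V g (Inr (us @ w # ws)))"
  proof (cases g)
    case (Inl a)
    then show ?thesis
      using assms h wg_add[of "[]" "a \<rightharpoonup>\<^bsub>V\<^esub> v" "a \<rightharpoonup>\<^bsub>V\<^esub> w" ws] wg_add[of "(a \<rightharpoonup>\<^bsub>V\<^esub> hd us) # tl us" v w ws]
      by (cases us) (simp_all add: lact_add lact_closed)
  next
    case (Inr vs)
    then show ?thesis
      using assms h wg_add[of "vs @ us" v w ws] by simp
  qed
next
  fix us v b w ws assume h: "set us \<subseteq> carrier V" "v \<in> carrier V" "b \<in> carrier B" "w \<in> carrier V" "set ws \<subseteq> carrier V"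
  show "wg (tword_mult B V g (Inr (us @ (v \<leftharpoonup>\<^bsub>V\<^esub> b) # w # ws))) = wg (tword_mult B V g (Inr (us @ v # (b \<rightharpoonup>\<^bsub>V\<^esub> w) # ws)))"
  proof (cases g)
    case (Inl a)
    then show ?thesis
      using assms h wg_bal[of "[]" "a \<rightharpoonup>\<^bsub>V\<^esub> v" b w ws] wg_bal[of "(a \<rightharpoonup>\<^bsub>V\<^esub> hd us) # tl us" v b w ws]
      by (cases us) (simp_all add: lact_ract[symmetric] lact_closed)
  next
    case (Inr vs)
    then show ?thesis
      using assms h wg_bal[of "vs @ us" v b w ws] by simp
  qed
qed

lemma respects_mult_left:
  assumes "h \<in> W" shows "respects_rels W WE (agp W WE) (\<lambda>g. wg (tword_mult B V g h))"
proof (rule tword_respects[OF W.agp_comm_group])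
  show "(\<lambda>g. wg (tword_mult B V g h)) \<in> W \<rightarrow> carrier (agp W WE)"
    by (intro Pi_I W.agp_gen_closed tword_mult_closed assms)
next
  fix b c assume bc: "b \<in> carrier B" "c \<in> carrier B"
  show "wg (tword_mult B V (Inl (b \<oplus>\<^bsub>B\<^esub> c)) h) = wg (tword_mult B V (Inl b) h) \<otimes>\<^bsub>agp W WE\<^esub> wg (tword_mult B V (Inl c) h)"
  proof (cases h)
    case (Inl a)
    then show ?thesis
      using assms bc by (simp add: R.l_distr wg_base)
  next
    case (Inr vs)
    then obtain u us where "vs = u # us"
      using assms by (cases vs) auto
    then show ?thesis
      using assms bc Inr wg_add[of "[]" "b \<rightharpoonup>\<^bsub>V\<^esub> u" "c \<rightharpoonup>\<^bsub>V\<^esub> u" us] by (simp add: add_lact lact_closed)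
  qed
next
  fix us v w ws assume g: "set us \<subseteq> carrier V" "v \<in> carrier V" "w \<in> carrier V" "set ws \<subseteq> carrier V"
  show "wg (tword_mult B V (Inr (us @ (v \<otimes>\<^bsub>V\<^esub> w) # ws)) h)
    = wg (tword_mult B V (Inr (us @ v # ws)) h) \<otimes>\<^bsub>agp W WE\<^esub> wg (tword_mult B V (Inr (us @ w # ws)) h)"
  proof (cases h)
    case (Inl a)
    show ?thesis
    \<comment> \<open>The scalar \<open>a\<close> acts on the last letter of the word. This is the
      letter changed by the relator exactly when \<open>ws\<close> is empty.\<close>
    proof (cases ws rule: rev_cases)
      case Nil
      with Inl show ?thesis
        using assms g wg_add[of us "v \<leftharpoonup>\<^bsub>V\<^esub> a" "w \<leftharpoonup>\<^bsub>V\<^esub> a" "[]"] by (simp add: butlast_append add_ract ract_closed)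
    next
      case (snoc ws' z)
      with Inl show ?thesis
        using assms g wg_add[of us v w "ws' @ [z \<leftharpoonup>\<^bsub>V\<^esub> a]"] by (simp add: butlast_append ract_closed)
    qed
  next
    case (Inr vs)
    then show ?thesis
      using assms g wg_add[of us v w "ws @ vs"] by simp
  qed
next
  fix us v b w ws assume g: "set us \<subseteq> carrier V" "v \<in> carrier V" "b \<in> carrier B" "w \<in> carrier V" "set ws \<subseteq> carrier V"
  show "wg (tword_mult B V (Inr (us @ (v \<leftharpoonup>\<^bsub>V\<^esub> b) # w # ws)) h) = wg (tword_mult B V (Inr (us @ v # (b \<rightharpoonup>\<^bsub>V\<^esub> w) # ws)) h)"
  proof (cases h)
    case (Inl a)
    show ?thesis
    proof (cases ws rule: rev_cases)
      case Nil
      with Inl show ?thesis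
        using assms g wg_bal[of us v b "w \<leftharpoonup>\<^bsub>V\<^esub> a" "[]"] by (simp add: butlast_append lact_ract ract_closed)
    next
      case (snoc ws' z)
      with Inl show ?thesis
        using assms g wg_bal[of us v b w "ws' @ [z \<leftharpoonup>\<^bsub>V\<^esub> a]"] by (simp add: butlast_append ract_closed)
    qed
  next
    case (Inr vs)
    then show ?thesis
      using assms g wg_bal[of us v b w "ws @ vs"] by simp
  qed
qed

text \<open>All bracketings agree already as words, except when a scalar stands between two words of
  positive degree: it may then act on the last letter of the left word or on the first letter of the
  right one. These two words are identified by \<open>wg_bal\<close>.\<close>

lemma tword_mult_assoc:
  assumes "g \<in> W" "h \<in> W" "k \<in> W"
  shows "wg (tword_mult B V (tword_mult B V g h) k) = wg (tword_mult B V g (tword_mult B V h k))"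
proof -
  show ?thesis
  proof (cases g)
    case g: (Inl a)
    show ?thesis
    proof (cases h)
      case h: (Inl b)
      show ?thesis
      proof (cases k)
        case (Inr zs)
        then obtain z zs' where "zs = z # zs'"
          using assms by (cases zs) auto
        with g h Inr assms show ?thesis by (simp add: mult_lact)
      qed (use g h assms in \<open>auto simp: R.m_assoc\<close>)
    next
      case h: (Inr ys)
      show ?thesis
      proof (cases k)
        case (Inl c)
        show ?thesis
        proof (cases ys rule: rev_cases)
          case (snoc ys' y)
          with g h Inl assms show ?thesis by (cases ys') (simp_all add: lact_ract)
        qed (use assms h in auto)
      next
        case (Inr zs)
        then show ?thesis using g h assms by (cases ys) auto
      qed
    qed
  next
    case g: (Inr xs)
    then obtain xs' x where xs: "xs = xs' @ [x]"
      using assms by (cases xs rule: rev_cases) auto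
    show ?thesis
    proof (cases h)
      case h: (Inl b)
      show ?thesis
      proof (cases k)
        case (Inl c)
        with g h assms xs show ?thesis by (simp add: ract_mult)
      next
        case (Inr zs)
        then obtain z zs' where zs: "zs = z # zs'"
          using assms by (cases zs) auto
        with g h Inr assms xs show ?thesis
          using wg_bal[of xs' x b z zs'] by simp
      qed
    next
      case h: (Inr ys)
      then show ?thesis
        using g assms by (cases k) (auto simp: butlast_append)
    qed
  qed
qed

lemma TA_add_monoid: "add_monoid TA = agp W WE"
  by (simp add: tens_alg_def Let_def)

lemma TA_simps:
  "carrier TA = carrier (agp W WE)" "ring.zero TA = one (agp W WE)"
  "ring.add TA = monoid.mult (agp W WE)" "one TA = wg (Inl \<one>\<^bsub>B\<^esub>)"
  by (simp_all add: tens_alg_def Let_def)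

lemma TA_eq: "TA = \<lparr>carrier = carrier (agp W WE), monoid.mult = monoid.mult TA,
    one = wg (Inl \<one>\<^bsub>B\<^esub>), ring.zero = one (agp W WE), ring.add = monoid.mult (agp W WE)\<rparr>"
  by (rule ring.equality) (simp_all add: TA_simps)

lemma TA_ring: "ring TA"
  and wg_mult: "\<lbrakk>g \<in> W; h \<in> W\<rbrakk> \<Longrightarrow> wg g \<otimes>\<^bsub>TA\<^esub> wg h = wg (tword_mult B V g h)"
proof -
  have m: "monoid.mult TA = (\<lambda>s t. agp_ext (agp W WE) (\<lambda>g. agp_ext (agp W WE) (\<lambda>h. wg (tword_mult B V g h)) t) s)"
    by (simp add: tens_alg_def Let_def)
  have e: "Inl \<one>\<^bsub>B\<^esub> \<in> W"
    by simp
  have units: "wg (tword_mult B V (Inl \<one>\<^bsub>B\<^esub>) g) = wg g" "wg (tword_mult B V g (Inl \<one>\<^bsub>B\<^esub>)) = wg g"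
    if "g \<in> W" for g
  proof -
    have "tword_mult B V (Inl \<one>\<^bsub>B\<^esub>) g = g"
    proof (cases g)
      case (Inr vs)
      then show ?thesis
        using that by (cases vs) (auto simp: one_lact)
    qed (use that in auto)
    then show "wg (tword_mult B V (Inl \<one>\<^bsub>B\<^esub>) g) = wg g" by simp
    have "tword_mult B V g (Inl \<one>\<^bsub>B\<^esub>) = g"
    proof (cases g)
      case (Inr vs)
      then have "last vs \<leftharpoonup>\<^bsub>V\<^esub> \<one>\<^bsub>B\<^esub> = last vs"
        using that last_in_set[of vs] by (intro ract_one) auto
      then show ?thesis
        using that Inr by simp
    qed (use that in auto)
    then show "wg (tword_mult B V g (Inl \<one>\<^bsub>B\<^esub>)) = wg g" by simp
  qed
  note R = presentation.agp_ring[where \<mu> = "tword_mult B V", OF W.presentation_axioms tword_mult_closed e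
      respects_mult_right respects_mult_left tword_mult_assoc units m]
  show "ring TA"
    using R(1) TA_eq by simp
  show "\<lbrakk>g \<in> W; h \<in> W\<rbrakk> \<Longrightarrow> wg g \<otimes>\<^bsub>TA\<^esub> wg h = wg (tword_mult B V g h)"
    by (rule R(2))
qed

lemma ta_base_closed [simp]: "b \<in> carrier B \<Longrightarrow> ta_base B V b \<in> carrier TA"
  and ta_gen_closed [simp]: "v \<in> carrier V \<Longrightarrow> ta_gen B V v \<in> carrier TA"
  by (simp_all add: ta_base_def ta_gen_def TA_simps)

lemma ta_base_ring_hom: "ta_base B V \<in> ring_hom B TA"
  by (rule ring_hom_memI) (auto simp: ta_base_def TA_simps wg_base wg_mult)

lemma ta_gen_add: "\<lbrakk>v \<in> carrier V; w \<in> carrier V\<rbrakk> \<Longrightarrow> ta_gen B V (v \<otimes>\<^bsub>V\<^esub> w) = ta_gen B V v \<oplus>\<^bsub>TA\<^esub> ta_gen B V w"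
  using wg_add[of "[]" v w "[]"] by (simp add: ta_gen_def TA_simps)

lemma ta_gen_lact: "\<lbrakk>b \<in> carrier B; v \<in> carrier V\<rbrakk> \<Longrightarrow> ta_gen B V (b \<rightharpoonup>\<^bsub>V\<^esub> v) = ta_base B V b \<otimes>\<^bsub>TA\<^esub> ta_gen B V v"
  by (simp add: ta_gen_def ta_base_def wg_mult)

lemma ta_gen_ract: "\<lbrakk>b \<in> carrier B; v \<in> carrier V\<rbrakk> \<Longrightarrow> ta_gen B V (v \<leftharpoonup>\<^bsub>V\<^esub> b) = ta_gen B V v \<otimes>\<^bsub>TA\<^esub> ta_base B V b"
  by (simp add: ta_gen_def ta_base_def wg_mult)

text \<open>A word is the product of its letters, so the elements of degree 0 and 1 generate the
  tensor algebra as a ring.\<close>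

lemma TA_induct [consumes 1, case_names base gen mult diff]:
  assumes "t \<in> carrier TA"
    and base: "\<And>b. b \<in> carrier B \<Longrightarrow> P (ta_base B V b)"
    and gen: "\<And>v. v \<in> carrier V \<Longrightarrow> P (ta_gen B V v)"
    and mult: "\<And>s t. \<lbrakk>s \<in> carrier TA; t \<in> carrier TA; P s; P t\<rbrakk> \<Longrightarrow> P (s \<otimes>\<^bsub>TA\<^esub> t)"
    and diff: "\<And>s t. \<lbrakk>s \<in> carrier TA; t \<in> carrier TA; P s; P t\<rbrakk> \<Longrightarrow> P (s \<ominus>\<^bsub>TA\<^esub> t)"
  shows "P t"
proof -
  interpret TA: ring TA by (rule TA_ring)
  have word: "P (wg (Inr (v # vs)))" if "v \<in> carrier V" "set vs \<subseteq> carrier V" for v vs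
    using that
  proof (induction vs arbitrary: v)
    case Nil
    then show ?case using gen by (simp add: ta_gen_def)
  next
    case (Cons u us)
    then have "wg (Inr (v # u # us)) = ta_gen B V v \<otimes>\<^bsub>TA\<^esub> wg (Inr (u # us))"
      by (simp add: ta_gen_def wg_mult)
    with Cons show ?case
      using mult[of "ta_gen B V v" "wg (Inr (u # us))"] gen by (simp add: TA_simps ta_gen_def)
  qed
  have inv: "inv\<^bsub>agp W WE\<^esub> x = \<ominus>\<^bsub>TA\<^esub> x" for x
    using TA_add_monoid by (simp add: a_inv_def)
  from assms(1)[unfolded TA_simps] show ?thesis
  proof (induction t rule: W.agp_induct)
    case one
    \<comment> \<open>Zero is reached as \<open>1 - 1\<close>, which is why the rule has no case for
      it.\<close>
    have "\<zero>\<^bsub>TA\<^esub> = \<one>\<^bsub>TA\<^esub> \<ominus>\<^bsub>TA\<^esub> \<one>\<^bsub>TA\<^esub>"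
      using TA.r_neg[of "\<one>\<^bsub>TA\<^esub>"] by (simp add: a_minus_def)
    moreover have "P \<one>\<^bsub>TA\<^esub>"
      using base[of "\<one>\<^bsub>B\<^esub>"] by (simp add: TA_simps(4) ta_base_def)
    ultimately show ?case
      using diff[OF TA.one_closed TA.one_closed] by (simp add: TA_simps(2))
  next
    case (gen s)
    then show ?case
    proof (cases s)
      case (Inl b)
      then show ?thesis using base gen by (simp add: ta_base_def)
    next
      case (Inr vs)
      then show ?thesis using word gen by (cases vs) auto
    qed
  next
    case (diff x y)
    then show ?case
      using assms(5)[of x y] by (simp add: TA_simps(1,3) inv a_minus_def)
  qed
qed

text \<open>A word is sent to the product of the images of its letters. The balancing relators are
  respected because the scalar between two letters may be extracted from the left one by
  \<open>hr\<close> or from the right one by \<open>hl\<close>; multiplicativity then needs checking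
  on words only.\<close>

lemma TA_universal:
  assumes E: "ring E" and hB: "hB \<in> ring_hom B E"
    and hV: "hV \<in> hom V (add_monoid E)"
    and hl: "\<And>b v. \<lbrakk>b \<in> carrier B; v \<in> carrier V\<rbrakk> \<Longrightarrow> hV (b \<rightharpoonup>\<^bsub>V\<^esub> v) = hB b \<otimes>\<^bsub>E\<^esub> hV v"
    and hr: "\<And>b v. \<lbrakk>b \<in> carrier B; v \<in> carrier V\<rbrakk> \<Longrightarrow> hV (v \<leftharpoonup>\<^bsub>V\<^esub> b) = hV v \<otimes>\<^bsub>E\<^esub> hB b"
  shows "\<exists>h\<in>ring_hom TA E. (\<forall>b\<in>carrier B. h (ta_base B V b) = hB b)
    \<and> (\<forall>v\<in>carrier V. h (ta_gen B V v) = hV v)"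
proof -
  interpret E: ring E by fact
  interpret TA: ring TA by (rule TA_ring)
  define \<phi> where "\<phi> = case_sum hB (\<lambda>vs. foldr (\<otimes>\<^bsub>E\<^esub>) (map hV vs) \<one>\<^bsub>E\<^esub>)"
  have hVc: "hV v \<in> carrier E" if "v \<in> carrier V" for v
    using hom_in_carrier[OF hV that] by simp
  have hBc: "hB b \<in> carrier E" if "b \<in> carrier B" for b
    using ring_hom_closed[OF hB that] .
  have set: "set (map hV vs) \<subseteq> carrier E" if "set vs \<subseteq> carrier V" for vs
    using that hVc by auto
  note fm = foldr_mult_append[OF E.is_monoid]
  have fc: "foldr (\<otimes>\<^bsub>E\<^esub>) (map hV vs) \<one>\<^bsub>E\<^esub> \<in> carrier E" if "set vs \<subseteq> carrier V" for vs
    using fm(2)[OF set[OF that] set[OF that]] .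
  have \<phi>c: "\<phi> \<in> W \<rightarrow> carrier E"
    using hBc fc by (auto simp: tword_def \<phi>_def)
  have fa: "foldr (\<otimes>\<^bsub>E\<^esub>) (map hV (us @ vs)) \<one>\<^bsub>E\<^esub>
    = foldr (\<otimes>\<^bsub>E\<^esub>) (map hV us) \<one>\<^bsub>E\<^esub> \<otimes>\<^bsub>E\<^esub> foldr (\<otimes>\<^bsub>E\<^esub>) (map hV vs) \<one>\<^bsub>E\<^esub>"
    if "set us \<subseteq> carrier V" "set vs \<subseteq> carrier V" for us vs
    unfolding map_append using fm(1)[OF set[OF that(1)] set[OF that(2)]] .
  have resp: "respects_rels W WE (add_monoid E) \<phi>"
  proof (rule tword_respects[OF E.a_comm_group])
    fix us v w ws assume h: "set us \<subseteq> carrier V" "v \<in> carrier V" "w \<in> carrier V" "set ws \<subseteq> carrier V"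
    show "\<phi> (Inr (us @ (v \<otimes>\<^bsub>V\<^esub> w) # ws)) = \<phi> (Inr (us @ v # ws)) \<otimes>\<^bsub>add_monoid E\<^esub> \<phi> (Inr (us @ w # ws))"
      using h hom_mult[OF hV h(2,3)] fc[OF h(1)] fc[OF h(4)] hVc
      by (simp add: \<phi>_def fa E.l_distr E.r_distr del: map_append foldr_append)
  next
    fix us v b w ws assume h: "set us \<subseteq> carrier V" "v \<in> carrier V" "b \<in> carrier B" "w \<in> carrier V" "set ws \<subseteq> carrier V"
    show "\<phi> (Inr (us @ (v \<leftharpoonup>\<^bsub>V\<^esub> b) # w # ws)) = \<phi> (Inr (us @ v # (b \<rightharpoonup>\<^bsub>V\<^esub> w) # ws))"
      using h fc[OF h(1)] fc[OF h(5)] hVc hBc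
      by (simp add: \<phi>_def fa ract_closed lact_closed hl hr E.m_assoc del: map_append foldr_append)
  qed (use \<phi>c ring_hom_add[OF hB] in \<open>auto simp: \<phi>_def\<close>)
  define h where "h = agp_ext (add_monoid E) \<phi>"
  have hh: "h \<in> hom (add_monoid TA) (add_monoid E)"
    unfolding h_def TA_add_monoid by (rule W.agp_ext_hom[OF E.a_comm_group resp])
  have hg: "h (wg g) = \<phi> g" if "g \<in> W" for g
    unfolding h_def by (rule W.agp_ext_gen[OF E.a_comm_group resp that])
  \<comment> \<open>When one factor has degree 0, it has been absorbed into the first or last letter
    of the other; \<open>hl\<close> and \<open>hr\<close> take it out again.\<close>
  have \<phi>m: "\<phi> (tword_mult B V g k) = \<phi> g \<otimes>\<^bsub>E\<^esub> \<phi> k" if gk: "g \<in> W" "k \<in> W" for g k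
  proof (cases g)
    case g: (Inl b)
    show ?thesis
    proof (cases k)
      case (Inl c)
      then show ?thesis
        using g gk ring_hom_mult[OF hB] by (simp add: \<phi>_def)
    next
      case (Inr vs)
      then show ?thesis
        using g gk hVc hBc fc by (cases vs) (auto simp: \<phi>_def hl E.m_assoc)
    qed
  next
    case g: (Inr us)
    show ?thesis
    proof (cases k)
      case (Inl c)
      show ?thesis
      proof (cases us rule: rev_cases)
        case (snoc us' u)
        then have us': "set us' \<subseteq> carrier V" "u \<in> carrier V"
          using g gk by auto
        show ?thesis
          using Inl snoc g gk us' hVc hBc fc[OF us'(1)]
          by (simp add: \<phi>_def fa ract_closed hr E.m_assoc del: map_append foldr_append)
      qed (use g gk in auto)
    next
      case (Inr vs)
      then show ?thesis
        using g gk by (simp add: \<phi>_def fa del: map_append foldr_append)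
    qed
  qed
  have hm: "h (s \<otimes>\<^bsub>TA\<^esub> t) = h s \<otimes>\<^bsub>E\<^esub> h t" if "s \<in> carrier TA" "t \<in> carrier TA" for s t
  proof (rule spans_bi_eqI[of "add_monoid TA" "wg ` W" "add_monoid TA" "wg ` W" "add_monoid E" "\<lambda>s t. h (s \<otimes>\<^bsub>TA\<^esub> t)" "\<lambda>s t. h s \<otimes>\<^bsub>E\<^esub> h t"])
    show "spans (add_monoid TA) (wg ` W)" "spans (add_monoid TA) (wg ` W)"
      unfolding TA_add_monoid by (rule W.spans_agp)+
    show "group (add_monoid E)"
      using E.a_comm_group by (simp add: comm_group_def)
    show "(\<lambda>x. h (x \<otimes>\<^bsub>TA\<^esub> y)) \<in> hom (add_monoid TA) (add_monoid E)" if "y \<in> carrier (add_monoid TA)" for y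
      by (rule hom_compose_lam[OF ring_mult_homs(2)[OF TA_ring] hh]) (use that in simp)
    show "(\<lambda>x. h (y \<otimes>\<^bsub>TA\<^esub> x)) \<in> hom (add_monoid TA) (add_monoid E)" if "y \<in> carrier (add_monoid TA)" for y
      by (rule hom_compose_lam[OF ring_mult_homs(1)[OF TA_ring] hh]) (use that in simp)
    show "(\<lambda>x. h x \<otimes>\<^bsub>E\<^esub> h y) \<in> hom (add_monoid TA) (add_monoid E)" if "y \<in> carrier (add_monoid TA)" for y
      by (rule hom_compose_lam[OF hh ring_mult_homs(2)[OF E]]) (use that hom_in_carrier[OF hh] in simp)
    show "(\<lambda>x. h y \<otimes>\<^bsub>E\<^esub> h x) \<in> hom (add_monoid TA) (add_monoid E)" if "y \<in> carrier (add_monoid TA)" for y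
      by (rule hom_compose_lam[OF hh ring_mult_homs(1)[OF E]]) (use that hom_in_carrier[OF hh] in simp)
  qed (use that in \<open>auto simp: wg_mult hg tword_mult_closed \<phi>m\<close>)
  have "h \<in> ring_hom TA E"
  proof (rule ring_hom_memI)
    show "h \<one>\<^bsub>TA\<^esub> = \<one>\<^bsub>E\<^esub>"
      using ring_hom_one[OF hB] by (simp add: TA_simps hg \<phi>_def)
  qed (use hom_in_carrier[OF hh] hm hom_mult[OF hh] in auto)
  then show ?thesis
    using hg hVc by (intro bexI[of _ h]) (auto simp: ta_base_def ta_gen_def \<phi>_def)
qed

end

section \<open>Generators of the tensor algebra of \<open>\<ZZ>\<close>\<close>

locale fgp_bimodule = bimodule K A \<Omega>
  for K :: "('k, 'x) ring_scheme" and A :: "('k, 'a, 'y) module_scheme"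
    and \<Omega> :: "('a, 'a, 'w, 'z) bimod_scheme" +
  assumes fgp: "fgp_right A \<Omega>" "fgp_left A \<Omega>"
begin

abbreviation "XX \<equiv> left_dual A \<Omega>"
abbreviation "YY \<equiv> right_dual A \<Omega>"
abbreviation "EA \<equiv> env_alg K A"
abbreviation "TT \<equiv> TZ K A \<Omega>"

sublocale X: bimodule K A XX
  by (rule left_dual_bimodule)
sublocale Y: bimodule K A YY
  by (rule right_dual_bimodule)
sublocale XO: bimod_pair K A XX \<Omega> ..
sublocale OY: bimod_pair K A \<Omega> YY ..
sublocale Z: ring_bimod EA "ZZ K A \<Omega>"
  unfolding ZZ_def by (rule ring_bimod_sum[OF XO.TK_ring_bimod OY.TK_ring_bimod])

end

text \<open>Images \<open>e a\<close>, \<open>eb a\<close>, \<open>gX x \<omega>\<close> and \<open>gY \<rho> y\<close> of \<open>a\<close>, \<open>a\<close>-bar, \<open>(x, \<omega>)\<close> and \<open>(\<rho>, y)\<close> in a ring \<open>E\<close>.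
  The axioms are the relations of the tensor algebra; the two relations specific to \<open>IB\<close> are not
  imposed here.\<close>

locale rep_data = fgp_bimodule K A \<Omega> + RE: ring E
  for K :: "('k, 'x) ring_scheme" and A :: "('k, 'a, 'y) module_scheme"
    and \<Omega> :: "('a, 'a, 'w, 'z) bimod_scheme" and E :: "('e, 'q) ring_scheme" +
  fixes e :: "'a \<Rightarrow> 'e" and eb :: "'a \<Rightarrow> 'e"
    and gX :: "('w \<Rightarrow> 'a) \<Rightarrow> 'w \<Rightarrow> 'e" and gY :: "'w \<Rightarrow> ('w \<Rightarrow> 'a) \<Rightarrow> 'e"
  assumes e_hom: "e \<in> hom (add_monoid A) (add_monoid E)"
    and eb_hom: "eb \<in> hom (add_monoid A) (add_monoid E)"
    and e_mult: "\<lbrakk>a \<in> carrier A; b \<in> carrier A\<rbrakk> \<Longrightarrow> e (a \<otimes>\<^bsub>A\<^esub> b) = e a \<otimes>\<^bsub>E\<^esub> e b"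
    and eb_mult: "\<lbrakk>a \<in> carrier A; b \<in> carrier A\<rbrakk> \<Longrightarrow> eb (a \<otimes>\<^bsub>A\<^esub> b) = eb b \<otimes>\<^bsub>E\<^esub> eb a"
    and e_one: "e \<one>\<^bsub>A\<^esub> = \<one>\<^bsub>E\<^esub>"
    and eb_one: "eb \<one>\<^bsub>A\<^esub> = \<one>\<^bsub>E\<^esub>"
    and e_eb: "\<lbrakk>a \<in> carrier A; b \<in> carrier A\<rbrakk> \<Longrightarrow> eb b \<otimes>\<^bsub>E\<^esub> e a = e a \<otimes>\<^bsub>E\<^esub> eb b"
    and e_kone: "k \<in> carrier K \<Longrightarrow> e (k \<odot>\<^bsub>A\<^esub> \<one>\<^bsub>A\<^esub>) = eb (k \<odot>\<^bsub>A\<^esub> \<one>\<^bsub>A\<^esub>)"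
    and gX_hom_left: "\<omega> \<in> carrier \<Omega> \<Longrightarrow> (\<lambda>x. gX x \<omega>) \<in> hom XX (add_monoid E)"
    and gX_hom_right: "x \<in> carrier XX \<Longrightarrow> gX x \<in> hom \<Omega> (add_monoid E)"
    and gX_act: "\<lbrakk>a \<in> carrier A; x \<in> carrier XX; \<omega> \<in> carrier \<Omega>\<rbrakk> \<Longrightarrow> gX (a \<rightharpoonup>\<^bsub>XX\<^esub> x) \<omega> = e a \<otimes>\<^bsub>E\<^esub> gX x \<omega>"
      "\<lbrakk>a \<in> carrier A; x \<in> carrier XX; \<omega> \<in> carrier \<Omega>\<rbrakk> \<Longrightarrow> gX (x \<leftharpoonup>\<^bsub>XX\<^esub> a) \<omega> = gX x \<omega> \<otimes>\<^bsub>E\<^esub> e a"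
      "\<lbrakk>a \<in> carrier A; x \<in> carrier XX; \<omega> \<in> carrier \<Omega>\<rbrakk> \<Longrightarrow> gX x (a \<rightharpoonup>\<^bsub>\<Omega>\<^esub> \<omega>) = gX x \<omega> \<otimes>\<^bsub>E\<^esub> eb a"
      "\<lbrakk>a \<in> carrier A; x \<in> carrier XX; \<omega> \<in> carrier \<Omega>\<rbrakk> \<Longrightarrow> gX x (\<omega> \<leftharpoonup>\<^bsub>\<Omega>\<^esub> a) = eb a \<otimes>\<^bsub>E\<^esub> gX x \<omega>"
    and gY_hom_left: "y \<in> carrier YY \<Longrightarrow> (\<lambda>\<rho>. gY \<rho> y) \<in> hom \<Omega> (add_monoid E)"
    and gY_hom_right: "\<rho> \<in> carrier \<Omega> \<Longrightarrow> gY \<rho> \<in> hom YY (add_monoid E)"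
    and gY_act: "\<lbrakk>a \<in> carrier A; y \<in> carrier YY; \<rho> \<in> carrier \<Omega>\<rbrakk> \<Longrightarrow> gY (a \<rightharpoonup>\<^bsub>\<Omega>\<^esub> \<rho>) y = e a \<otimes>\<^bsub>E\<^esub> gY \<rho> y"
      "\<lbrakk>a \<in> carrier A; y \<in> carrier YY; \<rho> \<in> carrier \<Omega>\<rbrakk> \<Longrightarrow> gY (\<rho> \<leftharpoonup>\<^bsub>\<Omega>\<^esub> a) y = gY \<rho> y \<otimes>\<^bsub>E\<^esub> e a"
      "\<lbrakk>a \<in> carrier A; y \<in> carrier YY; \<rho> \<in> carrier \<Omega>\<rbrakk> \<Longrightarrow> gY \<rho> (a \<rightharpoonup>\<^bsub>YY\<^esub> y) = gY \<rho> y \<otimes>\<^bsub>E\<^esub> eb a"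
      "\<lbrakk>a \<in> carrier A; y \<in> carrier YY; \<rho> \<in> carrier \<Omega>\<rbrakk> \<Longrightarrow> gY \<rho> (y \<leftharpoonup>\<^bsub>YY\<^esub> a) = eb a \<otimes>\<^bsub>E\<^esub> gY \<rho> y"

section \<open>The tensor algebra of \<open>ZZ\<close> in terms of its four families of
  generators\<close>

context fgp_bimodule begin

lemma TT_eq: "TT = tens_alg EA (ZZ K A \<Omega>)"
  by (simp add: TZ_def)

lemma TT_ring: "ring TT"
  unfolding TT_eq by (rule Z.TA_ring)

sublocale TT: ring TT
  by (rule TT_ring)

lemma ZZ_carrier: "carrier (ZZ K A \<Omega>) = carrier XO.TK \<times> carrier OY.TK"
  by (simp add: ZZ_def)

abbreviation "tbase \<equiv> ta_base EA (ZZ K A \<Omega>)"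

lemma tbase_hom: "tbase \<in> ring_hom EA TT"
  unfolding TT_eq by (rule Z.ta_base_ring_hom)

lemma env_homs:
  "b \<in> carrier A \<Longrightarrow> (\<lambda>a. env_pure K A a b) \<in> hom (add_monoid A) (add_monoid EA)"
  "a \<in> carrier A \<Longrightarrow> env_pure K A a \<in> hom (add_monoid A) (add_monoid EA)"
  unfolding add_monoid_env env_pure_eq using E.pure_hom_left[of b] E.pure_hom_right[of a] by auto

lemma tbase_add_hom: "tbase \<in> hom (add_monoid EA) (add_monoid TT)"
  using tbase_hom by (auto intro!: homI simp: ring_hom_closed ring_hom_add)

text \<open>The two factors come from opposite tensor positions of \<open>A^e\<close> and hence
  commute; this becomes the law \<open>e_eb\<close> of the representation of \<open>TT\<close> on
  itself.\<close>

lemma tbase_pure: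
  assumes "a \<in> carrier A" "b \<in> carrier A"
  shows "tbase (env_pure K A a b) = base_el K A \<Omega> a \<otimes>\<^bsub>TT\<^esub> base_bar K A \<Omega> b"
    and "tbase (env_pure K A a b) = base_bar K A \<Omega> b \<otimes>\<^bsub>TT\<^esub> base_el K A \<Omega> a"
  using assms by (simp_all add: base_el_def base_bar_def ring_hom_mult[OF tbase_hom, symmetric] env_mult)

definition "inX s = ta_gen EA (ZZ K A \<Omega>) (s, \<one>\<^bsub>OY.TK\<^esub>)"
definition "inY t = ta_gen EA (ZZ K A \<Omega>) (\<one>\<^bsub>XO.TK\<^esub>, t)"

lemma one_TK: "\<one>\<^bsub>XO.TK\<^esub> \<in> carrier XO.TK" "\<one>\<^bsub>OY.TK\<^esub> \<in> carrier OY.TK"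
  "\<one>\<^bsub>XO.TK\<^esub> \<otimes>\<^bsub>XO.TK\<^esub> \<one>\<^bsub>XO.TK\<^esub> = \<one>\<^bsub>XO.TK\<^esub>" "\<one>\<^bsub>OY.TK\<^esub> \<otimes>\<^bsub>OY.TK\<^esub> \<one>\<^bsub>OY.TK\<^esub> = \<one>\<^bsub>OY.TK\<^esub>"
  "r \<in> carrier EA \<Longrightarrow> r \<rightharpoonup>\<^bsub>XO.TK\<^esub> \<one>\<^bsub>XO.TK\<^esub> = \<one>\<^bsub>XO.TK\<^esub>" "r \<in> carrier EA \<Longrightarrow> r \<rightharpoonup>\<^bsub>OY.TK\<^esub> \<one>\<^bsub>OY.TK\<^esub> = \<one>\<^bsub>OY.TK\<^esub>"
  "r \<in> carrier EA \<Longrightarrow> \<one>\<^bsub>XO.TK\<^esub> \<leftharpoonup>\<^bsub>XO.TK\<^esub> r = \<one>\<^bsub>XO.TK\<^esub>" "r \<in> carrier EA \<Longrightarrow> \<one>\<^bsub>OY.TK\<^esub> \<leftharpoonup>\<^bsub>OY.TK\<^esub> r = \<one>\<^bsub>OY.TK\<^esub>"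
proof -
  interpret S: comm_group XO.TK by (rule XO.TK_comm_group)
  interpret T: comm_group OY.TK by (rule OY.TK_comm_group)
  show "\<one>\<^bsub>XO.TK\<^esub> \<in> carrier XO.TK" "\<one>\<^bsub>OY.TK\<^esub> \<in> carrier OY.TK"
    "\<one>\<^bsub>XO.TK\<^esub> \<otimes>\<^bsub>XO.TK\<^esub> \<one>\<^bsub>XO.TK\<^esub> = \<one>\<^bsub>XO.TK\<^esub>" "\<one>\<^bsub>OY.TK\<^esub> \<otimes>\<^bsub>OY.TK\<^esub> \<one>\<^bsub>OY.TK\<^esub> = \<one>\<^bsub>OY.TK\<^esub>" by simp_all
  show "r \<in> carrier EA \<Longrightarrow> r \<rightharpoonup>\<^bsub>XO.TK\<^esub> \<one>\<^bsub>XO.TK\<^esub> = \<one>\<^bsub>XO.TK\<^esub>"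
    by (rule hom_one[OF XO.TK_homs(2) S.is_group S.is_group])
  show "r \<in> carrier EA \<Longrightarrow> r \<rightharpoonup>\<^bsub>OY.TK\<^esub> \<one>\<^bsub>OY.TK\<^esub> = \<one>\<^bsub>OY.TK\<^esub>"
    by (rule hom_one[OF OY.TK_homs(2) T.is_group T.is_group])
  show "r \<in> carrier EA \<Longrightarrow> \<one>\<^bsub>XO.TK\<^esub> \<leftharpoonup>\<^bsub>XO.TK\<^esub> r = \<one>\<^bsub>XO.TK\<^esub>"
    by (rule hom_one[OF XO.TK_homs(4) S.is_group S.is_group])
  show "r \<in> carrier EA \<Longrightarrow> \<one>\<^bsub>OY.TK\<^esub> \<leftharpoonup>\<^bsub>OY.TK\<^esub> r = \<one>\<^bsub>OY.TK\<^esub>"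
    by (rule hom_one[OF OY.TK_homs(4) T.is_group T.is_group])
qed

lemma ZZ_simps:
  "(s, t) \<otimes>\<^bsub>ZZ K A \<Omega>\<^esub> (s', t') = (s \<otimes>\<^bsub>XO.TK\<^esub> s', t \<otimes>\<^bsub>OY.TK\<^esub> t')"
  "r \<rightharpoonup>\<^bsub>ZZ K A \<Omega>\<^esub> (s, t) = (r \<rightharpoonup>\<^bsub>XO.TK\<^esub> s, r \<rightharpoonup>\<^bsub>OY.TK\<^esub> t)"
  "(s, t) \<leftharpoonup>\<^bsub>ZZ K A \<Omega>\<^esub> r = (s \<leftharpoonup>\<^bsub>XO.TK\<^esub> r, t \<leftharpoonup>\<^bsub>OY.TK\<^esub> r)"
  by (simp_all add: ZZ_def)

lemma in_hom: "inX \<in> hom XO.TK (add_monoid TT)" "inY \<in> hom OY.TK (add_monoid TT)"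
  using Z.ta_gen_closed Z.ta_gen_add
  by (auto intro!: homI simp: TT_eq inX_def inY_def ZZ_carrier ZZ_simps one_TK Z.ta_gen_add[symmetric])

lemma in_act:
  "\<lbrakk>r \<in> carrier EA; s \<in> carrier XO.TK\<rbrakk> \<Longrightarrow> inX (r \<rightharpoonup>\<^bsub>XO.TK\<^esub> s) = tbase r \<otimes>\<^bsub>TT\<^esub> inX s"
  "\<lbrakk>r \<in> carrier EA; s \<in> carrier XO.TK\<rbrakk> \<Longrightarrow> inX (s \<leftharpoonup>\<^bsub>XO.TK\<^esub> r) = inX s \<otimes>\<^bsub>TT\<^esub> tbase r"
  "\<lbrakk>r \<in> carrier EA; t \<in> carrier OY.TK\<rbrakk> \<Longrightarrow> inY (r \<rightharpoonup>\<^bsub>OY.TK\<^esub> t) = tbase r \<otimes>\<^bsub>TT\<^esub> inY t"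
  "\<lbrakk>r \<in> carrier EA; t \<in> carrier OY.TK\<rbrakk> \<Longrightarrow> inY (t \<leftharpoonup>\<^bsub>OY.TK\<^esub> r) = inY t \<otimes>\<^bsub>TT\<^esub> tbase r"
  using Z.ta_gen_lact[of r "(s, \<one>\<^bsub>OY.TK\<^esub>)"] Z.ta_gen_ract[of r "(s, \<one>\<^bsub>OY.TK\<^esub>)"]
    Z.ta_gen_lact[of r "(\<one>\<^bsub>XO.TK\<^esub>, t)"] Z.ta_gen_ract[of r "(\<one>\<^bsub>XO.TK\<^esub>, t)"]
  by (simp_all add: TT_eq inX_def inY_def ZZ_carrier ZZ_simps one_TK)

lemma gen_eqs:
  "gen_X K A \<Omega> x \<omega> = inX (XO.tp x \<omega>)" "gen_Y K A \<Omega> \<omega> y = inY (OY.tp \<omega> y)"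
  "base_el K A \<Omega> a = tbase (env_pure K A a \<one>\<^bsub>A\<^esub>)" "base_bar K A \<Omega> a = tbase (env_pure K A \<one>\<^bsub>A\<^esub> a)"
  by (simp_all add: gen_X_def gen_Y_def inX_def inY_def base_el_def base_bar_def)

text \<open>This is the tautological representation. The laws for products and actions are formulas
  for pure tensors pushed forward along \<open>tbase\<close>, \<open>inX\<close> and
  \<open>inY\<close>.\<close>

lemma TT_rep_data:
  "rep_data K A \<Omega> TT (base_el K A \<Omega>) (base_bar K A \<Omega>) (gen_X K A \<Omega>) (gen_Y K A \<Omega>)"
proof (unfold_locales, goal_cases)
  case 1
  show ?case
    unfolding gen_eqs by (rule hom_compose_lam[OF env_homs(1) tbase_add_hom]) simp
next
  case 2
  show ?case
    unfolding gen_eqs by (rule hom_compose_lam[OF env_homs(2) tbase_add_hom]) simp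
next
  case (7 a b)
  then show ?case
    using tbase_pure[of a b] by simp
next
  case (8 k)
  \<comment> \<open>A scalar equals its own bar because \<open>A^e\<close> is a tensor product over
    \<open>K\<close>.\<close>
  have "E.pt (k \<odot>\<^bsub>A\<^esub> \<one>\<^bsub>A\<^esub>) \<one>\<^bsub>A\<^esub> = E.pt \<one>\<^bsub>A\<^esub> (k \<odot>\<^bsub>A\<^esub> \<one>\<^bsub>A\<^esub>)"
    using E.pure_balanced[of "\<one>\<^bsub>A\<^esub>" "\<one>\<^bsub>A\<^esub>" k] 8 by simp
  then show ?case
    by (simp add: gen_eqs env_pure_eq)
next
  case (9 \<omega>)
  then show ?case
    unfolding gen_eqs by (rule hom_compose_lam[OF XO.tp_hom_left in_hom(1)])
next
  case (10 x)
  then show ?case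
    unfolding gen_eqs[abs_def] by (rule hom_compose_lam[OF XO.tp_hom_right in_hom(1)])
next
  case (15 y)
  then show ?case
    unfolding gen_eqs by (rule hom_compose_lam[OF OY.tp_hom_left in_hom(2)])
next
  case (16 \<omega>)
  then show ?case
    unfolding gen_eqs[abs_def] by (rule hom_compose_lam[OF OY.tp_hom_right in_hom(2)])
qed (use ring_hom_one[OF tbase_hom] in \<open>auto simp: gen_eqs ring_hom_mult[OF tbase_hom, symmetric]
    in_act[symmetric] XO.TK_act_pure OY.TK_act_pure env_mult X.one_lact X.ract_one one_lact ract_one
    Y.one_lact Y.ract_one env_simps(4)\<close>)

text \<open>Refines the induction over the tensor algebra: a scalar from \<open>A^e\<close> is a
  combination of products of some \<open>a\<close> and some bar element, and a letter is the sum of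
  its components in the two summands of \<open>ZZ\<close>, each spanned by pure tensors.\<close>

lemma TT_induct [consumes 1, case_names base_el base_bar gen_X gen_Y mult diff]:
  assumes "t \<in> carrier TT"
    and base_el: "\<And>a. a \<in> carrier A \<Longrightarrow> P (base_el K A \<Omega> a)"
    and base_bar: "\<And>a. a \<in> carrier A \<Longrightarrow> P (base_bar K A \<Omega> a)"
    and gen_X: "\<And>x \<omega>. \<lbrakk>x \<in> carrier XX; \<omega> \<in> carrier \<Omega>\<rbrakk> \<Longrightarrow> P (gen_X K A \<Omega> x \<omega>)"
    and gen_Y: "\<And>\<omega> y. \<lbrakk>\<omega> \<in> carrier \<Omega>; y \<in> carrier YY\<rbrakk> \<Longrightarrow> P (gen_Y K A \<Omega> \<omega> y)"
    and mult: "\<And>s t. \<lbrakk>s \<in> carrier TT; t \<in> carrier TT; P s; P t\<rbrakk> \<Longrightarrow> P (s \<otimes>\<^bsub>TT\<^esub> t)"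
    and diff: "\<And>s t. \<lbrakk>s \<in> carrier TT; t \<in> carrier TT; P s; P t\<rbrakk> \<Longrightarrow> P (s \<ominus>\<^bsub>TT\<^esub> t)"
  shows "P t"
proof -
  interpret R: rep_data K A \<Omega> TT "base_el K A \<Omega>" "base_bar K A \<Omega>" "gen_X K A \<Omega>" "gen_Y K A \<Omega>"
    by (rule TT_rep_data)
  have "P \<zero>\<^bsub>TT\<^esub>"
    using diff[of "\<one>\<^bsub>TT\<^esub>" "\<one>\<^bsub>TT\<^esub>"] base_el[of "\<one>\<^bsub>A\<^esub>"] R.e_one TT.r_neg[of "\<one>\<^bsub>TT\<^esub>"]
    by (simp add: a_minus_def)
  \<comment> \<open>Closure under differences carries \<open>P\<close> from a spanning set to a
    whole group, along any homomorphism into the additive group of \<open>TT\<close>. It is used for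
    scalars and for each of the two summands of \<open>ZZ\<close>.\<close>
  have ext: "P (h x)" if h: "h \<in> hom G (add_monoid TT)" and G: "spans G X" "x \<in> carrier G"
    and X: "\<And>x. x \<in> X \<Longrightarrow> P (h x)" for h and G :: "('g, 'q) monoid_scheme" and X x
    using G
  proof (induction x rule: spans_induct)
    case one
    have "h \<one>\<^bsub>G\<^esub> = \<zero>\<^bsub>TT\<^esub>"
      using hom_one[OF h] G(1) TT.a_comm_group by (simp add: spans_def comm_group_def)
    then show ?case using \<open>P \<zero>\<^bsub>TT\<^esub>\<close> by simp
  next
    case (gen x)
    then show ?case by (rule X)
  next
    case (diff x y)
    interpret h: group_hom G "add_monoid TT" h
      using h G(1) TT.a_comm_group by (simp add: spans_def comm_group_def group_hom_def group_hom_axioms_def)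
    have "h (x \<otimes>\<^bsub>G\<^esub> inv\<^bsub>G\<^esub> y) = h x \<ominus>\<^bsub>TT\<^esub> h y"
      using diff by (simp add: a_minus_def a_inv_def)
    then show ?case
      using assms(7)[of "h x" "h y"] h.hom_closed diff by simp
  qed
  have base: "P (tbase b)" if "b \<in> carrier EA" for b
    by (rule ext[OF tbase_add_hom spans_env])
      (use that mult base_el base_bar hom_in_carrier[OF R.e_hom] hom_in_carrier[OF R.eb_hom]
        in \<open>auto simp: tbase_pure(1)\<close>)
  have X: "P (inX s)" if "s \<in> carrier XO.TK" for s
    by (rule ext[OF in_hom(1) XO.spans_TK that]) (use gen_X in \<open>auto simp: gen_eqs\<close>)
  have Y: "P (inY s)" if "s \<in> carrier OY.TK" for s
    by (rule ext[OF in_hom(2) OY.spans_TK that]) (use gen_Y in \<open>auto simp: gen_eqs\<close>)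
  have add: "P (s \<oplus>\<^bsub>TT\<^esub> t)" if "s \<in> carrier TT" "t \<in> carrier TT" "P s" "P t" for s t
    using diff[OF that(1) _ that(3), of "\<ominus>\<^bsub>TT\<^esub> t"] diff[OF TT.zero_closed that(2) \<open>P \<zero>\<^bsub>TT\<^esub>\<close> that(4)] that
    by (simp add: a_minus_def)
  have gen: "P (ta_gen EA (ZZ K A \<Omega>) v)" if "v \<in> carrier (ZZ K A \<Omega>)" for v
  proof -
    obtain s t where v: "v = (s, t)" "s \<in> carrier XO.TK" "t \<in> carrier OY.TK"
      using \<open>v \<in> carrier (ZZ K A \<Omega>)\<close> by (auto simp: ZZ_carrier)
    interpret S: comm_group XO.TK by (rule XO.TK_comm_group)
    interpret T: comm_group OY.TK by (rule OY.TK_comm_group)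
    have "v = (s, \<one>\<^bsub>OY.TK\<^esub>) \<otimes>\<^bsub>ZZ K A \<Omega>\<^esub> (\<one>\<^bsub>XO.TK\<^esub>, t)"
      using v by (simp add: ZZ_simps)
    then have "ta_gen EA (ZZ K A \<Omega>) v = inX s \<oplus>\<^bsub>TT\<^esub> inY t"
      using v by (simp add: Z.ta_gen_add ZZ_carrier inX_def inY_def TT_eq)
    then show ?thesis
      using add[of "inX s" "inY t"] X Y v hom_in_carrier[OF in_hom(1)] hom_in_carrier[OF in_hom(2)] by simp
  qed
  show ?thesis
    using assms(1) unfolding TT_eq
    by (rule Z.TA_induct) (use base gen mult diff in \<open>simp_all add: TT_eq\<close>)
qed

end

section \<open>Universal property of the tensor algebra of \<open>ZZ\<close> for generators\<close>

context rep_data begin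

lemma e_closed [simp]: "a \<in> carrier A \<Longrightarrow> e a \<in> carrier E" "a \<in> carrier A \<Longrightarrow> eb a \<in> carrier E"
  using hom_in_carrier[OF e_hom] hom_in_carrier[OF eb_hom] by auto

lemma g_closed [simp]:
  "\<lbrakk>x \<in> carrier XX; \<omega> \<in> carrier \<Omega>\<rbrakk> \<Longrightarrow> gX x \<omega> \<in> carrier E"
  "\<lbrakk>\<omega> \<in> carrier \<Omega>; y \<in> carrier YY\<rbrakk> \<Longrightarrow> gY \<omega> y \<in> carrier E"
  using hom_in_carrier[OF gX_hom_left] hom_in_carrier[OF gY_hom_left] by auto

text \<open>The images of generators extend additively to maps \<open>hB\<close>, \<open>hX\<close>
  and \<open>hY\<close> on \<open>A^e\<close> and on the two summands of \<open>ZZ\<close>. Once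
  these are known to be compatible with products and actions, \<open>TA_universal\<close> applies to
  \<open>hB\<close> and to the sum of \<open>hX\<close> and \<open>hY\<close>.\<close>

lemma TT_universal:
  "\<exists>h\<in>ring_hom TT E. (\<forall>a\<in>carrier A. h (base_el K A \<Omega> a) = e a \<and> h (base_bar K A \<Omega> a) = eb a)
    \<and> (\<forall>x\<in>carrier XX. \<forall>\<omega>\<in>carrier \<Omega>. h (gen_X K A \<Omega> x \<omega>) = gX x \<omega>)
    \<and> (\<forall>\<omega>\<in>carrier \<Omega>. \<forall>y\<in>carrier YY. h (gen_Y K A \<Omega> \<omega> y) = gY \<omega> y)"
proof -
  note cgE = RE.a_comm_group
  have grE: "group (add_monoid E)"
    using cgE by (simp add: comm_group_def)
  note mE = ring_mult_homs[OF RE.ring_axioms]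
  \<comment> \<open>A scalar is put next to the boundary between the two factors, where
    \<open>e_kone\<close> lets it cross from \<open>e\<close> to \<open>eb\<close>.\<close>
  have kone_e: "e (k \<odot>\<^bsub>A\<^esub> a) = e a \<otimes>\<^bsub>E\<^esub> e (kone k)" "eb (k \<odot>\<^bsub>A\<^esub> b) = e (kone k) \<otimes>\<^bsub>E\<^esub> eb b"
    if "k \<in> carrier K" "a \<in> carrier A" "b \<in> carrier A" for k a b
    using that e_kone smult_kone(2)[of k a] smult_kone(2)[of k b]
    by (simp_all add: e_mult eb_mult kone_def)
  define hB where "hB = agp_ext (add_monoid E) (\<lambda>(a, b). e a \<otimes>\<^bsub>E\<^esub> eb b)"
  have hB: "hB \<in> hom (add_monoid EA) (add_monoid E)"
    and hBp: "\<And>a b. \<lbrakk>a \<in> carrier A; b \<in> carrier A\<rbrakk> \<Longrightarrow> hB (env_pure K A a b) = e a \<otimes>\<^bsub>E\<^esub> eb b"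
  proof -
    have 1: "(\<lambda>n. e m \<otimes>\<^bsub>E\<^esub> eb n) \<in> hom (add_monoid A) (add_monoid E)" if "m \<in> carrier A" for m
      by (rule hom_compose_lam[OF eb_hom mE(1)]) (use that in simp)
    have 2: "(\<lambda>n. e n \<otimes>\<^bsub>E\<^esub> eb m) \<in> hom (add_monoid A) (add_monoid E)" if "m \<in> carrier A" for m
      by (rule hom_compose_lam[OF e_hom mE(2)]) (use that in simp)
    have 3: "e (k \<odot>\<^bsub>A\<^esub> a) \<otimes>\<^bsub>E\<^esub> eb b = e a \<otimes>\<^bsub>E\<^esub> eb (k \<odot>\<^bsub>A\<^esub> b)"
      if "k \<in> carrier K" "a \<in> carrier A" "b \<in> carrier A" for k a b
      using kone_e[OF that] that by (simp add: RE.m_assoc)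
    show "hB \<in> hom (add_monoid EA) (add_monoid E)"
      unfolding hB_def add_monoid_env
      by (rule E.tens_ext(1)[OF cgE]) (use 1 2 3 in simp_all)
    show "hB (env_pure K A a b) = e a \<otimes>\<^bsub>E\<^esub> eb b" if "a \<in> carrier A" "b \<in> carrier A" for a b
      unfolding hB_def env_pure_eq
      using E.tens_ext(2)[OF cgE, of "\<lambda>(a, b). e a \<otimes>\<^bsub>E\<^esub> eb b" a b] 1 2 3 that by simp
  qed
  have hBc: "hB b \<in> carrier E" if "b \<in> carrier EA" for b
    using hom_in_carrier[OF hB] that by simp
  interpret EA: ring EA by (rule env_ring)
  have hB_mult: "hB (s \<otimes>\<^bsub>EA\<^esub> t) = hB s \<otimes>\<^bsub>E\<^esub> hB t" if "s \<in> carrier EA" "t \<in> carrier EA" for s t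
  proof (rule spans_bi_eqI[OF spans_env spans_env grE, of "\<lambda>s t. hB (s \<otimes>\<^bsub>EA\<^esub> t)" "\<lambda>s t. hB s \<otimes>\<^bsub>E\<^esub> hB t"])
    show "(\<lambda>x. hB (x \<otimes>\<^bsub>EA\<^esub> y)) \<in> hom (add_monoid EA) (add_monoid E)" if "y \<in> carrier (add_monoid EA)" for y
      by (rule hom_compose_lam[OF ring_mult_homs(2)[OF env_ring] hB]) (use that in simp)
    show "(\<lambda>x. hB (y \<otimes>\<^bsub>EA\<^esub> x)) \<in> hom (add_monoid EA) (add_monoid E)" if "y \<in> carrier (add_monoid EA)" for y
      by (rule hom_compose_lam[OF ring_mult_homs(1)[OF env_ring] hB]) (use that in simp)
    show "(\<lambda>x. hB x \<otimes>\<^bsub>E\<^esub> hB y) \<in> hom (add_monoid EA) (add_monoid E)" if "y \<in> carrier (add_monoid EA)" for y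
      by (rule hom_compose_lam[OF hB mE(2)]) (use that hBc in simp)
    show "(\<lambda>x. hB y \<otimes>\<^bsub>E\<^esub> hB x) \<in> hom (add_monoid EA) (add_monoid E)" if "y \<in> carrier (add_monoid EA)" for y
      by (rule hom_compose_lam[OF hB mE(1)]) (use that hBc in simp)
    fix s t assume "s \<in> {env_pure K A a b |a b. a \<in> carrier A \<and> b \<in> carrier A}"
      "t \<in> {env_pure K A a b |a b. a \<in> carrier A \<and> b \<in> carrier A}"
    then obtain a a' b b' where ab: "a \<in> carrier A" "a' \<in> carrier A" "b \<in> carrier A" "b' \<in> carrier A"
      and st: "s = env_pure K A a a'" "t = env_pure K A b b'" by blast
    \<comment> \<open>Multiplicativity of \<open>hB\<close> on pure elements comes down to
      exchanging \<open>e b\<close> with \<open>eb a'\<close>. The reversal built into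
      \<open>eb_mult\<close> already gives the bar factors in the right order.\<close>
    have "(e a \<otimes>\<^bsub>E\<^esub> e b) \<otimes>\<^bsub>E\<^esub> (eb a' \<otimes>\<^bsub>E\<^esub> eb b') = (e a \<otimes>\<^bsub>E\<^esub> eb a') \<otimes>\<^bsub>E\<^esub> (e b \<otimes>\<^bsub>E\<^esub> eb b')"
      using ab e_eb[of b a'] by (metis RE.m_assoc RE.m_closed e_closed)
    then show "hB (s \<otimes>\<^bsub>EA\<^esub> t) = hB s \<otimes>\<^bsub>E\<^esub> hB t"
      using ab by (simp add: st env_mult hBp e_mult eb_mult)
  qed (use that in auto)
  have hB_ring: "hB \<in> ring_hom EA E"
    by (rule ring_hom_memI)
      (use hom_mult[OF hB] hBc hB_mult in \<open>auto simp: env_simps(4) hBp e_one eb_one\<close>)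
  define hX where "hX = agp_ext (add_monoid E) (\<lambda>(x, \<omega>). gX x \<omega>)"
  have hX: "hX \<in> hom XO.TK (add_monoid E)"
    and hXp: "\<And>x \<omega>. \<lbrakk>x \<in> carrier XX; \<omega> \<in> carrier \<Omega>\<rbrakk> \<Longrightarrow> hX (XO.tp x \<omega>) = gX x \<omega>"
    unfolding hX_def XO.hom_TK XO.tp_eq
    using XO.Tn.tens_ext[OF cgE, of "\<lambda>(x, \<omega>). gX x \<omega>"] gX_hom_left gX_hom_right
    by (auto simp: gX_act e_kone)
  define hY where "hY = agp_ext (add_monoid E) (\<lambda>(\<omega>, y). gY \<omega> y)"
  have hY: "hY \<in> hom OY.TK (add_monoid E)"
    and hYp: "\<And>\<omega> y. \<lbrakk>\<omega> \<in> carrier \<Omega>; y \<in> carrier YY\<rbrakk> \<Longrightarrow> hY (OY.tp \<omega> y) = gY \<omega> y"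
    unfolding hY_def OY.hom_TK OY.tp_eq
    using OY.Tn.tens_ext[OF cgE, of "\<lambda>(\<omega>, y). gY \<omega> y"] gY_hom_left gY_hom_right
    by (auto simp: gY_act e_kone)
  have hXc: "hX s \<in> carrier E" if "s \<in> carrier XO.TK" for s
    using hom_in_carrier[OF hX that] by simp
  have hYc: "hY s \<in> carrier E" if "s \<in> carrier OY.TK" for s
    using hom_in_carrier[OF hY that] by simp
  have e_eb': "eb b \<otimes>\<^bsub>E\<^esub> (e a \<otimes>\<^bsub>E\<^esub> z) = e a \<otimes>\<^bsub>E\<^esub> (eb b \<otimes>\<^bsub>E\<^esub> z)"
    if "a \<in> carrier A" "b \<in> carrier A" "z \<in> carrier E" for a b z
    using that e_eb[of a b] by (simp add: RE.m_assoc[symmetric])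
  \<comment> \<open>A map that is additive in a scalar from \<open>A^e\<close> and in an element of
    \<open>G\<close> is determined by pure scalars and spanning elements. The four compatibilities
    of \<open>hX\<close> and \<open>hY\<close> with the actions are instances.\<close>
  have bi: "hb (f s t) = g s t"
    if "spans G X0" "hb \<in> hom G (add_monoid E)"
      "\<And>t. t \<in> carrier G \<Longrightarrow> (\<lambda>s. f s t) \<in> hom (add_monoid EA) G" "\<And>s. s \<in> carrier EA \<Longrightarrow> f s \<in> hom G G"
      "\<And>t. t \<in> carrier G \<Longrightarrow> (\<lambda>s. g s t) \<in> hom (add_monoid EA) (add_monoid E)"
      "\<And>s. s \<in> carrier EA \<Longrightarrow> g s \<in> hom G (add_monoid E)"
      "\<And>a b v. \<lbrakk>a \<in> carrier A; b \<in> carrier A; v \<in> X0\<rbrakk> \<Longrightarrow> hb (f (env_pure K A a b) v) = g (env_pure K A a b) v"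
      "s \<in> carrier EA" "t \<in> carrier G"
    for G :: "('g, 'r) monoid_scheme" and X0 hb f g s t
    by (rule spans_bi_eqI[OF spans_env that(1) grE, of "\<lambda>s t. hb (f s t)" g])
      (use that hom_compose_lam[OF that(3) that(2)] hom_compose_lam[OF that(4) that(2)] in auto)
  have hX_l: "hX (r \<rightharpoonup>\<^bsub>XO.TK\<^esub> s) = hB r \<otimes>\<^bsub>E\<^esub> hX s" if "r \<in> carrier EA" "s \<in> carrier XO.TK" for r s
    by (rule bi[OF XO.spans_TK hX XO.TK_homs(1,2), of "\<lambda>r s. hB r \<otimes>\<^bsub>E\<^esub> hX s"])
      (use that hXc hBc in \<open>auto intro!: hom_compose_lam[OF hB mE(2), simplified] hom_compose_lam[OF hX mE(1), simplified]
        simp: XO.TK_act_pure hXp hBp gX_act RE.m_assoc X.lact_closed ract_closed e_eb'\<close>)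
  have hX_r: "hX (s \<leftharpoonup>\<^bsub>XO.TK\<^esub> r) = hX s \<otimes>\<^bsub>E\<^esub> hB r" if "r \<in> carrier EA" "s \<in> carrier XO.TK" for r s
    by (rule bi[OF XO.spans_TK hX XO.TK_homs(3,4), of "\<lambda>r s. hX s \<otimes>\<^bsub>E\<^esub> hB r"])
      (use that hXc hBc in \<open>auto intro!: hom_compose_lam[OF hB mE(1), simplified] hom_compose_lam[OF hX mE(2), simplified]
        simp: XO.TK_act_pure hXp hBp gX_act RE.m_assoc X.ract_closed lact_closed e_eb\<close>)
  have hY_l: "hY (r \<rightharpoonup>\<^bsub>OY.TK\<^esub> s) = hB r \<otimes>\<^bsub>E\<^esub> hY s" if "r \<in> carrier EA" "s \<in> carrier OY.TK" for r s
    by (rule bi[OF OY.spans_TK hY OY.TK_homs(1,2), of "\<lambda>r s. hB r \<otimes>\<^bsub>E\<^esub> hY s"])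
      (use that hYc hBc in \<open>auto intro!: hom_compose_lam[OF hB mE(2), simplified] hom_compose_lam[OF hY mE(1), simplified]
        simp: OY.TK_act_pure hYp hBp gY_act RE.m_assoc lact_closed Y.ract_closed e_eb'\<close>)
  have hY_r: "hY (s \<leftharpoonup>\<^bsub>OY.TK\<^esub> r) = hY s \<otimes>\<^bsub>E\<^esub> hB r" if "r \<in> carrier EA" "s \<in> carrier OY.TK" for r s
    by (rule bi[OF OY.spans_TK hY OY.TK_homs(3,4), of "\<lambda>r s. hY s \<otimes>\<^bsub>E\<^esub> hB r"])
      (use that hYc hBc in \<open>auto intro!: hom_compose_lam[OF hB mE(1), simplified] hom_compose_lam[OF hY mE(2), simplified]
        simp: OY.TK_act_pure hYp hBp gY_act RE.m_assoc ract_closed Y.lact_closed e_eb\<close>)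
  define hV where "hV = (\<lambda>(s, t). hX s \<oplus>\<^bsub>E\<^esub> hY t)"
  have hV: "hV \<in> hom (ZZ K A \<Omega>) (add_monoid E)"
    using hom_mult[OF hX] hom_mult[OF hY] hXc hYc
    by (intro homI) (auto simp: ZZ_carrier ZZ_simps hV_def RE.a_ac)
  obtain h where h: "h \<in> ring_hom TT E" "\<And>b. b \<in> carrier EA \<Longrightarrow> h (tbase b) = hB b"
    "\<And>v. v \<in> carrier (ZZ K A \<Omega>) \<Longrightarrow> h (ta_gen EA (ZZ K A \<Omega>) v) = hV v"
    using Z.TA_universal[OF RE.ring_axioms hB_ring hV]
    by (auto simp: TT_eq ZZ_carrier ZZ_simps hV_def hX_l hX_r hY_l hY_r hXc hYc hBc RE.l_distr RE.r_distr)
  \<comment> \<open>A generator of one summand has zero in the other component; these equations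
    remove the other component's contribution to \<open>hV\<close>.\<close>
  have one: "hX \<one>\<^bsub>XO.TK\<^esub> = \<zero>\<^bsub>E\<^esub>" "hY \<one>\<^bsub>OY.TK\<^esub> = \<zero>\<^bsub>E\<^esub>"
    using hom_one[OF hX _ grE] hom_one[OF hY _ grE] XO.TK_comm_group OY.TK_comm_group
    by (simp_all add: comm_group_def)
  show ?thesis
  proof (intro bexI[OF _ h(1)] conjI ballI)
    fix a assume a: "a \<in> carrier A"
    show "h (base_el K A \<Omega> a) = e a" "h (base_bar K A \<Omega> a) = eb a"
      using a by (simp_all add: gen_eqs h(2) hBp e_one eb_one)
  next
    fix x \<omega> assume "x \<in> carrier XX" "\<omega> \<in> carrier \<Omega>"
    then show "h (gen_X K A \<Omega> x \<omega>) = gX x \<omega>"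
      by (simp add: gen_eqs inX_def h(3) ZZ_carrier one_TK hV_def hXp one)
  next
    fix \<omega> y assume "\<omega> \<in> carrier \<Omega>" "y \<in> carrier YY"
    then show "h (gen_Y K A \<Omega> \<omega> y) = gY \<omega> y"
      by (simp add: gen_eqs inY_def h(3) ZZ_carrier one_TK hV_def hYp one)
  qed
qed

end

section \<open>Tensor products over \<open>A\<close> and evaluation maps\<close>

context bimod_pair begin

sublocale Ta: tensor_data M N "carrier A" "ract M" "lact N"
  by unfold_locales (auto simp: M.ract_closed N.lact_closed)

abbreviation "MN \<equiv> tensA A M N"
abbreviation "pa \<equiv> tensA_pure A M N"

lemma pa_eq: "pa = Ta.pt"
  by (simp add: tensA_pure_def)

lemma MN_simps: "carrier MN = carrier Ta.T" "monoid.mult MN = monoid.mult Ta.T" "one MN = one Ta.T"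
  by (simp_all add: tensA_def Let_def)

lemma MN_comm_group: "comm_group MN"
  by (rule comm_group_cong[OF MN_simps Ta.tens_comm_group])

lemma MN_group: "group MN"
  using MN_comm_group by (simp add: comm_group_def)

lemma hom_MN: "hom MN G = hom Ta.T G" "hom G MN = hom G Ta.T"
  by (rule hom_eq_carrier_mult; simp add: MN_simps)+

lemma spans_MN: "spans MN {pa m n | m n. m \<in> carrier M \<and> n \<in> carrier N}"
  unfolding pa_eq by (rule spans_cong[OF MN_simps Ta.tens_comm_group Ta.spans_tens])

lemma MN_hom_eqI:
  assumes "group G" "f \<in> hom MN G" "g \<in> hom MN G"
    and "\<And>m n. \<lbrakk>m \<in> carrier M; n \<in> carrier N\<rbrakk> \<Longrightarrow> f (pa m n) = g (pa m n)" "t \<in> carrier MN"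
  shows "f t = g t"
  by (rule spans_hom_eqI[OF spans_MN assms(1-3) _ assms(5)]) (use assms(4) in auto)

lemma pa_closed [simp]: "\<lbrakk>m \<in> carrier M; n \<in> carrier N\<rbrakk> \<Longrightarrow> pa m n \<in> carrier MN"
  by (simp add: MN_simps pa_eq)

lemma pa_hom_left: "n \<in> carrier N \<Longrightarrow> (\<lambda>m. pa m n) \<in> hom M MN"
  unfolding hom_MN pa_eq by (rule Ta.pure_hom_left)

lemma pa_hom_right: "m \<in> carrier M \<Longrightarrow> pa m \<in> hom N MN"
  unfolding hom_MN pa_eq by (rule Ta.pure_hom_right)

lemma pa_balanced: "\<lbrakk>m \<in> carrier M; n \<in> carrier N; a \<in> carrier A\<rbrakk>
  \<Longrightarrow> pa (m \<leftharpoonup>\<^bsub>M\<^esub> a) n = pa m (a \<rightharpoonup>\<^bsub>N\<^esub> n)"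
  unfolding pa_eq by (rule Ta.pure_balanced)

lemma MN_ext:
  assumes "comm_group G"
    and "\<And>m. m \<in> carrier M \<Longrightarrow> (\<lambda>n. \<phi> m n) \<in> hom N G"
    and "\<And>n. n \<in> carrier N \<Longrightarrow> (\<lambda>m. \<phi> m n) \<in> hom M G"
    and "\<And>m a n. \<lbrakk>m \<in> carrier M; a \<in> carrier A; n \<in> carrier N\<rbrakk> \<Longrightarrow> \<phi> (m \<leftharpoonup>\<^bsub>M\<^esub> a) n = \<phi> m (a \<rightharpoonup>\<^bsub>N\<^esub> n)"
  shows "agp_ext G (\<lambda>(m, n). \<phi> m n) \<in> hom MN G"
    and "\<lbrakk>m \<in> carrier M; n \<in> carrier N\<rbrakk> \<Longrightarrow> agp_ext G (\<lambda>(m, n). \<phi> m n) (pa m n) = \<phi> m n"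
  unfolding hom_MN pa_eq
  using Ta.tens_ext[OF assms(1), of "\<lambda>(m, n). \<phi> m n"] assms(2-) by auto

lemma MN_lact:
  assumes "a \<in> carrier A"
  shows "lact MN a \<in> hom MN MN"
    and "\<lbrakk>m \<in> carrier M; n \<in> carrier N\<rbrakk> \<Longrightarrow> a \<rightharpoonup>\<^bsub>MN\<^esub> pa m n = pa (a \<rightharpoonup>\<^bsub>M\<^esub> m) n"
proof -
  have eq: "lact MN a = agp_ext Ta.T (\<lambda>(m, n). pa (a \<rightharpoonup>\<^bsub>M\<^esub> m) n)"
    by (simp add: tensA_def Let_def)
  have 1: "(\<lambda>n. pa (a \<rightharpoonup>\<^bsub>M\<^esub> m) n) \<in> hom N Ta.T" if "m \<in> carrier M" for m
    using pa_hom_right[of "a \<rightharpoonup>\<^bsub>M\<^esub> m"] that assms by (simp add: hom_MN M.lact_closed)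
  have 2: "(\<lambda>m. pa (a \<rightharpoonup>\<^bsub>M\<^esub> m) n) \<in> hom M Ta.T" if "n \<in> carrier N" for n
    using hom_compose_lam[OF M.lact_hom[OF assms] pa_hom_left[OF that]] by (simp add: hom_MN)
  have 3: "pa (a \<rightharpoonup>\<^bsub>M\<^esub> (m \<leftharpoonup>\<^bsub>M\<^esub> b)) n = pa (a \<rightharpoonup>\<^bsub>M\<^esub> m) (b \<rightharpoonup>\<^bsub>N\<^esub> n)"
    if "m \<in> carrier M" "b \<in> carrier A" "n \<in> carrier N" for m b n
    using pa_balanced[of "a \<rightharpoonup>\<^bsub>M\<^esub> m" n b] that assms by (simp add: M.lact_closed M.lact_ract)
  show "lact MN a \<in> hom MN MN"
    unfolding eq hom_MN(2) by (rule MN_ext(1)[OF Ta.tens_comm_group 1 2 3])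
  show "\<lbrakk>m \<in> carrier M; n \<in> carrier N\<rbrakk> \<Longrightarrow> a \<rightharpoonup>\<^bsub>MN\<^esub> pa m n = pa (a \<rightharpoonup>\<^bsub>M\<^esub> m) n"
    unfolding eq by (rule MN_ext(2)[OF Ta.tens_comm_group 1 2 3])
qed

lemma MN_ract:
  assumes "a \<in> carrier A"
  shows "(\<lambda>t. t \<leftharpoonup>\<^bsub>MN\<^esub> a) \<in> hom MN MN"
    and "\<lbrakk>m \<in> carrier M; n \<in> carrier N\<rbrakk> \<Longrightarrow> pa m n \<leftharpoonup>\<^bsub>MN\<^esub> a = pa m (n \<leftharpoonup>\<^bsub>N\<^esub> a)"
proof -
  have eq: "(\<lambda>t. t \<leftharpoonup>\<^bsub>MN\<^esub> a) = agp_ext Ta.T (\<lambda>(m, n). pa m (n \<leftharpoonup>\<^bsub>N\<^esub> a))"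
    by (simp add: tensA_def Let_def fun_eq_iff)
  have 1: "(\<lambda>n. pa m (n \<leftharpoonup>\<^bsub>N\<^esub> a)) \<in> hom N Ta.T" if "m \<in> carrier M" for m
    using hom_compose_lam[OF N.ract_hom[OF assms] pa_hom_right[OF that]] by (simp add: hom_MN)
  have 2: "(\<lambda>m. pa m (n \<leftharpoonup>\<^bsub>N\<^esub> a)) \<in> hom M Ta.T" if "n \<in> carrier N" for n
    using pa_hom_left[of "n \<leftharpoonup>\<^bsub>N\<^esub> a"] that assms by (simp add: hom_MN N.ract_closed)
  have 3: "pa (m \<leftharpoonup>\<^bsub>M\<^esub> b) (n \<leftharpoonup>\<^bsub>N\<^esub> a) = pa m ((b \<rightharpoonup>\<^bsub>N\<^esub> n) \<leftharpoonup>\<^bsub>N\<^esub> a)"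
    if "m \<in> carrier M" "b \<in> carrier A" "n \<in> carrier N" for m b n
    using pa_balanced[of m "n \<leftharpoonup>\<^bsub>N\<^esub> a" b] that assms by (simp add: N.ract_closed N.lact_ract)
  show "(\<lambda>t. t \<leftharpoonup>\<^bsub>MN\<^esub> a) \<in> hom MN MN"
    unfolding eq hom_MN(2) by (rule MN_ext(1)[OF Ta.tens_comm_group 1 2 3])
  show "\<lbrakk>m \<in> carrier M; n \<in> carrier N\<rbrakk> \<Longrightarrow> pa m n \<leftharpoonup>\<^bsub>MN\<^esub> a = pa m (n \<leftharpoonup>\<^bsub>N\<^esub> a)"
    using MN_ext(2)[OF Ta.tens_comm_group 1 2 3] unfolding fun_cong[OF eq] .
qed

lemma MN_act_closed:
  "\<lbrakk>a \<in> carrier A; t \<in> carrier MN\<rbrakk> \<Longrightarrow> a \<rightharpoonup>\<^bsub>MN\<^esub> t \<in> carrier MN"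
  "\<lbrakk>a \<in> carrier A; t \<in> carrier MN\<rbrakk> \<Longrightarrow> t \<leftharpoonup>\<^bsub>MN\<^esub> a \<in> carrier MN"
  using hom_in_carrier[OF MN_lact(1)] hom_in_carrier[OF MN_ract(1)] by auto

end

context fgp_bimodule begin

text \<open>The pairs \<open>(cw i, cx i)\<close> and \<open>(dy j, dr j)\<close> are the pairs \<open>(\<omega>\<^sub>i, x\<^sub>i)\<close> and \<open>(y\<^sub>j, \<rho>\<^sub>j)\<close> of
  the coevaluations.\<close>

definition "cn = length (coev A \<Omega>)"
definition "cw i = fst (coev A \<Omega> ! i)"
definition "cx i = snd (coev A \<Omega> ! i)"
definition "dn = length (coev' A \<Omega>)"
definition "dy i = fst (coev' A \<Omega> ! i)"
definition "dr i = snd (coev' A \<Omega> ! i)"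

text \<open>Finite projectivity on the right enters here: it makes the choice defining
  \<open>coev\<close> meaningful. The left-sided hypothesis does the same for \<open>coev'\<close>
  in \<open>coev'_closed\<close>.\<close>

lemma coev_closed: "i < cn \<Longrightarrow> cw i \<in> carrier \<Omega>" "i < cn \<Longrightarrow> cx i \<in> carrier XX"
  and coev_triangle: "\<omega> \<in> carrier \<Omega> \<Longrightarrow> (\<Otimes>\<^bsub>\<Omega>\<^esub>i\<in>{..<cn}. cw i \<leftharpoonup>\<^bsub>\<Omega>\<^esub> cx i \<omega>) = \<omega>"
    "x \<in> carrier XX \<Longrightarrow> (\<Otimes>\<^bsub>XX\<^esub>i\<in>{..<cn}. x (cw i) \<rightharpoonup>\<^bsub>XX\<^esub> cx i) = x"
proof -
  have c: "is_coev A \<Omega> (coev A \<Omega>)"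
    unfolding coev_def by (rule someI_ex[OF coev_exists[OF fgp(1)]])
  then have "coev A \<Omega> ! i \<in> carrier \<Omega> \<times> carrier XX" if "i < cn" for i
    using that nth_mem[of i "coev A \<Omega>"] unfolding is_coev_def cn_def by blast
  then show "i < cn \<Longrightarrow> cw i \<in> carrier \<Omega>" "i < cn \<Longrightarrow> cx i \<in> carrier XX"
    unfolding cw_def cx_def by (metis mem_Times_iff)+
  show "\<omega> \<in> carrier \<Omega> \<Longrightarrow> (\<Otimes>\<^bsub>\<Omega>\<^esub>i\<in>{..<cn}. cw i \<leftharpoonup>\<^bsub>\<Omega>\<^esub> cx i \<omega>) = \<omega>"
    "x \<in> carrier XX \<Longrightarrow> (\<Otimes>\<^bsub>XX\<^esub>i\<in>{..<cn}. x (cw i) \<rightharpoonup>\<^bsub>XX\<^esub> cx i) = x"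
    using c unfolding is_coev_def cn_def cw_def cx_def by blast+
qed

lemma coev'_closed: "j < dn \<Longrightarrow> dy j \<in> carrier YY" "j < dn \<Longrightarrow> dr j \<in> carrier \<Omega>"
  and coev'_triangle: "\<omega> \<in> carrier \<Omega> \<Longrightarrow> (\<Otimes>\<^bsub>\<Omega>\<^esub>j\<in>{..<dn}. dy j \<omega> \<rightharpoonup>\<^bsub>\<Omega>\<^esub> dr j) = \<omega>"
    "y \<in> carrier YY \<Longrightarrow> (\<Otimes>\<^bsub>YY\<^esub>j\<in>{..<dn}. dy j \<leftharpoonup>\<^bsub>YY\<^esub> y (dr j)) = y"
proof -
  have c: "is_coev' A \<Omega> (coev' A \<Omega>)"
    unfolding coev'_def by (rule someI_ex[OF coev'_exists[OF fgp(2)]])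
  then have "coev' A \<Omega> ! i \<in> carrier YY \<times> carrier \<Omega>" if "i < dn" for i
    using that nth_mem[of i "coev' A \<Omega>"] unfolding is_coev'_def dn_def by blast
  then show "j < dn \<Longrightarrow> dy j \<in> carrier YY" "j < dn \<Longrightarrow> dr j \<in> carrier \<Omega>"
    unfolding dy_def dr_def by (metis mem_Times_iff)+
  show "\<omega> \<in> carrier \<Omega> \<Longrightarrow> (\<Otimes>\<^bsub>\<Omega>\<^esub>j\<in>{..<dn}. dy j \<omega> \<rightharpoonup>\<^bsub>\<Omega>\<^esub> dr j) = \<omega>"
    "y \<in> carrier YY \<Longrightarrow> (\<Otimes>\<^bsub>YY\<^esub>j\<in>{..<dn}. dy j \<leftharpoonup>\<^bsub>YY\<^esub> y (dr j)) = y"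
    using c unfolding is_coev'_def dn_def dy_def dr_def by blast+
qed

lemma dual_closed:
  "\<lbrakk>x \<in> carrier XX; \<omega> \<in> carrier \<Omega>\<rbrakk> \<Longrightarrow> x \<omega> \<in> carrier A"
  "\<lbrakk>y \<in> carrier YY; \<omega> \<in> carrier \<Omega>\<rbrakk> \<Longrightarrow> y \<omega> \<in> carrier A"
  by (simp_all add: left_dual_carrier right_dual_carrier)

lemma dual_apply:
  assumes "\<omega> \<in> carrier \<Omega>"
  shows "(x \<otimes>\<^bsub>XX\<^esub> x') \<omega> = x \<omega> \<oplus>\<^bsub>A\<^esub> x' \<omega>" "(y \<otimes>\<^bsub>YY\<^esub> y') \<omega> = y \<omega> \<oplus>\<^bsub>A\<^esub> y' \<omega>"
    "(a \<rightharpoonup>\<^bsub>XX\<^esub> x) \<omega> = a \<otimes>\<^bsub>A\<^esub> x \<omega>" "(x \<leftharpoonup>\<^bsub>XX\<^esub> a) \<omega> = x (a \<rightharpoonup>\<^bsub>\<Omega>\<^esub> \<omega>)"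
    "(a \<rightharpoonup>\<^bsub>YY\<^esub> y) \<omega> = y (\<omega> \<leftharpoonup>\<^bsub>\<Omega>\<^esub> a)" "(y \<leftharpoonup>\<^bsub>YY\<^esub> a) \<omega> = y \<omega> \<otimes>\<^bsub>A\<^esub> a"
  using assms by (simp_all add: left_dual_simps right_dual_simps)

lemma dual_linear:
  "\<lbrakk>x \<in> carrier XX; \<omega> \<in> carrier \<Omega>; a \<in> carrier A\<rbrakk> \<Longrightarrow> x (\<omega> \<leftharpoonup>\<^bsub>\<Omega>\<^esub> a) = x \<omega> \<otimes>\<^bsub>A\<^esub> a"
  "\<lbrakk>y \<in> carrier YY; \<omega> \<in> carrier \<Omega>; a \<in> carrier A\<rbrakk> \<Longrightarrow> y (a \<rightharpoonup>\<^bsub>\<Omega>\<^esub> \<omega>) = a \<otimes>\<^bsub>A\<^esub> y \<omega>"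
  by (simp_all add: left_dual_carrier right_dual_carrier)

end

locale omega_pair = fgp_bimodule K A \<Omega> + N: bimodule K A N
  for K :: "('k, 'x) ring_scheme" and A :: "('k, 'a, 'y) module_scheme"
    and \<Omega> :: "('a, 'a, 'w, 'z) bimod_scheme" and N :: "('a, 'a, 'm, 'q) bimod_scheme"
begin

sublocale NO: bimod_pair K A N \<Omega> ..
sublocale ON: bimod_pair K A \<Omega> N ..

abbreviation "P1 \<equiv> tensA A N \<Omega>"
abbreviation "P2 \<equiv> tensA A \<Omega> N"
abbreviation "p1 \<equiv> tensA_pure A N \<Omega>"
abbreviation "p2 \<equiv> tensA_pure A \<Omega> N"

text \<open>\<open>EV x\<close> applies \<open>x\<close> to the left tensor factor and
  \<open>EV' y\<close> applies \<open>y\<close> to the right one; the identifications of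
  \<open>A \<otimes> N\<close> and \<open>N \<otimes> A\<close> with \<open>N\<close> are already
  built in.\<close>

definition "EV x = agp_ext N (\<lambda>(\<omega>, m). x \<omega> \<rightharpoonup>\<^bsub>N\<^esub> m)"
definition "EV' y = agp_ext N (\<lambda>(m, \<omega>). m \<leftharpoonup>\<^bsub>N\<^esub> y \<omega>)"

lemma EV_hom: "x \<in> carrier XX \<Longrightarrow> EV x \<in> hom P2 N"
  and EV_pure: "\<lbrakk>x \<in> carrier XX; \<omega> \<in> carrier \<Omega>; m \<in> carrier N\<rbrakk> \<Longrightarrow> EV x (p2 \<omega> m) = x \<omega> \<rightharpoonup>\<^bsub>N\<^esub> m"
proof -
  have 1: "(\<lambda>m. x \<omega> \<rightharpoonup>\<^bsub>N\<^esub> m) \<in> hom N N" if "x \<in> carrier XX" "\<omega> \<in> carrier \<Omega>" for x \<omega>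
    using N.lact_hom dual_closed(1)[OF that] by simp
  have 2: "(\<lambda>\<omega>. x \<omega> \<rightharpoonup>\<^bsub>N\<^esub> m) \<in> hom \<Omega> N" if "x \<in> carrier XX" "m \<in> carrier N" for x m
    by (rule hom_compose_lam[OF left_dual_hom[OF that(1)] N.lact_hom_left[OF that(2)]])
  have 3: "x (\<omega> \<leftharpoonup>\<^bsub>\<Omega>\<^esub> a) \<rightharpoonup>\<^bsub>N\<^esub> m = x \<omega> \<rightharpoonup>\<^bsub>N\<^esub> (a \<rightharpoonup>\<^bsub>N\<^esub> m)"
    if "x \<in> carrier XX" "\<omega> \<in> carrier \<Omega>" "a \<in> carrier A" "m \<in> carrier N" for x \<omega> a m
    using that by (simp add: dual_linear dual_closed N.mult_lact)
  show "x \<in> carrier XX \<Longrightarrow> EV x \<in> hom P2 N"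
    unfolding EV_def by (rule ON.MN_ext(1)[OF N.M.comm_group_axioms 1 2 3])
  show "\<lbrakk>x \<in> carrier XX; \<omega> \<in> carrier \<Omega>; m \<in> carrier N\<rbrakk> \<Longrightarrow> EV x (p2 \<omega> m) = x \<omega> \<rightharpoonup>\<^bsub>N\<^esub> m"
    unfolding EV_def by (rule ON.MN_ext(2)[OF N.M.comm_group_axioms 1 2 3])
qed

lemma EV'_hom: "y \<in> carrier YY \<Longrightarrow> EV' y \<in> hom P1 N"
  and EV'_pure: "\<lbrakk>y \<in> carrier YY; \<omega> \<in> carrier \<Omega>; m \<in> carrier N\<rbrakk> \<Longrightarrow> EV' y (p1 m \<omega>) = m \<leftharpoonup>\<^bsub>N\<^esub> y \<omega>"
proof -
  have 1: "(\<lambda>\<omega>. m \<leftharpoonup>\<^bsub>N\<^esub> y \<omega>) \<in> hom \<Omega> N" if "y \<in> carrier YY" "m \<in> carrier N" for y m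
    by (rule hom_compose_lam[OF right_dual_hom[OF that(1)] N.ract_hom_right[OF that(2)]])
  have 2: "(\<lambda>m. m \<leftharpoonup>\<^bsub>N\<^esub> y \<omega>) \<in> hom N N" if "y \<in> carrier YY" "\<omega> \<in> carrier \<Omega>" for y \<omega>
    using N.ract_hom dual_closed(2)[OF that] by simp
  have 3: "(m \<leftharpoonup>\<^bsub>N\<^esub> a) \<leftharpoonup>\<^bsub>N\<^esub> y \<omega> = m \<leftharpoonup>\<^bsub>N\<^esub> y (a \<rightharpoonup>\<^bsub>\<Omega>\<^esub> \<omega>)"
    if "y \<in> carrier YY" "m \<in> carrier N" "a \<in> carrier A" "\<omega> \<in> carrier \<Omega>" for y \<omega> a m
    using that by (simp add: dual_linear dual_closed N.ract_mult)
  show "y \<in> carrier YY \<Longrightarrow> EV' y \<in> hom P1 N"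
    unfolding EV'_def by (rule NO.MN_ext(1)[OF N.M.comm_group_axioms 1 2 3])
  show "\<lbrakk>y \<in> carrier YY; \<omega> \<in> carrier \<Omega>; m \<in> carrier N\<rbrakk> \<Longrightarrow> EV' y (p1 m \<omega>) = m \<leftharpoonup>\<^bsub>N\<^esub> y \<omega>"
    unfolding EV'_def by (rule NO.MN_ext(2)[OF N.M.comm_group_axioms 1 2 3])
qed

lemma EV_closed: "\<lbrakk>x \<in> carrier XX; t \<in> carrier P2\<rbrakk> \<Longrightarrow> EV x t \<in> carrier N"
  and EV'_closed: "\<lbrakk>y \<in> carrier YY; u \<in> carrier P1\<rbrakk> \<Longrightarrow> EV' y u \<in> carrier N"
  using hom_in_carrier[OF EV_hom] hom_in_carrier[OF EV'_hom] by auto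

text \<open>The expansion in the dual basis. On a pure tensor the coefficient
  \<open>cx i \<omega>\<close> crosses the tensor sign by balancedness, and the first triangle
  identity reassembles \<omega>; both sides are additive, so pure tensors are enough.\<close>

lemma EV_expand:
  assumes "t \<in> carrier P2"
  shows "(\<Otimes>\<^bsub>P2\<^esub>i\<in>{..<cn}. p2 (cw i) (EV (cx i) t)) = t"
proof (rule ON.MN_hom_eqI[OF ON.MN_group _ _ _ assms, of "\<lambda>t. \<Otimes>\<^bsub>P2\<^esub>i\<in>{..<cn}. p2 (cw i) (EV (cx i) t)" "\<lambda>t. t"])
  show "(\<lambda>t. \<Otimes>\<^bsub>P2\<^esub>i\<in>{..<cn}. p2 (cw i) (EV (cx i) t)) \<in> hom P2 P2"
    by (rule finprod_hom[OF ON.MN_comm_group])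
      (rule hom_compose_lam[OF EV_hom ON.pa_hom_right], simp_all add: coev_closed)
  show "(\<lambda>t. t) \<in> hom P2 P2"
    by (simp add: hom_def)
  fix \<omega> m assume h: "\<omega> \<in> carrier \<Omega>" "m \<in> carrier N"
  have "(\<Otimes>\<^bsub>P2\<^esub>i\<in>{..<cn}. p2 (cw i) (EV (cx i) (p2 \<omega> m))) = (\<Otimes>\<^bsub>P2\<^esub>i\<in>{..<cn}. p2 (cw i \<leftharpoonup>\<^bsub>\<Omega>\<^esub> cx i \<omega>) m)"
    by (rule comm_monoid.finprod_cong'[OF comm_group.axioms(1)[OF ON.MN_comm_group]])
      (use h in \<open>auto simp: EV_pure coev_closed ON.pa_balanced dual_closed N.lact_closed\<close>)
  also have "\<dots> = p2 (\<Otimes>\<^bsub>\<Omega>\<^esub>i\<in>{..<cn}. cw i \<leftharpoonup>\<^bsub>\<Omega>\<^esub> cx i \<omega>) m"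
    by (rule hom_finprod_lessThan[OF M.comm_group_axioms ON.MN_comm_group ON.pa_hom_left[OF h(2)], symmetric])
      (use h in \<open>simp add: coev_closed dual_closed ract_closed\<close>)
  finally show "(\<Otimes>\<^bsub>P2\<^esub>i\<in>{..<cn}. p2 (cw i) (EV (cx i) (p2 \<omega> m))) = p2 \<omega> m"
    using coev_triangle(1)[OF h(1)] by simp
qed

lemma EV'_expand:
  assumes "t \<in> carrier P1"
  shows "(\<Otimes>\<^bsub>P1\<^esub>j\<in>{..<dn}. p1 (EV' (dy j) t) (dr j)) = t"
proof (rule NO.MN_hom_eqI[OF NO.MN_group _ _ _ assms, of "\<lambda>t. \<Otimes>\<^bsub>P1\<^esub>j\<in>{..<dn}. p1 (EV' (dy j) t) (dr j)" "\<lambda>t. t"])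
  show "(\<lambda>t. \<Otimes>\<^bsub>P1\<^esub>j\<in>{..<dn}. p1 (EV' (dy j) t) (dr j)) \<in> hom P1 P1"
    by (rule finprod_hom[OF NO.MN_comm_group])
      (rule hom_compose_lam[OF EV'_hom NO.pa_hom_left], simp_all add: coev'_closed)
  show "(\<lambda>t. t) \<in> hom P1 P1"
    by (simp add: hom_def)
  fix m \<omega> assume h: "m \<in> carrier N" "\<omega> \<in> carrier \<Omega>"
  have "(\<Otimes>\<^bsub>P1\<^esub>j\<in>{..<dn}. p1 (EV' (dy j) (p1 m \<omega>)) (dr j)) = (\<Otimes>\<^bsub>P1\<^esub>j\<in>{..<dn}. p1 m (dy j \<omega> \<rightharpoonup>\<^bsub>\<Omega>\<^esub> dr j))"
    by (rule comm_monoid.finprod_cong'[OF comm_group.axioms(1)[OF NO.MN_comm_group]])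
      (use h in \<open>auto simp: EV'_pure coev'_closed NO.pa_balanced dual_closed lact_closed\<close>)
  also have "\<dots> = p1 m (\<Otimes>\<^bsub>\<Omega>\<^esub>j\<in>{..<dn}. dy j \<omega> \<rightharpoonup>\<^bsub>\<Omega>\<^esub> dr j)"
    by (rule hom_finprod_lessThan[OF M.comm_group_axioms NO.MN_comm_group NO.pa_hom_right[OF h(1)], symmetric])
      (use h in \<open>simp add: coev'_closed dual_closed lact_closed\<close>)
  finally show "(\<Otimes>\<^bsub>P1\<^esub>j\<in>{..<dn}. p1 (EV' (dy j) (p1 m \<omega>)) (dr j)) = p1 m \<omega>"
    using coev'_triangle(1)[OF h(2)] by simp
qed

text \<open>The evaluations separate points; identities between elements of these tensor products are
  checked in this way.\<close>

lemma EV_eqI: "\<lbrakk>t \<in> carrier P2; u \<in> carrier P2; \<And>x. x \<in> carrier XX \<Longrightarrow> EV x t = EV x u\<rbrakk> \<Longrightarrow> t = u"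
  using EV_expand[of t] EV_expand[of u] coev_closed
    comm_monoid.finprod_cong'[OF comm_group.axioms(1)[OF ON.MN_comm_group] refl,
      of "\<lambda>i. p2 (cw i) (EV (cx i) u)" "{..<cn}" "\<lambda>i. p2 (cw i) (EV (cx i) t)"]
  by (auto simp: EV_closed)

lemma EV'_eqI: "\<lbrakk>t \<in> carrier P1; u \<in> carrier P1; \<And>y. y \<in> carrier YY \<Longrightarrow> EV' y t = EV' y u\<rbrakk> \<Longrightarrow> t = u"
  using EV'_expand[of t] EV'_expand[of u] coev'_closed
    comm_monoid.finprod_cong'[OF comm_group.axioms(1)[OF NO.MN_comm_group] refl,
      of "\<lambda>j. p1 (EV' (dy j) u) (dr j)" "{..<dn}" "\<lambda>j. p1 (EV' (dy j) t) (dr j)"]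
  by (auto simp: EV'_closed)

text \<open>These rules trade actions on the functional for actions on the tensor or on its value.
  Under them the linearity of \<sigma> and the laws \<open>Xa_act\<close> correspond to each
  other.\<close>

lemma EV_act:
  assumes "x \<in> carrier XX" "a \<in> carrier A" "t \<in> carrier P2"
  shows "EV (a \<rightharpoonup>\<^bsub>XX\<^esub> x) t = a \<rightharpoonup>\<^bsub>N\<^esub> EV x t" (is ?L1)
    and "EV (x \<leftharpoonup>\<^bsub>XX\<^esub> a) t = EV x (a \<rightharpoonup>\<^bsub>P2\<^esub> t)" (is ?L2)
    and "EV x (t \<leftharpoonup>\<^bsub>P2\<^esub> a) = EV x t \<leftharpoonup>\<^bsub>N\<^esub> a" (is ?L3)
proof -
  show ?L1
    by (rule ON.MN_hom_eqI[OF N.M.is_group EV_hom hom_compose_lam[OF EV_hom N.lact_hom] _ assms(3)])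
      (use assms in \<open>auto simp: EV_pure X.lact_closed dual_apply N.mult_lact dual_closed\<close>)
  show ?L2
    by (rule ON.MN_hom_eqI[OF N.M.is_group EV_hom hom_compose_lam[OF ON.MN_lact(1) EV_hom] _ assms(3)])
      (use assms in \<open>auto simp: EV_pure X.ract_closed dual_apply ON.MN_lact(2) lact_closed\<close>)
  show ?L3
    by (rule ON.MN_hom_eqI[OF N.M.is_group hom_compose_lam[OF ON.MN_ract(1) EV_hom] hom_compose_lam[OF EV_hom N.ract_hom] _ assms(3)])
      (use assms in \<open>auto simp: EV_pure ON.MN_ract(2) N.ract_closed dual_closed N.lact_ract\<close>)
qed

lemma EV'_act:
  assumes "y \<in> carrier YY" "a \<in> carrier A" "t \<in> carrier P1"
  shows "EV' (a \<rightharpoonup>\<^bsub>YY\<^esub> y) t = EV' y (t \<leftharpoonup>\<^bsub>P1\<^esub> a)" (is ?L1)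
    and "EV' (y \<leftharpoonup>\<^bsub>YY\<^esub> a) t = EV' y t \<leftharpoonup>\<^bsub>N\<^esub> a" (is ?L2)
    and "EV' y (a \<rightharpoonup>\<^bsub>P1\<^esub> t) = a \<rightharpoonup>\<^bsub>N\<^esub> EV' y t" (is ?L3)
proof -
  show ?L1
    by (rule NO.MN_hom_eqI[OF N.M.is_group EV'_hom hom_compose_lam[OF NO.MN_ract(1) EV'_hom] _ assms(3)])
      (use assms in \<open>auto simp: EV'_pure Y.lact_closed dual_apply NO.MN_ract(2) ract_closed\<close>)
  show ?L2
    by (rule NO.MN_hom_eqI[OF N.M.is_group EV'_hom hom_compose_lam[OF EV'_hom N.ract_hom] _ assms(3)])
      (use assms in \<open>auto simp: EV'_pure Y.ract_closed dual_apply N.ract_mult dual_closed\<close>)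
  show ?L3
    by (rule NO.MN_hom_eqI[OF N.M.is_group hom_compose_lam[OF NO.MN_lact(1) EV'_hom] hom_compose_lam[OF EV'_hom N.lact_hom] _ assms(3)])
      (use assms in \<open>auto simp: EV'_pure NO.MN_lact(2) N.lact_closed dual_closed N.lact_ract\<close>)
qed

lemma EV_hom_left:
  assumes "t \<in> carrier P2" shows "(\<lambda>x. EV x t) \<in> hom XX N"
proof (rule homI)
  fix x x' assume x: "x \<in> carrier XX" "x' \<in> carrier XX"
  show "EV (x \<otimes>\<^bsub>XX\<^esub> x') t = EV x t \<otimes>\<^bsub>N\<^esub> EV x' t"
    by (rule ON.MN_hom_eqI[OF N.M.is_group EV_hom hom_pointwise_mult[OF N.M.comm_group_axioms EV_hom EV_hom] _ assms])
      (use x X.M.m_closed[OF x] in \<open>auto simp: EV_pure dual_apply N.add_lact dual_closed\<close>)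
qed (use assms EV_closed in auto)

lemma EV'_hom_left:
  assumes "t \<in> carrier P1" shows "(\<lambda>y. EV' y t) \<in> hom YY N"
proof (rule homI)
  fix x x' assume x: "x \<in> carrier YY" "x' \<in> carrier YY"
  show "EV' (x \<otimes>\<^bsub>YY\<^esub> x') t = EV' x t \<otimes>\<^bsub>N\<^esub> EV' x' t"
    by (rule NO.MN_hom_eqI[OF N.M.is_group EV'_hom hom_pointwise_mult[OF N.M.comm_group_axioms EV'_hom EV'_hom] _ assms])
      (use x Y.M.m_closed[OF x] in \<open>auto simp: EV'_pure dual_apply N.ract_add dual_closed\<close>)
qed (use assms EV'_closed in auto)

end


section \<open>Intertwinings in terms of generators\<close>

text \<open>\<open>Xa x \<omega>\<close> and \<open>Ya \<rho> y\<close> are the operators on \<open>N\<close> by which \<open>(x, \<omega>)\<close> and \<open>(\<rho>, y)\<close> act.\<close>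

locale gen_module = omega_pair K A \<Omega> N
  for K :: "('k, 'x) ring_scheme" and A :: "('k, 'a, 'y) module_scheme"
    and \<Omega> :: "('a, 'a, 'w, 'z) bimod_scheme" and N :: "('a, 'a, 'm, 'q) bimod_scheme" +
  fixes Xa :: "('w \<Rightarrow> 'a) \<Rightarrow> 'w \<Rightarrow> 'm \<Rightarrow> 'm" and Ya :: "'w \<Rightarrow> ('w \<Rightarrow> 'a) \<Rightarrow> 'm \<Rightarrow> 'm"
  assumes Xa_hom: "\<lbrakk>x \<in> carrier XX; \<omega> \<in> carrier \<Omega>\<rbrakk> \<Longrightarrow> Xa x \<omega> \<in> hom N N"
      "\<lbrakk>\<omega> \<in> carrier \<Omega>; m \<in> carrier N\<rbrakk> \<Longrightarrow> (\<lambda>x. Xa x \<omega> m) \<in> hom XX N"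
      "\<lbrakk>x \<in> carrier XX; m \<in> carrier N\<rbrakk> \<Longrightarrow> (\<lambda>\<omega>. Xa x \<omega> m) \<in> hom \<Omega> N"
    and Ya_hom: "\<lbrakk>\<omega> \<in> carrier \<Omega>; y \<in> carrier YY\<rbrakk> \<Longrightarrow> Ya \<omega> y \<in> hom N N"
      "\<lbrakk>y \<in> carrier YY; m \<in> carrier N\<rbrakk> \<Longrightarrow> (\<lambda>\<omega>. Ya \<omega> y m) \<in> hom \<Omega> N"
      "\<lbrakk>\<omega> \<in> carrier \<Omega>; m \<in> carrier N\<rbrakk> \<Longrightarrow> (\<lambda>y. Ya \<omega> y m) \<in> hom YY N"
    and Xa_act: "\<lbrakk>x \<in> carrier XX; \<omega> \<in> carrier \<Omega>; m \<in> carrier N; a \<in> carrier A\<rbrakk> \<Longrightarrow> Xa (a \<rightharpoonup>\<^bsub>XX\<^esub> x) \<omega> m = a \<rightharpoonup>\<^bsub>N\<^esub> Xa x \<omega> m"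
      "\<lbrakk>x \<in> carrier XX; \<omega> \<in> carrier \<Omega>; m \<in> carrier N; a \<in> carrier A\<rbrakk> \<Longrightarrow> Xa (x \<leftharpoonup>\<^bsub>XX\<^esub> a) \<omega> m = Xa x \<omega> (a \<rightharpoonup>\<^bsub>N\<^esub> m)"
      "\<lbrakk>x \<in> carrier XX; \<omega> \<in> carrier \<Omega>; m \<in> carrier N; a \<in> carrier A\<rbrakk> \<Longrightarrow> Xa x (a \<rightharpoonup>\<^bsub>\<Omega>\<^esub> \<omega>) m = Xa x \<omega> (m \<leftharpoonup>\<^bsub>N\<^esub> a)"
      "\<lbrakk>x \<in> carrier XX; \<omega> \<in> carrier \<Omega>; m \<in> carrier N; a \<in> carrier A\<rbrakk> \<Longrightarrow> Xa x (\<omega> \<leftharpoonup>\<^bsub>\<Omega>\<^esub> a) m = Xa x \<omega> m \<leftharpoonup>\<^bsub>N\<^esub> a"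
    and Ya_act: "\<lbrakk>y \<in> carrier YY; \<omega> \<in> carrier \<Omega>; m \<in> carrier N; a \<in> carrier A\<rbrakk> \<Longrightarrow> Ya (a \<rightharpoonup>\<^bsub>\<Omega>\<^esub> \<omega>) y m = a \<rightharpoonup>\<^bsub>N\<^esub> Ya \<omega> y m"
      "\<lbrakk>y \<in> carrier YY; \<omega> \<in> carrier \<Omega>; m \<in> carrier N; a \<in> carrier A\<rbrakk> \<Longrightarrow> Ya (\<omega> \<leftharpoonup>\<^bsub>\<Omega>\<^esub> a) y m = Ya \<omega> y (a \<rightharpoonup>\<^bsub>N\<^esub> m)"
      "\<lbrakk>y \<in> carrier YY; \<omega> \<in> carrier \<Omega>; m \<in> carrier N; a \<in> carrier A\<rbrakk> \<Longrightarrow> Ya \<omega> (a \<rightharpoonup>\<^bsub>YY\<^esub> y) m = Ya \<omega> y (m \<leftharpoonup>\<^bsub>N\<^esub> a)"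
      "\<lbrakk>y \<in> carrier YY; \<omega> \<in> carrier \<Omega>; m \<in> carrier N; a \<in> carrier A\<rbrakk> \<Longrightarrow> Ya \<omega> (y \<leftharpoonup>\<^bsub>YY\<^esub> a) m = Ya \<omega> y m \<leftharpoonup>\<^bsub>N\<^esub> a"
    and YX_rel: "\<lbrakk>y \<in> carrier YY; \<omega> \<in> carrier \<Omega>; m \<in> carrier N\<rbrakk>
      \<Longrightarrow> (\<Otimes>\<^bsub>N\<^esub>i\<in>{..<cn}. Ya (cw i) y (Xa (cx i) \<omega> m)) = m \<leftharpoonup>\<^bsub>N\<^esub> y \<omega>"
    and XY_rel: "\<lbrakk>x \<in> carrier XX; \<omega> \<in> carrier \<Omega>; m \<in> carrier N\<rbrakk>
      \<Longrightarrow> (\<Otimes>\<^bsub>N\<^esub>j\<in>{..<dn}. Xa x (dr j) (Ya \<omega> (dy j) m)) = x \<omega> \<rightharpoonup>\<^bsub>N\<^esub> m"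
begin

lemma Xa_closed: "\<lbrakk>x \<in> carrier XX; \<omega> \<in> carrier \<Omega>; m \<in> carrier N\<rbrakk> \<Longrightarrow> Xa x \<omega> m \<in> carrier N"
  and Ya_closed: "\<lbrakk>\<omega> \<in> carrier \<Omega>; y \<in> carrier YY; m \<in> carrier N\<rbrakk> \<Longrightarrow> Ya \<omega> y m \<in> carrier N"
  using hom_in_carrier[OF Xa_hom(1)] hom_in_carrier[OF Ya_hom(1)] by auto

definition "sg0 m \<omega> = (\<Otimes>\<^bsub>P2\<^esub>i\<in>{..<cn}. p2 (cw i) (Xa (cx i) \<omega> m))"
definition "sg0' \<omega> m = (\<Otimes>\<^bsub>P1\<^esub>j\<in>{..<dn}. p1 (Ya \<omega> (dy j) m) (dr j))"

lemma sg0_closed: "\<lbrakk>m \<in> carrier N; \<omega> \<in> carrier \<Omega>\<rbrakk> \<Longrightarrow> sg0 m \<omega> \<in> carrier P2"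
  and sg0'_closed: "\<lbrakk>m \<in> carrier N; \<omega> \<in> carrier \<Omega>\<rbrakk> \<Longrightarrow> sg0' \<omega> m \<in> carrier P1"
  unfolding sg0_def sg0'_def
  by (auto intro!: comm_monoid.finprod_closed[OF comm_group.axioms(1)[OF ON.MN_comm_group]]
      comm_monoid.finprod_closed[OF comm_group.axioms(1)[OF NO.MN_comm_group]]
      simp: coev_closed coev'_closed Xa_closed Ya_closed)

text \<open>The coefficients \<open>x (cw i)\<close> can be absorbed into the functionals because
  \<open>Xa\<close> is left linear in \<open>x\<close>; the second triangle identity then restores
  \<open>x\<close>. The result describes the value of \<sigma> without reference to the dual
  basis.\<close>

lemma EV_sg0:
  assumes "x \<in> carrier XX" "m \<in> carrier N" "\<omega> \<in> carrier \<Omega>"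
  shows "EV x (sg0 m \<omega>) = Xa x \<omega> m"
proof -
  have "EV x (sg0 m \<omega>) = (\<Otimes>\<^bsub>N\<^esub>i\<in>{..<cn}. EV x (p2 (cw i) (Xa (cx i) \<omega> m)))"
    unfolding sg0_def
    by (rule hom_finprod_lessThan[OF ON.MN_comm_group N.M.comm_group_axioms EV_hom[OF assms(1)]])
      (use assms in \<open>simp add: coev_closed Xa_closed\<close>)
  also have "\<dots> = (\<Otimes>\<^bsub>N\<^esub>i\<in>{..<cn}. Xa (x (cw i) \<rightharpoonup>\<^bsub>XX\<^esub> cx i) \<omega> m)"
    by (rule N.M.finprod_cong')
      (use assms in \<open>auto simp: EV_pure coev_closed Xa_closed Xa_act dual_closed N.lact_closed\<close>)
  also have "\<dots> = Xa (\<Otimes>\<^bsub>XX\<^esub>i\<in>{..<cn}. x (cw i) \<rightharpoonup>\<^bsub>XX\<^esub> cx i) \<omega> m"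
    by (rule hom_finprod_lessThan[OF X.M.comm_group_axioms N.M.comm_group_axioms Xa_hom(2)[OF assms(3,2)], symmetric])
      (use assms in \<open>simp add: coev_closed dual_closed X.lact_closed\<close>)
  finally show ?thesis
    using coev_triangle(2)[OF assms(1)] by simp
qed

lemma EV'_sg0':
  assumes "y \<in> carrier YY" "m \<in> carrier N" "\<omega> \<in> carrier \<Omega>"
  shows "EV' y (sg0' \<omega> m) = Ya \<omega> y m"
proof -
  have "EV' y (sg0' \<omega> m) = (\<Otimes>\<^bsub>N\<^esub>j\<in>{..<dn}. EV' y (p1 (Ya \<omega> (dy j) m) (dr j)))"
    unfolding sg0'_def
    by (rule hom_finprod_lessThan[OF NO.MN_comm_group N.M.comm_group_axioms EV'_hom[OF assms(1)]])
      (use assms in \<open>simp add: coev'_closed Ya_closed\<close>)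
  also have "\<dots> = (\<Otimes>\<^bsub>N\<^esub>j\<in>{..<dn}. Ya \<omega> (dy j \<leftharpoonup>\<^bsub>YY\<^esub> y (dr j)) m)"
    by (rule N.M.finprod_cong')
      (use assms in \<open>auto simp: EV'_pure coev'_closed Ya_closed Ya_act dual_closed N.ract_closed\<close>)
  also have "\<dots> = Ya \<omega> (\<Otimes>\<^bsub>YY\<^esub>j\<in>{..<dn}. dy j \<leftharpoonup>\<^bsub>YY\<^esub> y (dr j)) m"
    by (rule hom_finprod_lessThan[OF Y.M.comm_group_axioms N.M.comm_group_axioms Ya_hom(3)[OF assms(3,2)], symmetric])
      (use assms in \<open>simp add: coev'_closed dual_closed Y.ract_closed\<close>)
  finally show ?thesis
    using coev'_triangle(2)[OF assms(1)] by simp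
qed

text \<open>The restriction supplies the extensionality demanded by \<open>bimod_hom\<close>; with
  it \<sigma> is determined by its values on the tensor product.\<close>

definition "sg = restrict (agp_ext P2 (\<lambda>(m, \<omega>). sg0 m \<omega>)) (carrier P1)"
definition "sg' = restrict (agp_ext P1 (\<lambda>(\<omega>, m). sg0' \<omega> m)) (carrier P2)"

text \<open>Additivity and balancedness of \<open>sg0\<close> cannot be read off its defining sum
  directly, but after applying every \<open>EV x\<close> they are the corresponding laws of
  \<open>Xa\<close>.\<close>

lemma sg_hom: "sg \<in> hom P1 P2"
  and sg_pure: "\<lbrakk>m \<in> carrier N; \<omega> \<in> carrier \<Omega>\<rbrakk> \<Longrightarrow> sg (p1 m \<omega>) = sg0 m \<omega>"
proof -
  have add: "EV x (t \<otimes>\<^bsub>P2\<^esub> u) = EV x t \<otimes>\<^bsub>N\<^esub> EV x u"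
    if "x \<in> carrier XX" "t \<in> carrier P2" "u \<in> carrier P2" for x t u
    using hom_mult[OF EV_hom] that by simp
  interpret P2: comm_group P2 by (rule ON.MN_comm_group)
  have 1: "sg0 m \<in> hom \<Omega> P2" if "m \<in> carrier N" for m
  proof (rule homI)
    fix \<omega> \<eta> assume "\<omega> \<in> carrier \<Omega>" "\<eta> \<in> carrier \<Omega>"
    then show "sg0 m (\<omega> \<otimes>\<^bsub>\<Omega>\<^esub> \<eta>) = sg0 m \<omega> \<otimes>\<^bsub>P2\<^esub> sg0 m \<eta>"
      using that hom_mult[OF Xa_hom(3)] by (intro EV_eqI) (auto simp: sg0_closed add EV_sg0)
  qed (use sg0_closed that in auto)
  have 2: "(\<lambda>m. sg0 m \<omega>) \<in> hom N P2" if "\<omega> \<in> carrier \<Omega>" for \<omega>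
  proof (rule homI)
    fix m n assume "m \<in> carrier N" "n \<in> carrier N"
    then show "sg0 (m \<otimes>\<^bsub>N\<^esub> n) \<omega> = sg0 m \<omega> \<otimes>\<^bsub>P2\<^esub> sg0 n \<omega>"
      using that hom_mult[OF Xa_hom(1)] by (intro EV_eqI) (auto simp: sg0_closed add EV_sg0)
  qed (use sg0_closed that in auto)
  have 3: "sg0 (m \<leftharpoonup>\<^bsub>N\<^esub> a) \<omega> = sg0 m (a \<rightharpoonup>\<^bsub>\<Omega>\<^esub> \<omega>)"
    if "m \<in> carrier N" "a \<in> carrier A" "\<omega> \<in> carrier \<Omega>" for m a \<omega>
    using that by (intro EV_eqI) (auto simp: sg0_closed EV_sg0 N.ract_closed lact_closed Xa_act)
  note e = NO.MN_ext[OF ON.MN_comm_group 1 2 3]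
  show "sg \<in> hom P1 P2"
    using e(1) NO.MN_group by (auto simp: sg_def hom_def Pi_iff group.is_monoid monoid.m_closed)
  show "\<lbrakk>m \<in> carrier N; \<omega> \<in> carrier \<Omega>\<rbrakk> \<Longrightarrow> sg (p1 m \<omega>) = sg0 m \<omega>"
    using e(2) by (simp add: sg_def)
qed

lemma sg'_hom: "sg' \<in> hom P2 P1"
  and sg'_pure: "\<lbrakk>\<omega> \<in> carrier \<Omega>; m \<in> carrier N\<rbrakk> \<Longrightarrow> sg' (p2 \<omega> m) = sg0' \<omega> m"
proof -
  have add: "EV' x (t \<otimes>\<^bsub>P1\<^esub> u) = EV' x t \<otimes>\<^bsub>N\<^esub> EV' x u"
    if "x \<in> carrier YY" "t \<in> carrier P1" "u \<in> carrier P1" for x t u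
    using hom_mult[OF EV'_hom] that by simp
  interpret P1: comm_group P1 by (rule NO.MN_comm_group)
  have 1: "sg0' \<omega> \<in> hom N P1" if "\<omega> \<in> carrier \<Omega>" for \<omega>
  proof (rule homI)
    fix m n assume "m \<in> carrier N" "n \<in> carrier N"
    then show "sg0' \<omega> (m \<otimes>\<^bsub>N\<^esub> n) = sg0' \<omega> m \<otimes>\<^bsub>P1\<^esub> sg0' \<omega> n"
      using that hom_mult[OF Ya_hom(1)] by (intro EV'_eqI) (auto simp: sg0'_closed add EV'_sg0')
  qed (use sg0'_closed that in auto)
  have 2: "(\<lambda>\<omega>. sg0' \<omega> m) \<in> hom \<Omega> P1" if "m \<in> carrier N" for m
  proof (rule homI)
    fix \<omega> \<eta> assume "\<omega> \<in> carrier \<Omega>" "\<eta> \<in> carrier \<Omega>"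
    then show "sg0' (\<omega> \<otimes>\<^bsub>\<Omega>\<^esub> \<eta>) m = sg0' \<omega> m \<otimes>\<^bsub>P1\<^esub> sg0' \<eta> m"
      using that hom_mult[OF Ya_hom(2)] by (intro EV'_eqI) (auto simp: sg0'_closed add EV'_sg0')
  qed (use sg0'_closed that in auto)
  have 3: "sg0' (\<omega> \<leftharpoonup>\<^bsub>\<Omega>\<^esub> a) m = sg0' \<omega> (a \<rightharpoonup>\<^bsub>N\<^esub> m)"
    if "\<omega> \<in> carrier \<Omega>" "a \<in> carrier A" "m \<in> carrier N" for m a \<omega>
    using that by (intro EV'_eqI) (auto simp: sg0'_closed EV'_sg0' N.lact_closed ract_closed Ya_act)
  note e = ON.MN_ext[OF NO.MN_comm_group 1 2 3]
  show "sg' \<in> hom P2 P1"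
    using e(1) ON.MN_group by (auto simp: sg'_def hom_def Pi_iff group.is_monoid monoid.m_closed)
  show "\<lbrakk>\<omega> \<in> carrier \<Omega>; m \<in> carrier N\<rbrakk> \<Longrightarrow> sg' (p2 \<omega> m) = sg0' \<omega> m"
    using e(2) by (simp add: sg'_def)
qed

lemma sg_closed: "t \<in> carrier P1 \<Longrightarrow> sg t \<in> carrier P2"
  and sg'_closed: "u \<in> carrier P2 \<Longrightarrow> sg' u \<in> carrier P1"
  using hom_in_carrier[OF sg_hom] hom_in_carrier[OF sg'_hom] by auto

lemma EV_sg: "\<lbrakk>x \<in> carrier XX; m \<in> carrier N; \<omega> \<in> carrier \<Omega>\<rbrakk> \<Longrightarrow> EV x (sg (p1 m \<omega>)) = Xa x \<omega> m"
  and EV'_sg': "\<lbrakk>y \<in> carrier YY; m \<in> carrier N; \<omega> \<in> carrier \<Omega>\<rbrakk> \<Longrightarrow> EV' y (sg' (p2 \<omega> m)) = Ya \<omega> y m"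
  by (simp_all add: sg_pure sg'_pure EV_sg0 EV'_sg0')

text \<open>Seen through \<open>EV' y\<close> on a pure tensor, the claim is exactly
  \<open>YX_rel\<close>.\<close>

lemma sg'_sg:
  assumes "t \<in> carrier P1" shows "sg' (sg t) = t"
proof (rule NO.MN_hom_eqI[OF NO.MN_group hom_compose_lam[OF sg_hom sg'_hom] _ _ assms, of "\<lambda>t. t"])
  show "(\<lambda>t. t) \<in> hom P1 P1"
    by (simp add: hom_def)
  fix m \<omega> assume h: "m \<in> carrier N" "\<omega> \<in> carrier \<Omega>"
  show "sg' (sg (p1 m \<omega>)) = p1 m \<omega>"
  proof (rule EV'_eqI)
    fix y assume y: "y \<in> carrier YY"
    have "EV' y (sg' (sg (p1 m \<omega>))) = (\<Otimes>\<^bsub>N\<^esub>i\<in>{..<cn}. EV' y (sg' (p2 (cw i) (Xa (cx i) \<omega> m))))"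
      unfolding sg_pure[OF h] sg0_def
      by (rule hom_finprod_lessThan[OF ON.MN_comm_group N.M.comm_group_axioms hom_compose_lam[OF sg'_hom EV'_hom[OF y]]])
        (use h in \<open>simp add: coev_closed Xa_closed\<close>)
    also have "\<dots> = (\<Otimes>\<^bsub>N\<^esub>i\<in>{..<cn}. Ya (cw i) y (Xa (cx i) \<omega> m))"
      by (rule N.M.finprod_cong') (use h y in \<open>auto simp: EV'_sg' coev_closed Xa_closed Ya_closed\<close>)
    finally show "EV' y (sg' (sg (p1 m \<omega>))) = EV' y (p1 m \<omega>)"
      using YX_rel y h by (simp add: EV'_pure)
  qed (use h in \<open>simp_all add: sg_closed sg'_closed\<close>)
qed

text \<open>Seen through \<open>EV x\<close> on a pure tensor, the claim is exactly
  \<open>XY_rel\<close>.\<close>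

lemma sg_sg':
  assumes "t \<in> carrier P2" shows "sg (sg' t) = t"
proof (rule ON.MN_hom_eqI[OF ON.MN_group hom_compose_lam[OF sg'_hom sg_hom] _ _ assms, of "\<lambda>t. t"])
  show "(\<lambda>t. t) \<in> hom P2 P2"
    by (simp add: hom_def)
  fix \<omega> m assume h: "\<omega> \<in> carrier \<Omega>" "m \<in> carrier N"
  show "sg (sg' (p2 \<omega> m)) = p2 \<omega> m"
  proof (rule EV_eqI)
    fix x assume x: "x \<in> carrier XX"
    have "EV x (sg (sg' (p2 \<omega> m))) = (\<Otimes>\<^bsub>N\<^esub>j\<in>{..<dn}. EV x (sg (p1 (Ya \<omega> (dy j) m) (dr j))))"
      unfolding sg'_pure[OF h] sg0'_def
      by (rule hom_finprod_lessThan[OF NO.MN_comm_group N.M.comm_group_axioms hom_compose_lam[OF sg_hom EV_hom[OF x]]])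
        (use h in \<open>simp add: coev'_closed Ya_closed\<close>)
    also have "\<dots> = (\<Otimes>\<^bsub>N\<^esub>j\<in>{..<dn}. Xa x (dr j) (Ya \<omega> (dy j) m))"
      by (rule N.M.finprod_cong') (use h x in \<open>auto simp: EV_sg coev'_closed Xa_closed Ya_closed\<close>)
    finally show "EV x (sg (sg' (p2 \<omega> m))) = EV x (p2 \<omega> m)"
      using XY_rel x h by (simp add: EV_pure)
  qed (use h in \<open>simp_all add: sg_closed sg'_closed\<close>)
qed

text \<open>Left linearity follows from \<open>Xa_act(2)\<close>, since acting on \<open>m\<close>
  and acting on \<open>x\<close> from the right have the same effect; right linearity follows from
  \<open>Xa_act(4)\<close>.\<close>

lemma sg_linear:
  assumes "a \<in> carrier A" "t \<in> carrier P1"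
  shows "sg (a \<rightharpoonup>\<^bsub>P1\<^esub> t) = a \<rightharpoonup>\<^bsub>P2\<^esub> sg t" and "sg (t \<leftharpoonup>\<^bsub>P1\<^esub> a) = sg t \<leftharpoonup>\<^bsub>P2\<^esub> a"
proof -
  show "sg (a \<rightharpoonup>\<^bsub>P1\<^esub> t) = a \<rightharpoonup>\<^bsub>P2\<^esub> sg t"
  proof (rule NO.MN_hom_eqI[OF ON.MN_group hom_compose_lam[OF NO.MN_lact(1)[OF assms(1)] sg_hom]
        hom_compose_lam[OF sg_hom ON.MN_lact(1)[OF assms(1)]] _ assms(2)])
    fix m \<omega> assume "m \<in> carrier N" "\<omega> \<in> carrier \<Omega>"
    then show "sg (a \<rightharpoonup>\<^bsub>P1\<^esub> p1 m \<omega>) = a \<rightharpoonup>\<^bsub>P2\<^esub> sg (p1 m \<omega>)"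
      using assms(1) by (intro EV_eqI)
        (simp_all add: NO.MN_lact(2) sg_closed ON.MN_act_closed N.lact_closed EV_sg Xa_act(2)[symmetric]
          X.ract_closed EV_act(2)[symmetric])
  qed
  show "sg (t \<leftharpoonup>\<^bsub>P1\<^esub> a) = sg t \<leftharpoonup>\<^bsub>P2\<^esub> a"
  proof (rule NO.MN_hom_eqI[OF ON.MN_group hom_compose_lam[OF NO.MN_ract(1)[OF assms(1)] sg_hom]
        hom_compose_lam[OF sg_hom ON.MN_ract(1)[OF assms(1)]] _ assms(2)])
    fix m \<omega> assume "m \<in> carrier N" "\<omega> \<in> carrier \<Omega>"
    then show "sg (p1 m \<omega> \<leftharpoonup>\<^bsub>P1\<^esub> a) = sg (p1 m \<omega>) \<leftharpoonup>\<^bsub>P2\<^esub> a"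
      using assms(1) by (intro EV_eqI)
        (simp_all add: NO.MN_ract(2) sg_closed ON.MN_act_closed ract_closed EV_sg Xa_act EV_act(3))
  qed
qed

lemma sg_inv_bimod_hom: "sg \<in> inv_bimod_hom A P1 P2"
proof -
  \<comment> \<open>The inverse of a bimodule map is linear: apply \<open>sg'\<close> to the
    linearity of \<open>sg\<close> at \<open>sg' t\<close>.\<close>
  have "sg' (a \<rightharpoonup>\<^bsub>P2\<^esub> t) = a \<rightharpoonup>\<^bsub>P1\<^esub> sg' t" "sg' (t \<leftharpoonup>\<^bsub>P2\<^esub> a) = sg' t \<leftharpoonup>\<^bsub>P1\<^esub> a"
    if "a \<in> carrier A" "t \<in> carrier P2" for a t
    using sg_linear[OF that(1) sg'_closed[OF that(2)]] sg_sg'[OF that(2)] that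
      sg'_sg[of "a \<rightharpoonup>\<^bsub>P1\<^esub> sg' t"] sg'_sg[of "sg' t \<leftharpoonup>\<^bsub>P1\<^esub> a"]
    by (simp_all add: NO.MN_act_closed sg'_closed)
  then have "sg' \<in> bimod_hom A P2 P1"
    using sg'_hom by (auto simp: bimod_hom_def lmod_hom_def rmod_hom_def sg'_def)
  moreover have "sg \<in> bimod_hom A P1 P2"
    using sg_hom sg_linear by (auto simp: bimod_hom_def lmod_hom_def rmod_hom_def sg_def)
  ultimately show ?thesis
    unfolding inv_bimod_hom_def using sg'_sg sg_sg' by (intro CollectI conjI bexI[of _ sg'] ballI)
qed

text \<open>Identifies a given bimodule map with the one built from operators; it is how both
  passages, from operators to \<sigma> and back, are seen to match.\<close>

lemma sg_eqI:
  assumes "\<tau> \<in> bimod_hom A P1 P2"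
    and "\<And>x m \<omega>. \<lbrakk>x \<in> carrier XX; m \<in> carrier N; \<omega> \<in> carrier \<Omega>\<rbrakk> \<Longrightarrow> EV x (\<tau> (p1 m \<omega>)) = Xa x \<omega> m"
  shows "sg = \<tau>"
proof (rule extensionalityI)
  show "sg \<in> extensional (carrier P1)" "\<tau> \<in> extensional (carrier P1)"
    using assms(1) by (auto simp: sg_def bimod_hom_def lmod_hom_def)
  have \<tau>: "\<tau> \<in> hom P1 P2"
    using assms(1) by (auto simp: bimod_hom_def lmod_hom_def)
  fix t assume "t \<in> carrier P1"
  then show "sg t = \<tau> t"
  proof (rule NO.MN_hom_eqI[OF ON.MN_group sg_hom \<tau>, rotated])
    fix m \<omega> assume "m \<in> carrier N" "\<omega> \<in> carrier \<Omega>"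
    then show "sg (p1 m \<omega>) = \<tau> (p1 m \<omega>)"
      by (intro EV_eqI) (simp_all add: EV_sg assms(2) sg_closed hom_in_carrier[OF \<tau>])
  qed
qed

end

section \<open>From an intertwining back to operators\<close>

context omega_pair begin

text \<open>The operators are read off from \<sigma> and its inverse by evaluation. Linearity of
  \<sigma> and of its inverse becomes the action laws, and their being mutually inverse becomes the
  two relations.\<close>

lemma intertwining_gen_module:
  assumes "\<sigma> \<in> inv_bimod_hom A P1 P2"
  obtains Xa Ya where "gen_module K A \<Omega> N Xa Ya" "gen_module.sg A \<Omega> N Xa = \<sigma>"
proof -
  have \<sigma>: "\<sigma> \<in> bimod_hom A P1 P2"
    and ex: "\<exists>\<tau>\<in>bimod_hom A P2 P1. (\<forall>t\<in>carrier P1. \<tau> (\<sigma> t) = t) \<and> (\<forall>t\<in>carrier P2. \<sigma> (\<tau> t) = t)"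
    using CollectD[OF assms[unfolded inv_bimod_hom_def]] by (rule conjunct1, rule conjunct2)
  from ex obtain \<tau> where \<tau>: "\<tau> \<in> bimod_hom A P2 P1"
    and inv: "(\<forall>t\<in>carrier P1. \<tau> (\<sigma> t) = t) \<and> (\<forall>t\<in>carrier P2. \<sigma> (\<tau> t) = t)"
    by (rule bexE)
  have \<tau>\<sigma>: "\<And>t. t \<in> carrier P1 \<Longrightarrow> \<tau> (\<sigma> t) = t" and \<sigma>\<tau>: "\<And>t. t \<in> carrier P2 \<Longrightarrow> \<sigma> (\<tau> t) = t"
    using inv by simp_all
  have \<sigma>h: "\<sigma> \<in> hom P1 P2" and \<tau>h: "\<tau> \<in> hom P2 P1"
    using \<sigma> \<tau> by (simp_all add: bimod_hom_def lmod_hom_def)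
  note \<sigma>c = hom_in_carrier[OF \<sigma>h] and \<tau>c = hom_in_carrier[OF \<tau>h]
  have \<sigma>l: "\<sigma> (p1 (a \<rightharpoonup>\<^bsub>N\<^esub> m) \<omega>) = a \<rightharpoonup>\<^bsub>P2\<^esub> \<sigma> (p1 m \<omega>)" "\<sigma> (p1 m (\<omega> \<leftharpoonup>\<^bsub>\<Omega>\<^esub> a)) = \<sigma> (p1 m \<omega>) \<leftharpoonup>\<^bsub>P2\<^esub> a"
    if "a \<in> carrier A" "m \<in> carrier N" "\<omega> \<in> carrier \<Omega>" for a m \<omega>
    using \<sigma> that by (auto simp: bimod_hom_def lmod_hom_def rmod_hom_def NO.MN_lact(2)[symmetric] NO.MN_ract(2)[symmetric])
  have \<tau>l: "\<tau> (p2 (a \<rightharpoonup>\<^bsub>\<Omega>\<^esub> \<omega>) m) = a \<rightharpoonup>\<^bsub>P1\<^esub> \<tau> (p2 \<omega> m)" "\<tau> (p2 \<omega> (m \<leftharpoonup>\<^bsub>N\<^esub> a)) = \<tau> (p2 \<omega> m) \<leftharpoonup>\<^bsub>P1\<^esub> a"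
    if "a \<in> carrier A" "m \<in> carrier N" "\<omega> \<in> carrier \<Omega>" for a m \<omega>
    using \<tau> that by (auto simp: bimod_hom_def lmod_hom_def rmod_hom_def ON.MN_lact(2)[symmetric] ON.MN_ract(2)[symmetric])
  define Xa where "Xa = (\<lambda>x \<omega> m. EV x (\<sigma> (p1 m \<omega>)))"
  define Ya where "Ya = (\<lambda>\<omega> y m. EV' y (\<tau> (p2 \<omega> m)))"
  have rel1: "(\<Otimes>\<^bsub>N\<^esub>i\<in>{..<cn}. Ya (cw i) y (Xa (cx i) \<omega> m)) = m \<leftharpoonup>\<^bsub>N\<^esub> y \<omega>"
    if "y \<in> carrier YY" "\<omega> \<in> carrier \<Omega>" "m \<in> carrier N" for y \<omega> m
  proof -
    \<comment> \<open>The dual basis expansion of \<open>\<sigma> (p1 m \<omega>)\<close> is mapped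
      by the inverse and then evaluated at \<open>y\<close>. Computed term by term this gives the
      sum of operators; computed without expanding, the inverse cancels \<sigma> and only
      \<open>EV' y (p1 m \<omega>)\<close> remains.\<close>
    have "EV' y (\<tau> (\<Otimes>\<^bsub>P2\<^esub>i\<in>{..<cn}. p2 (cw i) (EV (cx i) (\<sigma> (p1 m \<omega>)))))
      = (\<Otimes>\<^bsub>N\<^esub>i\<in>{..<cn}. Ya (cw i) y (Xa (cx i) \<omega> m))"
      unfolding Xa_def Ya_def
      by (rule hom_finprod_lessThan[OF ON.MN_comm_group N.M.comm_group_axioms hom_compose_lam[OF \<tau>h EV'_hom[OF that(1)]]])
        (use that in \<open>simp add: coev_closed EV_closed \<sigma>c\<close>)
    then show ?thesis
      using that by (simp add: EV_expand \<sigma>c \<tau>\<sigma> EV'_pure)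
  qed
  have rel2: "(\<Otimes>\<^bsub>N\<^esub>j\<in>{..<dn}. Xa x (dr j) (Ya \<omega> (dy j) m)) = x \<omega> \<rightharpoonup>\<^bsub>N\<^esub> m"
    if "x \<in> carrier XX" "\<omega> \<in> carrier \<Omega>" "m \<in> carrier N" for x \<omega> m
  proof -
    have "EV x (\<sigma> (\<Otimes>\<^bsub>P1\<^esub>j\<in>{..<dn}. p1 (EV' (dy j) (\<tau> (p2 \<omega> m))) (dr j)))
      = (\<Otimes>\<^bsub>N\<^esub>j\<in>{..<dn}. Xa x (dr j) (Ya \<omega> (dy j) m))"
      unfolding Xa_def Ya_def
      by (rule hom_finprod_lessThan[OF NO.MN_comm_group N.M.comm_group_axioms hom_compose_lam[OF \<sigma>h EV_hom[OF that(1)]]])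
        (use that in \<open>simp add: coev'_closed EV'_closed \<tau>c\<close>)
    then show ?thesis
      using that by (simp add: EV'_expand \<tau>c \<sigma>\<tau> EV_pure)
  qed
  have gm: "gen_module K A \<Omega> N Xa Ya"
  proof (intro gen_module.intro gen_module_axioms.intro omega_pair_axioms rel1 rel2, goal_cases)
    case (1 x \<omega>)
    then show ?case
      unfolding Xa_def[abs_def] by (intro hom_compose_lam[OF hom_compose_lam[OF NO.pa_hom_left \<sigma>h] EV_hom])
  next
    case (2 \<omega> m)
    then show ?case
      unfolding Xa_def by (intro EV_hom_left \<sigma>c NO.pa_closed)
  next
    case (3 x m)
    then show ?case
      unfolding Xa_def by (intro hom_compose_lam[OF hom_compose_lam[OF NO.pa_hom_right \<sigma>h] EV_hom])
  next
    case (4 \<omega> y)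
    then show ?case
      unfolding Ya_def[abs_def] by (intro hom_compose_lam[OF hom_compose_lam[OF ON.pa_hom_right \<tau>h] EV'_hom])
  next
    case (5 y m)
    then show ?case
      unfolding Ya_def by (intro hom_compose_lam[OF hom_compose_lam[OF ON.pa_hom_left \<tau>h] EV'_hom])
  next
    case (6 \<omega> m)
    then show ?case
      unfolding Ya_def by (intro EV'_hom_left \<tau>c ON.pa_closed)
  qed (auto simp: Xa_def Ya_def EV_act EV'_act \<sigma>c \<tau>c \<sigma>l \<tau>l NO.pa_balanced[symmetric] ON.pa_balanced)
  then have "gen_module.sg A \<Omega> N Xa = \<sigma>"
    by (rule gen_module.sg_eqI[OF _ \<sigma>]) (simp add: Xa_def)
  with gm show thesis by (rule that)
qed

end

text \<open>The maps induced by \<open>f\<close> on the tensor products commute with all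
  evaluations. Evaluating the intertwining condition therefore gives the conditions on operators,
  and the separation property of the evaluations leads back.\<close>

lemma intertwine_iff:
  assumes "gen_module K A \<Omega> M Xa Ya" "gen_module K A \<Omega> N Xb Yb" and f: "f \<in> bimod_hom A M N"
  shows "(\<forall>t\<in>carrier (tensA A M \<Omega>). gen_module.sg A \<Omega> N Xb (tensA_map A N \<Omega> f (\<lambda>\<omega>. \<omega>) t)
        = tensA_map A \<Omega> N (\<lambda>\<omega>. \<omega>) f (gen_module.sg A \<Omega> M Xa t))
    \<longleftrightarrow> (\<forall>x\<in>carrier (left_dual A \<Omega>). \<forall>\<omega>\<in>carrier \<Omega>. \<forall>m\<in>carrier M. f (Xa x \<omega> m) = Xb x \<omega> (f m))
      \<and> (\<forall>y\<in>carrier (right_dual A \<Omega>). \<forall>\<omega>\<in>carrier \<Omega>. \<forall>m\<in>carrier M. f (Ya \<omega> y m) = Yb \<omega> y (f m))"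
proof -
  interpret M: gen_module K A \<Omega> M Xa Ya by fact
  interpret N: gen_module K A \<Omega> N Xb Yb by fact
  have fh: "f \<in> hom M N"
    and fl: "\<And>a m. \<lbrakk>a \<in> carrier A; m \<in> carrier M\<rbrakk> \<Longrightarrow> f (a \<rightharpoonup>\<^bsub>M\<^esub> m) = a \<rightharpoonup>\<^bsub>N\<^esub> f m"
    and fr: "\<And>a m. \<lbrakk>a \<in> carrier A; m \<in> carrier M\<rbrakk> \<Longrightarrow> f (m \<leftharpoonup>\<^bsub>M\<^esub> a) = f m \<leftharpoonup>\<^bsub>N\<^esub> a"
    using f by (auto simp: bimod_hom_def lmod_hom_def rmod_hom_def)
  note fc = hom_in_carrier[OF fh]
  define f1 where "f1 = tensA_map A N \<Omega> f (\<lambda>\<omega>. \<omega>)"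
  define f2 where "f2 = tensA_map A \<Omega> N (\<lambda>\<omega>. \<omega>) f"
  have f1: "f1 \<in> hom M.P1 N.P1"
    and f1p: "\<And>m \<omega>. \<lbrakk>m \<in> carrier M; \<omega> \<in> carrier \<Omega>\<rbrakk> \<Longrightarrow> f1 (M.p1 m \<omega>) = N.p1 (f m) \<omega>"
  proof -
    have 1: "(\<lambda>\<omega>. N.p1 (f m) \<omega>) \<in> hom \<Omega> N.P1" if "m \<in> carrier M" for m
      by (rule N.NO.pa_hom_right[OF fc[OF that]])
    have 2: "(\<lambda>m. N.p1 (f m) \<omega>) \<in> hom M N.P1" if "\<omega> \<in> carrier \<Omega>" for \<omega>
      by (rule hom_compose_lam[OF fh N.NO.pa_hom_left[OF that]])
    have 3: "N.p1 (f (m \<leftharpoonup>\<^bsub>M\<^esub> a)) \<omega> = N.p1 (f m) (a \<rightharpoonup>\<^bsub>\<Omega>\<^esub> \<omega>)"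
      if "m \<in> carrier M" "a \<in> carrier A" "\<omega> \<in> carrier \<Omega>" for m a \<omega>
      using that by (simp add: fr fc N.NO.pa_balanced)
    note e = M.NO.MN_ext[OF N.NO.MN_comm_group 1 2 3]
    show "f1 \<in> hom M.P1 N.P1" "\<And>m \<omega>. \<lbrakk>m \<in> carrier M; \<omega> \<in> carrier \<Omega>\<rbrakk> \<Longrightarrow> f1 (M.p1 m \<omega>) = N.p1 (f m) \<omega>"
      unfolding f1_def tensA_map_def by (rule e; assumption)+
  qed
  have f2: "f2 \<in> hom M.P2 N.P2"
    and f2p: "\<And>m \<omega>. \<lbrakk>\<omega> \<in> carrier \<Omega>; m \<in> carrier M\<rbrakk> \<Longrightarrow> f2 (M.p2 \<omega> m) = N.p2 \<omega> (f m)"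
  proof -
    have 1: "(\<lambda>m. N.p2 \<omega> (f m)) \<in> hom M N.P2" if "\<omega> \<in> carrier \<Omega>" for \<omega>
      by (rule hom_compose_lam[OF fh N.ON.pa_hom_right[OF that]])
    have 2: "(\<lambda>\<omega>. N.p2 \<omega> (f m)) \<in> hom \<Omega> N.P2" if "m \<in> carrier M" for m
      by (rule N.ON.pa_hom_left[OF fc[OF that]])
    have 3: "N.p2 (\<omega> \<leftharpoonup>\<^bsub>\<Omega>\<^esub> a) (f m) = N.p2 \<omega> (f (a \<rightharpoonup>\<^bsub>M\<^esub> m))"
      if "\<omega> \<in> carrier \<Omega>" "a \<in> carrier A" "m \<in> carrier M" for m a \<omega>
      using that by (simp add: fl fc N.ON.pa_balanced)
    note e = M.ON.MN_ext[OF N.ON.MN_comm_group 1 2 3]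
    show "f2 \<in> hom M.P2 N.P2" "\<And>m \<omega>. \<lbrakk>\<omega> \<in> carrier \<Omega>; m \<in> carrier M\<rbrakk> \<Longrightarrow> f2 (M.p2 \<omega> m) = N.p2 \<omega> (f m)"
      unfolding f2_def tensA_map_def by (rule e; assumption)+
  qed
  note f1c = hom_in_carrier[OF f1] and f2c = hom_in_carrier[OF f2]
  \<comment> \<open>Naturality of evaluation in the module, which uses the left linearity of
    \<open>f\<close>; its counterpart \<open>EV'f\<close> uses right linearity.\<close>
  have EVf: "N.EV x (f2 t) = f (M.EV x t)" if "x \<in> carrier M.XX" "t \<in> carrier M.P2" for x t
    by (rule M.ON.MN_hom_eqI[OF N.N.M.is_group hom_compose_lam[OF f2 N.EV_hom[OF that(1)]]
          hom_compose_lam[OF M.EV_hom[OF that(1)] fh] _ that(2)])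
      (use that in \<open>simp add: f2p N.EV_pure M.EV_pure fc fl M.dual_closed\<close>)
  have EV'f: "N.EV' y (f1 t) = f (M.EV' y t)" if "y \<in> carrier M.YY" "t \<in> carrier M.P1" for y t
    by (rule M.NO.MN_hom_eqI[OF N.N.M.is_group hom_compose_lam[OF f1 N.EV'_hom[OF that(1)]]
          hom_compose_lam[OF M.EV'_hom[OF that(1)] fh] _ that(2)])
      (use that in \<open>simp add: f1p N.EV'_pure M.EV'_pure fc fr M.dual_closed\<close>)
  have "(\<forall>t\<in>carrier M.P1. N.sg (f1 t) = f2 (M.sg t))
    \<longleftrightarrow> (\<forall>x\<in>carrier M.XX. \<forall>\<omega>\<in>carrier \<Omega>. \<forall>m\<in>carrier M. f (Xa x \<omega> m) = Xb x \<omega> (f m))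
      \<and> (\<forall>y\<in>carrier M.YY. \<forall>\<omega>\<in>carrier \<Omega>. \<forall>m\<in>carrier M. f (Ya \<omega> y m) = Yb \<omega> y (f m))"
    (is "?L \<longleftrightarrow> ?X \<and> ?Y")
  proof
    assume L: ?L
    have X: "f (Xa x \<omega> m) = Xb x \<omega> (f m)" if "x \<in> carrier M.XX" "\<omega> \<in> carrier \<Omega>" "m \<in> carrier M" for x \<omega> m
    proof -
      have "N.EV x (N.sg (f1 (M.p1 m \<omega>))) = N.EV x (f2 (M.sg (M.p1 m \<omega>)))"
        using L that by simp
      then show ?thesis
        using that by (simp add: f1p N.EV_sg fc EVf M.sg_closed M.EV_sg)
    qed
    \<comment> \<open>The operators \<open>Ya\<close> are evaluations of the inverse, so the
      intertwining condition is first turned into one for the inverses.\<close>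
    have L': "N.sg' (f2 u) = f1 (M.sg' u)" if "u \<in> carrier M.P2" for u
    proof -
      have "N.sg (f1 (M.sg' u)) = f2 u"
        using L that by (simp add: M.sg'_closed M.sg_sg')
      then show ?thesis
        using that by (metis N.sg'_sg M.sg'_closed f1c)
    qed
    have Y: "f (Ya \<omega> y m) = Yb \<omega> y (f m)" if "y \<in> carrier M.YY" "\<omega> \<in> carrier \<Omega>" "m \<in> carrier M" for y \<omega> m
    proof -
      have "N.EV' y (N.sg' (f2 (M.p2 \<omega> m))) = N.EV' y (f1 (M.sg' (M.p2 \<omega> m)))"
        using L' that by simp
      then show ?thesis
        using that by (simp add: f2p N.EV'_sg' fc EV'f M.sg'_closed M.EV'_sg')
    qed
    from X Y show "?X \<and> ?Y" by blast
  next
    assume "?X \<and> ?Y"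
    then have X: ?X ..
    show ?L
    proof
      fix t assume "t \<in> carrier M.P1"
      then show "N.sg (f1 t) = f2 (M.sg t)"
      proof (rule M.NO.MN_hom_eqI[OF N.ON.MN_group hom_compose_lam[OF f1 N.sg_hom] hom_compose_lam[OF M.sg_hom f2], rotated])
        fix m \<omega> assume "m \<in> carrier M" "\<omega> \<in> carrier \<Omega>"
        then show "N.sg (f1 (M.p1 m \<omega>)) = f2 (M.sg (M.p1 m \<omega>))"
          using X by (intro N.EV_eqI) (simp_all add: f1p fc f1c f2c N.sg_closed M.sg_closed N.EV_sg EVf M.EV_sg)
      qed
    qed
  qed
  then show ?thesis
    unfolding f1_def f2_def .
qed


section \<open>Modules over \<open>IB(\<Omega>)\<close>\<close>

text \<open>A ring homomorphism into this ring is a module structure on \<open>G\<close>. Its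
  elements are extensional so that operators agreeing on \<open>G\<close> are equal and the ring
  laws hold as equations.\<close>

definition end_ring :: "('m, 'x) monoid_scheme \<Rightarrow> ('m \<Rightarrow> 'm) ring" where
  "end_ring G = \<lparr>carrier = hom G G \<inter> extensional (carrier G), monoid.mult = compose (carrier G),
     one = (\<lambda>m\<in>carrier G. m), ring.zero = (\<lambda>m\<in>carrier G. \<one>\<^bsub>G\<^esub>),
     ring.add = (\<lambda>f g. \<lambda>m\<in>carrier G. f m \<otimes>\<^bsub>G\<^esub> g m)\<rparr>"

lemma end_ring_simps [simp]:
  "carrier (end_ring G) = hom G G \<inter> extensional (carrier G)"
  "m \<in> carrier G \<Longrightarrow> (f \<otimes>\<^bsub>end_ring G\<^esub> g) m = f (g m)"
  "m \<in> carrier G \<Longrightarrow> \<one>\<^bsub>end_ring G\<^esub> m = m"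
  "m \<in> carrier G \<Longrightarrow> \<zero>\<^bsub>end_ring G\<^esub> m = \<one>\<^bsub>G\<^esub>"
  "m \<in> carrier G \<Longrightarrow> (f \<oplus>\<^bsub>end_ring G\<^esub> g) m = f m \<otimes>\<^bsub>G\<^esub> g m"
  by (simp_all add: end_ring_def compose_def)

lemma end_ring_eqI:
  "\<lbrakk>f \<in> carrier (end_ring G); g \<in> carrier (end_ring G); \<And>m. m \<in> carrier G \<Longrightarrow> f m = g m\<rbrakk> \<Longrightarrow> f = g"
  by (auto intro: extensionalityI[of f "carrier G"])

lemma restrict_end_ring:
  assumes "comm_group G" "f \<in> hom G G"
  shows "restrict f (carrier G) \<in> carrier (end_ring G)"
proof -
  interpret comm_group G by fact
  show ?thesis
    using assms(2) by (auto simp: hom_def Pi_iff)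
qed

lemma end_ring_closed:
  assumes "comm_group G" "f \<in> carrier (end_ring G)" "g \<in> carrier (end_ring G)"
  shows "f \<otimes>\<^bsub>end_ring G\<^esub> g \<in> carrier (end_ring G)" "f \<oplus>\<^bsub>end_ring G\<^esub> g \<in> carrier (end_ring G)"
proof -
  have fg: "f \<in> hom G G" "g \<in> hom G G"
    using assms by auto
  show "f \<otimes>\<^bsub>end_ring G\<^esub> g \<in> carrier (end_ring G)"
    using restrict_end_ring[OF assms(1) hom_compose_lam[OF fg(2,1)]] by (simp add: end_ring_def compose_def)
  show "f \<oplus>\<^bsub>end_ring G\<^esub> g \<in> carrier (end_ring G)"
    using restrict_end_ring[OF assms(1) hom_pointwise_mult[OF assms(1) fg]] by (simp add: end_ring_def)
qed

lemma end_ring_consts_closed: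
  assumes "comm_group G"
  shows "\<one>\<^bsub>end_ring G\<^esub> \<in> carrier (end_ring G)" "\<zero>\<^bsub>end_ring G\<^esub> \<in> carrier (end_ring G)"
proof -
  interpret comm_group G by fact
  show "\<one>\<^bsub>end_ring G\<^esub> \<in> carrier (end_ring G)"
    using restrict_end_ring[OF assms(1), of "\<lambda>m. m"] by (simp add: end_ring_def hom_def)
  show "\<zero>\<^bsub>end_ring G\<^esub> \<in> carrier (end_ring G)"
    using restrict_end_ring[OF assms(1) const_one_hom] by (simp add: end_ring_def)
qed

lemma end_ring_ring:
  assumes "comm_group G" shows "ring (end_ring G)"
proof -
  interpret comm_group G by fact
  note cl = end_ring_closed[OF assms] end_ring_consts_closed[OF assms]
  have app: "f m \<in> carrier G" "n \<in> carrier G \<Longrightarrow> f (m \<otimes>\<^bsub>G\<^esub> n) = f m \<otimes>\<^bsub>G\<^esub> f n"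
    if "f \<in> carrier (end_ring G)" "m \<in> carrier G" for f m n
    using that by (auto simp: hom_def)
  show ?thesis
  proof (rule ringI)
    show "abelian_group (end_ring G)"
    proof (rule abelian_groupI)
      fix f assume f: "f \<in> carrier (end_ring G)"
      have c: "restrict (\<lambda>m. inv\<^bsub>G\<^esub> f m) (carrier G) \<in> carrier (end_ring G)"
        using f by (intro restrict_end_ring[OF assms] hom_pointwise_inv[OF assms]) simp
      have "restrict (\<lambda>m. inv\<^bsub>G\<^esub> f m) (carrier G) \<oplus>\<^bsub>end_ring G\<^esub> f = \<zero>\<^bsub>end_ring G\<^esub>"
        using app(1)[OF f] by (intro end_ring_eqI[OF cl(2)[OF c f] cl(4)]) simp
      with c show "\<exists>g\<in>carrier (end_ring G). g \<oplus>\<^bsub>end_ring G\<^esub> f = \<zero>\<^bsub>end_ring G\<^esub>"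
        by blast
    qed (use cl app in \<open>auto intro!: end_ring_eqI[where G = G] simp: m_ac simp del: end_ring_simps(1)\<close>)
    show "monoid (end_ring G)"
      by (rule monoidI) (use cl app in \<open>auto intro!: end_ring_eqI[where G = G] simp del: end_ring_simps(1)\<close>)
  qed (use cl app in \<open>auto intro!: end_ring_eqI[where G = G] simp del: end_ring_simps(1)\<close>)
qed

lemma end_ring_eval_hom: "m \<in> carrier G \<Longrightarrow> (\<lambda>f. f m) \<in> hom (add_monoid (end_ring G)) G"
  by (rule homI) (auto simp: hom_def)

lemma (in ring) minus_eq_zero_iff:
  assumes "x \<in> carrier R" "y \<in> carrier R"
  shows "x \<ominus> y = \<zero> \<longleftrightarrow> x = y"
proof
  have "x = (x \<ominus> y) \<oplus> y"
    using assms by (simp add: a_minus_def a_assoc l_neg)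
  then show "x \<ominus> y = \<zero> \<Longrightarrow> x = y"
    using assms by simp
qed (use assms in \<open>simp add: a_minus_def r_neg\<close>)

section \<open>The quotient algebra and the structure carried by its modules\<close>

context fgp_bimodule begin

abbreviation "II \<equiv> Idl\<^bsub>TT\<^esub> IB_rels K A \<Omega>"
abbreviation "cl t \<equiv> II +>\<^bsub>TT\<^esub> t"
abbreviation "bel \<equiv> base_el K A \<Omega>"
abbreviation "bba \<equiv> base_bar K A \<Omega>"
abbreviation "gX \<equiv> gen_X K A \<Omega>"
abbreviation "gY \<equiv> gen_Y K A \<Omega>"

sublocale TR: rep_data K A \<Omega> TT bel bba gX gY
  by (rule TT_rep_data)

definition "rel1 y \<omega> = (\<Oplus>\<^bsub>TT\<^esub>i\<in>{..<cn}. gY (cw i) y \<otimes>\<^bsub>TT\<^esub> gX (cx i) \<omega>)"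
definition "rel2 x \<omega> = (\<Oplus>\<^bsub>TT\<^esub>j\<in>{..<dn}. gX x (dr j) \<otimes>\<^bsub>TT\<^esub> gY \<omega> (dy j))"

lemma IB_rels_eq:
  "IB_rels K A \<Omega> = {rel1 y \<omega> \<ominus>\<^bsub>TT\<^esub> bba (y \<omega>) | y \<omega>. y \<in> carrier YY \<and> \<omega> \<in> carrier \<Omega>}
    \<union> {rel2 x \<omega> \<ominus>\<^bsub>TT\<^esub> bel (x \<omega>) | x \<omega>. x \<in> carrier XX \<and> \<omega> \<in> carrier \<Omega>}"
  unfolding IB_rels_def rel1_def rel2_def cn_def dn_def cw_def cx_def dy_def dr_def ..

lemma rel_closed:
  "\<lbrakk>y \<in> carrier YY; \<omega> \<in> carrier \<Omega>\<rbrakk> \<Longrightarrow> rel1 y \<omega> \<in> carrier TT"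
  "\<lbrakk>x \<in> carrier XX; \<omega> \<in> carrier \<Omega>\<rbrakk> \<Longrightarrow> rel2 x \<omega> \<in> carrier TT"
  unfolding rel1_def rel2_def by (intro TT.finsum_closed; auto simp: coev_closed coev'_closed)+

lemma IB_rels_closed: "IB_rels K A \<Omega> \<subseteq> carrier TT"
  unfolding IB_rels_eq by (auto simp: rel_closed dual_closed)

lemma II_ideal: "ideal II TT"
  by (rule TT.genideal_ideal[OF IB_rels_closed])

lemma IB_ring: "ring (IB K A \<Omega>)"
  unfolding IB_def by (rule ideal.quotient_is_ring[OF II_ideal])

lemma cl_hom: "cl \<in> ring_hom TT (IB K A \<Omega>)"
  unfolding IB_def by (rule ideal.rcos_ring_hom[OF II_ideal])

lemma IB_carrier: "carrier (IB K A \<Omega>) = cl ` carrier TT"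
  by (auto simp: IB_def FactRing_def A_RCOSETS_def' )

lemma cl_eq_iff: "\<lbrakk>s \<in> carrier TT; t \<in> carrier TT\<rbrakk> \<Longrightarrow> cl s = cl t \<longleftrightarrow> s \<ominus>\<^bsub>TT\<^esub> t \<in> II"
  using TT.quotient_eq_iff_same_a_r_cos[OF II_ideal] by simp

lemma cl_rels:
  "\<lbrakk>y \<in> carrier YY; \<omega> \<in> carrier \<Omega>\<rbrakk> \<Longrightarrow> cl (rel1 y \<omega>) = cl (bba (y \<omega>))"
  "\<lbrakk>x \<in> carrier XX; \<omega> \<in> carrier \<Omega>\<rbrakk> \<Longrightarrow> cl (rel2 x \<omega>) = cl (bel (x \<omega>))"
proof -
  have self: "r \<in> IB_rels K A \<Omega> \<Longrightarrow> r \<in> II" for r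
    using TT.genideal_self[OF IB_rels_closed] by (rule subsetD)
  show "cl (rel1 y \<omega>) = cl (bba (y \<omega>))" if "y \<in> carrier YY" "\<omega> \<in> carrier \<Omega>" for y \<omega>
  proof -
    have "rel1 y \<omega> \<ominus>\<^bsub>TT\<^esub> bba (y \<omega>) \<in> II"
      using that by (intro self) (unfold IB_rels_eq, blast)
    then show ?thesis
      using that by (simp add: cl_eq_iff rel_closed dual_closed)
  qed
  show "cl (rel2 x \<omega>) = cl (bel (x \<omega>))" if "x \<in> carrier XX" "\<omega> \<in> carrier \<Omega>" for x \<omega>
  proof -
    have "rel2 x \<omega> \<ominus>\<^bsub>TT\<^esub> bel (x \<omega>) \<in> II"
      using that by (intro self) (unfold IB_rels_eq, blast)
    then show ?thesis
      using that by (simp add: cl_eq_iff rel_closed dual_closed)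
  qed
qed

text \<open>The module structure pulled back to the tensor algebra, so that calculations use
  representatives instead of cosets.\<close>

definition act :: "(('a, 'w) tz set, 'm, 'q) lmod_scheme \<Rightarrow> ('a, 'w) tz \<Rightarrow> 'm \<Rightarrow> 'm" where
  "act N t m = cl t \<rightharpoonup>\<^bsub>N\<^esub> m"

text \<open>The right action of \<open>a\<close> is the left action of its bar, which reverses
  products as a right action should. The value \<open>undefined\<close> off the carriers is what
  \<open>ext_bimod\<close> prescribes for objects.\<close>

definition under :: "(('a, 'w) tz set, 'm, 'q) lmod_scheme \<Rightarrow> ('a, 'a, 'm) bimod" where
  "under N = bimod_on N
     (\<lambda>a m. if a \<in> carrier A \<and> m \<in> carrier N then act N (bel a) m else undefined)
     (\<lambda>m a. if a \<in> carrier A \<and> m \<in> carrier N then act N (bba a) m else undefined)"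

lemma under_simps [simp]:
  "carrier (under N) = carrier N" "monoid.mult (under N) = monoid.mult N" "one (under N) = one N"
  "\<lbrakk>a \<in> carrier A; m \<in> carrier N\<rbrakk> \<Longrightarrow> a \<rightharpoonup>\<^bsub>under N\<^esub> m = act N (bel a) m"
  "\<lbrakk>a \<in> carrier A; m \<in> carrier N\<rbrakk> \<Longrightarrow> m \<leftharpoonup>\<^bsub>under N\<^esub> a = act N (bba a) m"
  by (simp_all add: under_def)

lemma hom_under: "hom (under N) G = hom N G" "hom G (under N) = hom G N"
  by (rule hom_eq_carrier_mult; simp)+

context
  fixes N :: "(('a, 'w) tz set, 'm, 'q) lmod_scheme"
  assumes N: "left_mod (IB K A \<Omega>) N"
begin

interpretation N: left_mod "IB K A \<Omega>" N by (rule N)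

lemma act_simps:
  assumes "s \<in> carrier TT" "m \<in> carrier N"
  shows "act N s m \<in> carrier N"
    and "t \<in> carrier TT \<Longrightarrow> act N (s \<otimes>\<^bsub>TT\<^esub> t) m = act N s (act N t m)"
    and "t \<in> carrier TT \<Longrightarrow> act N (s \<oplus>\<^bsub>TT\<^esub> t) m = act N s m \<otimes>\<^bsub>N\<^esub> act N t m"
    and "n \<in> carrier N \<Longrightarrow> act N s (m \<otimes>\<^bsub>N\<^esub> n) = act N s m \<otimes>\<^bsub>N\<^esub> act N s n"
  using assms
  by (simp_all add: act_def ring_hom_closed[OF cl_hom] ring_hom_mult[OF cl_hom] ring_hom_add[OF cl_hom] ring_hom_one[OF cl_hom]
      N.lact_closed N.lact_add N.add_lact N.mult_lact N.one_lact)

lemma act_one: "m \<in> carrier N \<Longrightarrow> act N \<one>\<^bsub>TT\<^esub> m = m"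
  by (simp add: act_def ring_hom_one[OF cl_hom] N.one_lact)

lemma act_hom: "s \<in> carrier TT \<Longrightarrow> act N s \<in> hom N N"
  and act_hom_left: "m \<in> carrier N \<Longrightarrow> (\<lambda>s. act N s m) \<in> hom (add_monoid TT) N"
  by (auto intro!: homI simp: act_simps)

lemma act_minus:
  assumes "s \<in> carrier TT" "t \<in> carrier TT" "m \<in> carrier N"
  shows "act N (s \<ominus>\<^bsub>TT\<^esub> t) m = act N s m \<otimes>\<^bsub>N\<^esub> inv\<^bsub>N\<^esub> act N t m"
proof -
  have "(s \<ominus>\<^bsub>TT\<^esub> t) \<oplus>\<^bsub>TT\<^esub> t = s"
    using assms by (simp add: a_minus_def TT.a_assoc TT.l_neg)
  then show ?thesis
    using assms act_simps(3)[of "s \<ominus>\<^bsub>TT\<^esub> t" m t] by (simp add: N.M.inv_solve_right act_simps)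
qed

lemma act_finsum:
  fixes n :: nat
  assumes "m \<in> carrier N" "\<And>i. i < n \<Longrightarrow> f i \<in> carrier TT"
  shows "act N (\<Oplus>\<^bsub>TT\<^esub>i\<in>{..<n}. f i) m = (\<Otimes>\<^bsub>N\<^esub>i\<in>{..<n}. act N (f i) m)"
  unfolding finsum_def
  by (rule hom_finprod_lessThan[OF TT.a_comm_group N.M.comm_group_axioms act_hom_left[OF assms(1)]])
    (use assms in simp)

lemma under_bimodule: "bimodule K A (under N)"
proof -
  have cg: "comm_group (under N)"
    by (rule comm_group_cong[OF _ _ _ N.M.comm_group_axioms]) simp_all
  note a = act_simps act_one
  note h = hom_mult[OF TR.e_hom, simplified] hom_mult[OF TR.eb_hom, simplified]
  show ?thesis
  proof (intro bimodule.intro bimodule_axioms.intro left_mod.intro left_mod_axioms.intro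
      k_algebra_axioms A.ring_axioms cg, goal_cases)
    \<comment> \<open>This goal is the commuting of the left and right actions; it holds because an
      element of \<open>A\<close> and a bar element commute in \<open>A^e\<close>.\<close>
    case (11 m a b)
    then have "act N (bba b \<otimes>\<^bsub>TT\<^esub> bel a) m = act N (bel a \<otimes>\<^bsub>TT\<^esub> bba b) m"
      by (simp add: TR.e_eb)
    with 11 show ?case
      by (simp add: a)
  qed (auto simp: a h TR.e_mult TR.eb_mult TR.e_one TR.eb_one TR.e_kone)
qed

text \<open>The action laws are inherited from the relations between generators in
  \<open>TT\<close>. The relations \<open>YX_rel\<close> and \<open>XY_rel\<close> hold because
  \<open>cl_rels\<close> identifies the two sides of the defining relations in the quotient.\<close>

lemma under_gen_module: "gen_module K A \<Omega> (under N) (\<lambda>x \<omega>. act N (gX x \<omega>)) (\<lambda>\<omega> y. act N (gY \<omega> y))"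
proof -
  interpret U: bimodule K A "under N" by (rule under_bimodule)
  interpret O: omega_pair K A \<Omega> "under N" ..
  \<comment> \<open>\<open>finprod\<close> takes the whole record as its argument, so the products
    over \<open>N\<close> and over \<open>under N\<close> are matched by induction.\<close>
  have fp: "finprod (under N) f {..<n} = finprod N f {..<n}" if "\<And>i. i < n \<Longrightarrow> f i \<in> carrier N" for f and n :: nat
    using that
  proof (induction n)
    case (Suc n)
    then show ?case
      unfolding lessThan_Suc
      by (subst U.M.finprod_insert, simp, simp, force, force, subst N.M.finprod_insert) (auto simp: less_Suc_eq)
  qed simp
  note a = act_simps act_one
  show ?thesis
  proof (intro gen_module.intro gen_module_axioms.intro O.omega_pair_axioms, goal_cases)
    case (1 x \<omega>)
    then show ?case by (simp add: hom_under act_hom)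
  next
    case (2 \<omega> m)
    then show ?case
      using hom_compose_lam[OF TR.gX_hom_left act_hom_left] by (simp add: hom_under)
  next
    case (3 x m)
    then show ?case
      using hom_compose_lam[OF TR.gX_hom_right act_hom_left] by (simp add: hom_under)
  next
    case (4 x \<omega>)
    then show ?case by (simp add: hom_under act_hom)
  next
    case (5 \<omega> m)
    then show ?case
      using hom_compose_lam[OF TR.gY_hom_left act_hom_left] by (simp add: hom_under)
  next
    case (6 x m)
    then show ?case
      using hom_compose_lam[OF TR.gY_hom_right act_hom_left] by (simp add: hom_under)
  next
    case (15 y \<omega> m)
    then have "(\<Otimes>\<^bsub>N\<^esub>i\<in>{..<cn}. act N (gY (cw i) y) (act N (gX (cx i) \<omega>) m)) = act N (rel1 y \<omega>) m"
      unfolding rel1_def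
      by (subst act_finsum) (auto simp: coev_closed a intro!: N.M.finprod_cong')
    also have "\<dots> = act N (bba (y \<omega>)) m"
      using 15 by (simp add: act_def cl_rels)
    finally show ?case
      using 15 by (subst fp) (simp_all add: coev_closed a dual_closed)
  next
    case (16 x \<omega> m)
    then have "(\<Otimes>\<^bsub>N\<^esub>j\<in>{..<dn}. act N (gX x (dr j)) (act N (gY \<omega> (dy j)) m)) = act N (rel2 x \<omega>) m"
      unfolding rel2_def
      by (subst act_finsum) (auto simp: coev'_closed a intro!: N.M.finprod_cong')
    also have "\<dots> = act N (bel (x \<omega>)) m"
      using 16 by (simp add: act_def cl_rels)
    finally show ?case
      using 16 by (subst fp) (simp_all add: coev'_closed a dual_closed)
  qed (simp_all add: TR.gX_act TR.gY_act a)
qed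

end

end

section \<open>From operators to a module over \<open>IB\<close>\<close>

context gen_module begin

text \<open>The operators represent the generators in the endomorphism ring of \<open>N\<close>, and
  the universal property extends them to a ring homomorphism \<open>h\<close> on \<open>TT\<close>.
  The two relations put the defining ideal into the kernel of \<open>h\<close>, so \<open>h\<close>
  descends to an action of the quotient.\<close>

lemma exists_IB_module:
  assumes ext: "ext_bimod A N"
  shows "\<exists>N' :: (('a, 'w) tz set, 'm) lmod. left_mod (IB K A \<Omega>) N' \<and> ext_lmod (IB K A \<Omega>) N'
    \<and> carrier N' = carrier N \<and> monoid.mult N' = monoid.mult N \<and> one N' = one N
    \<and> (\<forall>a\<in>carrier A. \<forall>m\<in>carrier N. act N' (bel a) m = a \<rightharpoonup>\<^bsub>N\<^esub> m \<and> act N' (bba a) m = m \<leftharpoonup>\<^bsub>N\<^esub> a)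
    \<and> (\<forall>x\<in>carrier XX. \<forall>\<omega>\<in>carrier \<Omega>. \<forall>m\<in>carrier N. act N' (gX x \<omega>) m = Xa x \<omega> m)
    \<and> (\<forall>\<omega>\<in>carrier \<Omega>. \<forall>y\<in>carrier YY. \<forall>m\<in>carrier N. act N' (gY \<omega> y) m = Ya \<omega> y m)"
proof -
  note cg = N.M.comm_group_axioms
  let ?E = "end_ring N"
  let ?C = "carrier N"
  interpret E: ring ?E by (rule end_ring_ring[OF cg])
  note ecl = end_ring_closed[OF cg] end_ring_consts_closed[OF cg]
  note del = end_ring_simps(1)
  define e where "e a = restrict (lact N a) ?C" for a
  define eb where "eb a = restrict (\<lambda>m. m \<leftharpoonup>\<^bsub>N\<^esub> a) ?C" for a
  define hX where "hX x \<omega> = restrict (Xa x \<omega>) ?C" for x \<omega>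
  define hY where "hY \<omega> y = restrict (Ya \<omega> y) ?C" for \<omega> y
  have c: "a \<in> carrier A \<Longrightarrow> e a \<in> carrier ?E" "a \<in> carrier A \<Longrightarrow> eb a \<in> carrier ?E"
    "\<lbrakk>x \<in> carrier XX; \<omega> \<in> carrier \<Omega>\<rbrakk> \<Longrightarrow> hX x \<omega> \<in> carrier ?E"
    "\<lbrakk>\<omega> \<in> carrier \<Omega>; y \<in> carrier YY\<rbrakk> \<Longrightarrow> hY \<omega> y \<in> carrier ?E" for a x \<omega> y
    unfolding e_def eb_def hX_def hY_def
    by (intro restrict_end_ring[OF cg] N.lact_hom N.ract_hom Xa_hom Ya_hom; assumption)+
  have app: "m \<in> ?C \<Longrightarrow> e a m = a \<rightharpoonup>\<^bsub>N\<^esub> m" "m \<in> ?C \<Longrightarrow> eb a m = m \<leftharpoonup>\<^bsub>N\<^esub> a"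
    "m \<in> ?C \<Longrightarrow> hX x \<omega> m = Xa x \<omega> m" "m \<in> ?C \<Longrightarrow> hY \<omega> y m = Ya \<omega> y m" for a x \<omega> y m
    by (simp_all add: e_def eb_def hX_def hY_def)
  have homE: "\<phi> \<in> hom H (add_monoid ?E)"
    if "\<And>s. s \<in> carrier H \<Longrightarrow> \<phi> s \<in> carrier ?E"
      and "\<And>m s t. \<lbrakk>m \<in> ?C; s \<in> carrier H; t \<in> carrier H\<rbrakk> \<Longrightarrow> \<phi> (s \<otimes>\<^bsub>H\<^esub> t) m = \<phi> s m \<otimes>\<^bsub>N\<^esub> \<phi> t m"
      and "\<And>s t. \<lbrakk>s \<in> carrier H; t \<in> carrier H\<rbrakk> \<Longrightarrow> s \<otimes>\<^bsub>H\<^esub> t \<in> carrier H"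
    for \<phi> and H :: "('h, 'r) monoid_scheme"
  proof (rule homI)
    fix s t assume st: "s \<in> carrier H" "t \<in> carrier H"
    have "\<phi> (s \<otimes>\<^bsub>H\<^esub> t) = \<phi> s \<oplus>\<^bsub>?E\<^esub> \<phi> t"
      using st that by (intro end_ring_eqI[where G = N] ecl) (simp_all del: del)
    then show "\<phi> (s \<otimes>\<^bsub>H\<^esub> t) = \<phi> s \<otimes>\<^bsub>add_monoid ?E\<^esub> \<phi> t" by simp
  qed (use that in \<open>simp del: del\<close>)
  interpret R: rep_data K A \<Omega> ?E e eb hX hY
  proof (intro rep_data.intro rep_data_axioms.intro fgp_bimodule_axioms E.ring_axioms, goal_cases)
    case 1 show ?case by (rule homE) (simp_all add: c app N.add_lact del: del)
  next
    case 2 show ?case by (rule homE) (simp_all add: c app N.ract_add del: del)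
  next
    case (9 \<omega>) then show ?case
      using hom_mult[OF Xa_hom(2)] by (intro homE) (simp_all add: c app del: del)
  next
    case (10 x) then show ?case
      using hom_mult[OF Xa_hom(3)] by (intro homE) (simp_all add: c app del: del)
  next
    case (15 y) then show ?case
      using hom_mult[OF Ya_hom(2)] by (intro homE) (simp_all add: c app del: del)
  next
    case (16 \<omega>) then show ?case
      using hom_mult[OF Ya_hom(3)] by (intro homE) (simp_all add: c app del: del)
  qed (auto intro!: end_ring_eqI[where G = N] ecl c simp: app N.lact_closed N.ract_closed N.mult_lact N.ract_mult N.one_lact
      N.ract_one N.lact_ract N.K_central X.lact_closed X.ract_closed Y.lact_closed Y.ract_closed lact_closed ract_closed
      Xa_act Ya_act Xa_closed Ya_closed simp del: del)
  obtain h where h: "h \<in> ring_hom TT ?E"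
    and hb: "\<And>a. a \<in> carrier A \<Longrightarrow> h (bel a) = e a" "\<And>a. a \<in> carrier A \<Longrightarrow> h (bba a) = eb a"
    and hx: "\<And>x \<omega>. \<lbrakk>x \<in> carrier XX; \<omega> \<in> carrier \<Omega>\<rbrakk> \<Longrightarrow> h (gX x \<omega>) = hX x \<omega>"
    and hy: "\<And>\<omega> y. \<lbrakk>\<omega> \<in> carrier \<Omega>; y \<in> carrier YY\<rbrakk> \<Longrightarrow> h (gY \<omega> y) = hY \<omega> y"
    using R.TT_universal by blast
  interpret h: ring_hom_ring TT ?E h
    by (rule ring_hom_ringI2[OF TT_ring E.ring_axioms h])
  have hc: "h t \<in> carrier ?E" if "t \<in> carrier TT" for t
    using h that by (rule ring_hom_closed)
  have hev: "(\<lambda>t. h t m) \<in> hom (add_monoid TT) N" if "m \<in> ?C" for m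
  proof (rule hom_compose_lam[OF _ end_ring_eval_hom[OF that]])
    show "h \<in> hom (add_monoid TT) (add_monoid ?E)"
      using hc ring_hom_add[OF h] by (intro homI) (simp_all del: del)
  qed
  \<comment> \<open>Evaluation at \<open>m\<close> is additive, so it turns the sum in the
    endomorphism ring into a product in \<open>N\<close>; the equation is then
    \<open>YX_rel\<close>.\<close>
  have r1: "h (rel1 y \<omega>) = h (bba (y \<omega>))" if "y \<in> carrier YY" "\<omega> \<in> carrier \<Omega>" for y \<omega>
  proof (rule end_ring_eqI[OF hc hc])
    fix m assume m: "m \<in> ?C"
    have "h (rel1 y \<omega>) m = (\<Otimes>\<^bsub>N\<^esub>i\<in>{..<cn}. h (gY (cw i) y \<otimes>\<^bsub>TT\<^esub> gX (cx i) \<omega>) m)"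
      unfolding rel1_def finsum_def
      by (rule hom_finprod_lessThan[OF TT.a_comm_group cg hev[OF m]]) (use that in \<open>simp add: coev_closed\<close>)
    also have "\<dots> = (\<Otimes>\<^bsub>N\<^esub>i\<in>{..<cn}. Ya (cw i) y (Xa (cx i) \<omega> m))"
      by (rule N.M.finprod_cong')
        (use that m in \<open>auto simp: coev_closed ring_hom_mult[OF h] hx hy app Xa_closed Ya_closed simp del: del\<close>)
    finally show "h (rel1 y \<omega>) m = h (bba (y \<omega>)) m"
      using that m by (simp add: YX_rel hb dual_closed app)
  qed (use that in \<open>simp_all add: rel_closed dual_closed\<close>)
  have r2: "h (rel2 x \<omega>) = h (bel (x \<omega>))" if "x \<in> carrier XX" "\<omega> \<in> carrier \<Omega>" for x \<omega>
  proof (rule end_ring_eqI[OF hc hc])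
    fix m assume m: "m \<in> ?C"
    have "h (rel2 x \<omega>) m = (\<Otimes>\<^bsub>N\<^esub>j\<in>{..<dn}. h (gX x (dr j) \<otimes>\<^bsub>TT\<^esub> gY \<omega> (dy j)) m)"
      unfolding rel2_def finsum_def
      by (rule hom_finprod_lessThan[OF TT.a_comm_group cg hev[OF m]]) (use that in \<open>simp add: coev'_closed\<close>)
    also have "\<dots> = (\<Otimes>\<^bsub>N\<^esub>j\<in>{..<dn}. Xa x (dr j) (Ya \<omega> (dy j) m))"
      by (rule N.M.finprod_cong')
        (use that m in \<open>auto simp: coev'_closed ring_hom_mult[OF h] hx hy app Xa_closed Ya_closed simp del: del\<close>)
    finally show "h (rel2 x \<omega>) m = h (bel (x \<omega>)) m"
      using that m by (simp add: XY_rel hb dual_closed app)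
  qed (use that in \<open>simp_all add: rel_closed dual_closed\<close>)
  have h_minus: "h (s \<ominus>\<^bsub>TT\<^esub> t) = h s \<ominus>\<^bsub>?E\<^esub> h t" if "s \<in> carrier TT" "t \<in> carrier TT" for s t
    using that by (simp add: a_minus_def del: del)
  have rels: "h r = \<zero>\<^bsub>?E\<^esub>" if r: "r \<in> IB_rels K A \<Omega>" for r
  proof -
    consider y \<omega> where "y \<in> carrier YY" "\<omega> \<in> carrier \<Omega>" "r = rel1 y \<omega> \<ominus>\<^bsub>TT\<^esub> bba (y \<omega>)"
      | x \<omega> where "x \<in> carrier XX" "\<omega> \<in> carrier \<Omega>" "r = rel2 x \<omega> \<ominus>\<^bsub>TT\<^esub> bel (x \<omega>)"
      using r unfolding IB_rels_eq by blast
    then show ?thesis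
    proof cases
      case 1
      then show ?thesis
        using h_minus[of "rel1 y \<omega>" "bba (y \<omega>)"] hc[of "bba (y \<omega>)"]
        by (simp add: rel_closed dual_closed r1 E.minus_eq_zero_iff del: del)
    next
      case 2
      then show ?thesis
        using h_minus[of "rel2 x \<omega>" "bel (x \<omega>)"] hc[of "bel (x \<omega>)"]
        by (simp add: rel_closed dual_closed r2 E.minus_eq_zero_iff del: del)
    qed
  qed
  have "IB_rels K A \<Omega> \<subseteq> a_kernel TT ?E h"
    using IB_rels_closed rels unfolding a_kernel_def' by blast
  then have ker: "II \<subseteq> a_kernel TT ?E h"
    by (rule TT.genideal_minimal[OF h.kernel_is_ideal])
  \<comment> \<open>Elements with the same class differ by an element of the ideal, hence of the
    kernel; the choice of a representative below is therefore harmless.\<close>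
  have wd: "h s = h t" if st: "s \<in> carrier TT" "t \<in> carrier TT" "cl s = cl t" for s t
  proof -
    have "s \<ominus>\<^bsub>TT\<^esub> t \<in> a_kernel TT ?E h"
      using cl_eq_iff[OF st(1,2)] st(3) ker by (intro subsetD[OF ker]) (rule iffD1)
    then have "h s \<ominus>\<^bsub>?E\<^esub> h t = \<zero>\<^bsub>?E\<^esub>"
      unfolding a_kernel_def' h_minus[OF st(1,2), symmetric] by simp
    then show ?thesis
      using E.minus_eq_zero_iff[OF hc[OF st(1)] hc[OF st(2)]] by (rule iffD1[rotated])
  qed
  \<comment> \<open>A class acts through \<open>h\<close> of a chosen representative. The value
    \<open>undefined\<close> elsewhere gives extensionality of the action, while that of the
    addition is inherited from \<open>N\<close>.\<close>
  define N' :: "(('a, 'w) tz set, 'm) lmod" where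
    "N' = \<lparr>carrier = ?C, monoid.mult = monoid.mult N, one = one N,
      lact = (\<lambda>r m. if r \<in> carrier (IB K A \<Omega>) \<and> m \<in> ?C then h (SOME t. t \<in> carrier TT \<and> cl t = r) m else undefined)\<rparr>"
  have act: "cl t \<rightharpoonup>\<^bsub>N'\<^esub> m = h t m" if "t \<in> carrier TT" "m \<in> ?C" for t m
  proof -
    have "(SOME s. s \<in> carrier TT \<and> cl s = cl t) \<in> carrier TT \<and> cl (SOME s. s \<in> carrier TT \<and> cl s = cl t) = cl t"
      by (rule someI[of _ t]) (simp add: that)
    then have "h (SOME s. s \<in> carrier TT \<and> cl s = cl t) = h t"
      using wd that by blast
    then show ?thesis
      using that by (simp add: N'_def IB_carrier)
  qed
  have Ns: "carrier N' = ?C" "monoid.mult N' = monoid.mult N" "one N' = one N"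
    by (simp_all add: N'_def)
  have hm: "h t m \<in> ?C" "n \<in> ?C \<Longrightarrow> h t (m \<otimes>\<^bsub>N\<^esub> n) = h t m \<otimes>\<^bsub>N\<^esub> h t n"
    if "t \<in> carrier TT" "m \<in> ?C" for t m n
    using hc[OF that(1)] that by (auto simp: hom_def)
  have "left_mod (IB K A \<Omega>) N'"
  proof (intro left_mod.intro left_mod_axioms.intro IB_ring)
    show "comm_group N'"
      by (rule comm_group_cong[OF Ns cg])
  qed (auto simp: Ns IB_carrier act hm ring_hom_add[OF cl_hom, symmetric] ring_hom_mult[OF cl_hom, symmetric]
      ring_hom_one[OF cl_hom, symmetric] ring_hom_add[OF h] ring_hom_mult[OF h] ring_hom_one[OF h] simp del: del)
  moreover have "ext_lmod (IB K A \<Omega>) N'"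
    using ext by (auto simp: ext_lmod_def ext_bimod_def Ns extensional_def N'_def)
  ultimately show ?thesis
    using Ns by (intro exI[of _ N']) (simp add: act_def act hb hx hy app)
qed

end

section \<open>The isomorphism of categories\<close>

text \<open>With a bijection on objects and identical morphism sets, identities and composites, both
  functors can be taken to be the identity on morphisms. The category laws of \<open>D\<close> are
  transported from \<open>C\<close>, so they need no separate verification for
  intertwinings.\<close>

lemma isomorphic_via_bij:
  assumes C: "category C"
    and bij: "bij_betw Fo (Ob C) (Ob D)"
    and Hom: "\<And>X Y. \<lbrakk>X \<in> Ob C; Y \<in> Ob C\<rbrakk> \<Longrightarrow> Hom D (Fo X) (Fo Y) = Hom C X Y"
    and Id: "\<And>X. X \<in> Ob C \<Longrightarrow> Id D (Fo X) = Id C X"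
    and Comp: "\<And>X Y Z g f. \<lbrakk>X \<in> Ob C; Y \<in> Ob C; Z \<in> Ob C\<rbrakk>
      \<Longrightarrow> Comp D (Fo X) (Fo Y) (Fo Z) g f = Comp C X Y Z g f"
  shows "isomorphic_categories C D"
proof -
  interpret C: category C by fact
  define Go where "Go = inv_into (Ob C) Fo"
  have GF: "Go (Fo X) = X" if "X \<in> Ob C" for X
    using bij that by (simp add: Go_def bij_betw_inv_into_left)
  have FG: "Fo (Go Y) = Y" and G: "Go Y \<in> Ob C" if "Y \<in> Ob D" for Y
    using bij that by (auto simp: Go_def bij_betw_def f_inv_into_f inv_into_into)
  have F: "Fo X \<in> Ob D" if "X \<in> Ob C" for X
    using bij that by (auto simp: bij_betw_def)
  have Hom': "Hom D X Y = Hom C (Go X) (Go Y)" if "X \<in> Ob D" "Y \<in> Ob D" for X Y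
    using Hom[of "Go X" "Go Y"] that by (simp add: FG G)
  have Id': "Id D X = Id C (Go X)" if "X \<in> Ob D" for X
    using Id[of "Go X"] that by (simp add: FG G)
  have Comp': "Comp D X Y Z g f = Comp C (Go X) (Go Y) (Go Z) g f"
    if "X \<in> Ob D" "Y \<in> Ob D" "Z \<in> Ob D" for X Y Z g f
    using Comp[of "Go X" "Go Y" "Go Z"] that by (simp add: FG G)
  interpret D: category D
    by unfold_locales
      (simp_all add: Hom' Id' Comp' G C.Id_closed C.Comp_closed C.Id_left C.Id_right C.Comp_assoc)
  have "cat_functor C D Fo (\<lambda>_ _ f. f)"
    by unfold_locales (simp_all add: F Hom Id Comp)
  moreover have "cat_functor D C Go (\<lambda>_ _ f. f)"
    by unfold_locales (simp_all add: G Hom' Id' Comp')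
  ultimately show ?thesis
    unfolding isomorphic_categories_def
    by (intro exI[of _ Fo] exI[of _ "\<lambda>_ _ f. f"] exI[of _ Go]) (simp add: GF FG)
qed

lemma lmod_category: "category (lmod_cat R :: (('r, 'm) lmod, 'm \<Rightarrow> 'm) cat)"
proof
  fix X :: "('r, 'm) lmod" assume "X \<in> Ob (lmod_cat R)"
  then interpret left_mod R X
    by (simp add: lmod_cat_def)
  show "Id (lmod_cat R) X \<in> Hom (lmod_cat R) X X"
    by (auto simp: lmod_cat_def lmod_hom_def hom_def lact_closed)
next
  fix X Y Z :: "('r, 'm) lmod" and f g
  assume X: "X \<in> Ob (lmod_cat R)" and f: "f \<in> Hom (lmod_cat R) X Y" and g: "g \<in> Hom (lmod_cat R) Y Z"
  interpret left_mod R X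
    using X by (simp add: lmod_cat_def)
  show "Comp (lmod_cat R) X Y Z g f \<in> Hom (lmod_cat R) X Z"
    using f g by (auto simp: lmod_cat_def lmod_hom_def hom_def compose_def lact_closed Pi_iff)
next
  fix X Y Z U :: "('r, 'm) lmod" and f g h
  assume "f \<in> Hom (lmod_cat R) X Y"
  then show "Comp (lmod_cat R) X Z U h (Comp (lmod_cat R) X Y Z g f)
    = Comp (lmod_cat R) X Y U (Comp (lmod_cat R) Y Z U h g) f"
    by (auto simp: lmod_cat_def lmod_hom_def hom_def compose_def Pi_iff fun_eq_iff restrict_def)
next
  fix X Y :: "('r, 'm) lmod" and f
  assume f: "f \<in> Hom (lmod_cat R) X Y"
  then have "f \<in> extensional (carrier X)" "\<And>m. m \<in> carrier X \<Longrightarrow> f m \<in> carrier Y"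
    by (auto simp: lmod_cat_def lmod_hom_def hom_def)
  then show "Comp (lmod_cat R) X Y Y (Id (lmod_cat R) Y) f = f"
    "Comp (lmod_cat R) X X Y f (Id (lmod_cat R) X) = f"
    by (auto simp: lmod_cat_def compose_def intro!: extensionalityI[of _ "carrier X"])
qed

context fgp_bimodule begin

definition IB_to_IM :: "(('a, 'w) tz set, 'm) lmod \<Rightarrow> ('a, 'w, 'm) intertwining" where
  "IB_to_IM N = (under N, gen_module.sg A \<Omega> (under N) (\<lambda>x \<omega>. act N (gX x \<omega>)))"

lemma IB_to_IM_closed:
  assumes "N \<in> Ob (lmod_cat (IB K A \<Omega>))"
  shows "IB_to_IM N \<in> Ob (IM_cat K A \<Omega>)"
proof -
  have N: "left_mod (IB K A \<Omega>) N" "ext_lmod (IB K A \<Omega>) N"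
    using assms by (auto simp: lmod_cat_def)
  interpret G: gen_module K A \<Omega> "under N" "\<lambda>x \<omega>. act N (gX x \<omega>)" "\<lambda>\<omega> y. act N (gY \<omega> y)"
    by (rule under_gen_module[OF N(1)])
  have "ext_bimod A (under N)"
    using N(2) by (auto simp: ext_bimod_def ext_lmod_def extensional_def under_def)
  then show ?thesis
    using G.sg_inv_bimod_hom G.N.bimodule_axioms by (simp add: IB_to_IM_def IM_cat_def)
qed

text \<open>The elements of \<open>TT\<close> whose action commutes with \<open>f\<close> are closed
  under products and differences, so it suffices to test the four families of generators. With
  \<open>f\<close> the identity this compares two module structures on one group; in general it
  recognises module maps.\<close>

lemma act_eqI:
  assumes "left_mod (IB K A \<Omega>) N" "left_mod (IB K A \<Omega>) N'" "f \<in> hom N N'"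
    and "\<And>a m. \<lbrakk>a \<in> carrier A; m \<in> carrier N\<rbrakk> \<Longrightarrow> f (act N (bel a) m) = act N' (bel a) (f m)"
    and "\<And>a m. \<lbrakk>a \<in> carrier A; m \<in> carrier N\<rbrakk> \<Longrightarrow> f (act N (bba a) m) = act N' (bba a) (f m)"
    and "\<And>x \<omega> m. \<lbrakk>x \<in> carrier XX; \<omega> \<in> carrier \<Omega>; m \<in> carrier N\<rbrakk> \<Longrightarrow> f (act N (gX x \<omega>) m) = act N' (gX x \<omega>) (f m)"
    and "\<And>\<omega> y m. \<lbrakk>\<omega> \<in> carrier \<Omega>; y \<in> carrier YY; m \<in> carrier N\<rbrakk> \<Longrightarrow> f (act N (gY \<omega> y) m) = act N' (gY \<omega> y) (f m)"
    and "t \<in> carrier TT" "m \<in> carrier N"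
  shows "f (act N t m) = act N' t (f m)"
proof -
  interpret N: left_mod "IB K A \<Omega>" N by fact
  interpret N': left_mod "IB K A \<Omega>" N' by fact
  interpret f: group_hom N N' f
    using assms(3) by (simp add: group_hom_def group_hom_axioms_def N.M.is_group N'.M.is_group)
  have "\<forall>m\<in>carrier N. f (act N t m) = act N' t (f m)"
    using assms(8)
  proof (induction t rule: TT_induct)
    case (mult s t)
    then show ?case
      by (simp add: act_simps[OF assms(1)] act_simps[OF assms(2)])
  next
    case (diff s t)
    then show ?case
      by (simp add: act_minus[OF assms(1)] act_minus[OF assms(2)] act_simps[OF assms(1)])
  qed (simp_all add: assms(4-7))
  then show ?thesis
    using assms(9) by blast
qed

text \<open>The bimodule fixes the action of \<open>A^e\<close>, evaluation of \<sigma> recovers the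
  generators \<open>(x, \<omega>)\<close>, and evaluation of its inverse the generators
  \<open>(\<rho>, y)\<close>. Together these determine the action of the whole algebra.\<close>

lemma IB_to_IM_inj: "inj_on IB_to_IM (Ob (lmod_cat (IB K A \<Omega>)))"
proof (rule inj_onI)
  fix N N' :: "(('a, 'w) tz set, 'm) lmod"
  assume "N \<in> Ob (lmod_cat (IB K A \<Omega>))" "N' \<in> Ob (lmod_cat (IB K A \<Omega>))" and eq: "IB_to_IM N = IB_to_IM N'"
  then have N: "left_mod (IB K A \<Omega>) N" "ext_lmod (IB K A \<Omega>) N"
    and N': "left_mod (IB K A \<Omega>) N'" "ext_lmod (IB K A \<Omega>) N'"
    by (auto simp: lmod_cat_def)
  have U: "under N = under N'"
    using eq by (simp add: IB_to_IM_def)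
  interpret G: gen_module K A \<Omega> "under N" "\<lambda>x \<omega>. act N (gX x \<omega>)" "\<lambda>\<omega> y. act N (gY \<omega> y)"
    by (rule under_gen_module[OF N(1)])
  interpret G': gen_module K A \<Omega> "under N" "\<lambda>x \<omega>. act N' (gX x \<omega>)" "\<lambda>\<omega> y. act N' (gY \<omega> y)"
    unfolding U by (rule under_gen_module[OF N'(1)])
  have sg: "G.sg = G'.sg"
    using eq by (simp add: IB_to_IM_def U)
  \<comment> \<open>Both maps invert the same \<sigma>, hence they agree.\<close>
  have sg': "G.sg' u = G'.sg' u" if "u \<in> carrier G.P2" for u
    using that G'.sg'_sg[of "G.sg' u"] G.sg'_closed[OF that] G.sg_sg'[OF that] by (simp add: sg)
  have c: "carrier N = carrier N'" "monoid.mult N = monoid.mult N'" "one N = one N'"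
    using arg_cong[OF U, of carrier] arg_cong[OF U, of monoid.mult] arg_cong[OF U, of one] by simp_all
  have l: "a \<rightharpoonup>\<^bsub>under N\<^esub> m = a \<rightharpoonup>\<^bsub>under N'\<^esub> m" "m \<leftharpoonup>\<^bsub>under N\<^esub> a = m \<leftharpoonup>\<^bsub>under N'\<^esub> a" for a m
    by (simp_all add: U)
  have act: "act N t m = act N' t m" if "t \<in> carrier TT" "m \<in> carrier N" for t m
  proof (rule act_eqI[OF N(1) N'(1), of "\<lambda>m. m"])
    show "(\<lambda>m. m) \<in> hom N N'"
      by (auto simp: hom_def c)
    show "act N (bel a) m = act N' (bel a) m" "act N (bba a) m = act N' (bba a) m"
      if "a \<in> carrier A" "m \<in> carrier N" for a m
      using l(1)[of a m] l(2)[of m a] that c by simp_all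
    show "act N (gX x \<omega>) m = act N' (gX x \<omega>) m"
      if "x \<in> carrier XX" "\<omega> \<in> carrier \<Omega>" "m \<in> carrier N" for x \<omega> m
      using that G.EV_sg[of x m \<omega>] G'.EV_sg[of x m \<omega>] by (simp add: sg)
    show "act N (gY \<omega> y) m = act N' (gY \<omega> y) m"
      if "\<omega> \<in> carrier \<Omega>" "y \<in> carrier YY" "m \<in> carrier N" for y \<omega> m
      using that G.EV'_sg'[of y m \<omega>] G'.EV'_sg'[of y m \<omega>] by (simp add: sg')
  qed (use that in auto)
  have "lact N r m = lact N' r m" for r m
  proof (cases "r \<in> carrier (IB K A \<Omega>) \<and> m \<in> carrier N")
    case True
    then show ?thesis
      using act by (auto simp: IB_carrier act_def)
  next
    \<comment> \<open>Off the carriers both actions are \<open>undefined\<close>; this upgrades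
      agreement on elements to equality of the records.\<close>
    case False
    then show ?thesis
      using N(2) N'(2) c(1) by (auto simp: ext_lmod_def extensional_def)
  qed
  then show "N = N'"
    using c by (intro lmod.equality) (auto simp: fun_eq_iff)
qed

text \<open>The operators extracted from \<sigma> yield a module \<open>N\<close>. Rebuilding the
  intertwining from \<open>N\<close> returns \<sigma>, because both have the same evaluations on
  pure tensors.\<close>

lemma IB_to_IM_surj:
  fixes P :: "('a, 'w, 'm) intertwining"
  assumes "P \<in> Ob (IM_cat K A \<Omega>)"
  shows "P \<in> IB_to_IM ` Ob (lmod_cat (IB K A \<Omega>))"
proof -
  obtain M \<sigma> where P: "P = (M, \<sigma>)"
    by (cases P)
  have M: "bimodule K A M" "ext_bimod A M" "\<sigma> \<in> inv_bimod_hom A (tensA A M \<Omega>) (tensA A \<Omega> M)"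
    using assms by (auto simp: P IM_cat_def)
  interpret M: bimodule K A M by fact
  interpret O: omega_pair K A \<Omega> M ..
  obtain Xa Ya where G: "gen_module K A \<Omega> M Xa Ya" "gen_module.sg A \<Omega> M Xa = \<sigma>"
    by (rule O.intertwining_gen_module[OF M(3)])
  interpret G: gen_module K A \<Omega> M Xa Ya by (rule G(1))
  obtain N :: "(('a, 'w) tz set, 'm) lmod" where N: "left_mod (IB K A \<Omega>) N" "ext_lmod (IB K A \<Omega>) N"
    and c: "carrier N = carrier M" "monoid.mult N = monoid.mult M" "one N = one M"
    and ab: "\<And>a m. \<lbrakk>a \<in> carrier A; m \<in> carrier M\<rbrakk> \<Longrightarrow> act N (bel a) m = a \<rightharpoonup>\<^bsub>M\<^esub> m"
      "\<And>a m. \<lbrakk>a \<in> carrier A; m \<in> carrier M\<rbrakk> \<Longrightarrow> act N (bba a) m = m \<leftharpoonup>\<^bsub>M\<^esub> a"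
    and aX: "\<And>x \<omega> m. \<lbrakk>x \<in> carrier XX; \<omega> \<in> carrier \<Omega>; m \<in> carrier M\<rbrakk> \<Longrightarrow> act N (gX x \<omega>) m = Xa x \<omega> m"
    using G.exists_IB_module[OF M(2)] by blast
  \<comment> \<open>This is an equality of records and not merely an isomorphism: on the carriers
    the actions agree by construction, and elsewhere both are \<open>undefined\<close>.\<close>
  have U: "under N = M"
  proof -
    have "lact (under N) a m = lact M a m" for a m
      using M(2) by (cases "a \<in> carrier A \<and> m \<in> carrier M")
        (auto simp: under_def c ab ext_bimod_def ext_lmod_def extensional_def)
    moreover have "ract (under N) m a = ract M m a" for a m
      using M(2) by (cases "a \<in> carrier A \<and> m \<in> carrier M")
        (auto simp: under_def c ab ext_bimod_def ext_lmod_def extensional_def)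
    ultimately show ?thesis
      using c by (intro bimod.equality) (auto simp: fun_eq_iff)
  qed
  interpret H: gen_module K A \<Omega> M "\<lambda>x \<omega>. act N (gX x \<omega>)" "\<lambda>\<omega> y. act N (gY \<omega> y)"
    using under_gen_module[OF N(1)] by (simp add: U)
  have \<sigma>: "\<sigma> \<in> bimod_hom A (tensA A M \<Omega>) (tensA A \<Omega> M)"
    using M(3) unfolding inv_bimod_hom_def by simp
  have "H.sg = \<sigma>"
    by (rule H.sg_eqI[OF \<sigma>]) (simp add: G(2)[symmetric] G.EV_sg aX)
  then have "IB_to_IM N = P"
    by (simp add: IB_to_IM_def P U)
  moreover have "N \<in> Ob (lmod_cat (IB K A \<Omega>))"
    using N by (simp add: lmod_cat_def)
  ultimately show ?thesis
    by blast
qed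

text \<open>A map linear over \<open>IB\<close> is one that commutes with the four families of
  generators. Those from \<open>A\<close> and its bars give bimodule maps, and the other two give
  the intertwining condition by \<open>intertwine_iff\<close>.\<close>

lemma IB_to_IM_Hom:
  assumes "N \<in> Ob (lmod_cat (IB K A \<Omega>))" "N' \<in> Ob (lmod_cat (IB K A \<Omega>))"
  shows "Hom (IM_cat K A \<Omega>) (IB_to_IM N) (IB_to_IM N') = Hom (lmod_cat (IB K A \<Omega>)) N N'"
proof -
  have N: "left_mod (IB K A \<Omega>) N" and N': "left_mod (IB K A \<Omega>) N'"
    using assms by (auto simp: lmod_cat_def)
  note G = under_gen_module[OF N] and G' = under_gen_module[OF N']
  have iff: "f \<in> lmod_hom (IB K A \<Omega>) N N' \<longleftrightarrow> f \<in> bimod_hom A (under N) (under N')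
    \<and> (\<forall>x\<in>carrier XX. \<forall>\<omega>\<in>carrier \<Omega>. \<forall>m\<in>carrier N. f (act N (gX x \<omega>) m) = act N' (gX x \<omega>) (f m))
    \<and> (\<forall>y\<in>carrier YY. \<forall>\<omega>\<in>carrier \<Omega>. \<forall>m\<in>carrier N. f (act N (gY \<omega> y) m) = act N' (gY \<omega> y) (f m))"
    (is "?L \<longleftrightarrow> ?R") for f
  proof
    assume L: ?L
    then have act: "f (act N t m) = act N' t (f m)" if "t \<in> carrier TT" "m \<in> carrier N" for t m
      using that ring_hom_closed[OF cl_hom] by (simp add: lmod_hom_def act_def)
    have "f m \<in> carrier N'" if "m \<in> carrier N" for m
      using L that by (auto simp: lmod_hom_def hom_def)
    then show ?R
      using L act by (auto simp: bimod_hom_def lmod_hom_def rmod_hom_def hom_under)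
  next
    assume R: ?R
    then have f: "f \<in> hom N N'" "f \<in> extensional (carrier N)"
      by (simp_all add: bimod_hom_def lmod_hom_def hom_under)
    note fc = hom_in_carrier[OF f(1)]
    have "f (act N t m) = act N' t (f m)" if "t \<in> carrier TT" "m \<in> carrier N" for t m
    proof (rule act_eqI[OF N N' f(1)])
      show "f (act N (bel a) m) = act N' (bel a) (f m)" "f (act N (bba a) m) = act N' (bba a) (f m)"
        if "a \<in> carrier A" "m \<in> carrier N" for a m
        using R that fc[OF that(2)] by (simp_all add: bimod_hom_def lmod_hom_def rmod_hom_def)
    qed (use R that in auto)
    then show ?L
      using f by (auto simp: lmod_hom_def IB_carrier act_def)
  qed
  show ?thesis
  proof (rule Set.set_eqI)
    fix f
    have "f \<in> Hom (IM_cat K A \<Omega>) (IB_to_IM N) (IB_to_IM N') \<longleftrightarrow> f \<in> bimod_hom A (under N) (under N')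
      \<and> (\<forall>t\<in>carrier (tensA A (under N) \<Omega>).
          gen_module.sg A \<Omega> (under N') (\<lambda>x \<omega>. act N' (gX x \<omega>)) (tensA_map A (under N') \<Omega> f (\<lambda>\<omega>. \<omega>) t)
          = tensA_map A \<Omega> (under N') (\<lambda>\<omega>. \<omega>) f (gen_module.sg A \<Omega> (under N) (\<lambda>x \<omega>. act N (gX x \<omega>)) t))"
      by (simp add: IM_cat_def IB_to_IM_def)
    also have "\<dots> \<longleftrightarrow> f \<in> lmod_hom (IB K A \<Omega>) N N'"
      unfolding iff by (rule conj_cong[OF refl]) (simp add: intertwine_iff[OF G G'])
    finally show "f \<in> Hom (IM_cat K A \<Omega>) (IB_to_IM N) (IB_to_IM N') \<longleftrightarrow> f \<in> Hom (lmod_cat (IB K A \<Omega>)) N N'"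
      by (simp add: lmod_cat_def)
  qed
qed

lemma IB_IM_isomorphic:
  "isomorphic_categories
     (lmod_cat (IB K A \<Omega>) :: ((('a, 'w) tz set, 'm) lmod, 'm \<Rightarrow> 'm) cat)
     (IM_cat K A \<Omega> :: (('a, 'w, 'm) intertwining, 'm \<Rightarrow> 'm) cat)"
proof (rule isomorphic_via_bij[where Fo = IB_to_IM, OF lmod_category])
  show "bij_betw IB_to_IM (Ob (lmod_cat (IB K A \<Omega>)))
      (Ob (IM_cat K A \<Omega> :: (('a, 'w, 'm) intertwining, 'm \<Rightarrow> 'm) cat))"
    unfolding bij_betw_def using IB_to_IM_inj IB_to_IM_closed IB_to_IM_surj by blast
  show "Hom (IM_cat K A \<Omega>) (IB_to_IM X) (IB_to_IM Y) = Hom (lmod_cat (IB K A \<Omega>)) X Y"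
    if "X \<in> Ob (lmod_cat (IB K A \<Omega>))" "Y \<in> Ob (lmod_cat (IB K A \<Omega>))"
    for X Y :: "(('a, 'w) tz set, 'm) lmod"
    by (rule IB_to_IM_Hom[OF that])
qed (simp_all add: IM_cat_def lmod_cat_def IB_to_IM_def)

end

theorem theorem4p3:
  fixes K :: "'k ring" and A :: "('k, 'a) module" and \<Omega> :: "('a, 'a, 'w) bimod"
  assumes "k_algebra K A"
    and "bimodule K A \<Omega>"
    and "fgp_right A \<Omega>"
    and "fgp_left A \<Omega>"
  shows "isomorphic_categories
           (lmod_cat (IB K A \<Omega>) :: ((('a, 'w) tz set, 'm) lmod, 'm \<Rightarrow> 'm) cat)
           (IM_cat K A \<Omega> :: (('a, 'w, 'm) intertwining, 'm \<Rightarrow> 'm) cat)"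
  by (rule fgp_bimodule.IB_IM_isomorphic)
    (intro fgp_bimodule.intro fgp_bimodule_axioms.intro assms)

end
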